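(* Let $\phi$ be a symbol of Szegő type on the unit circle $\mathbb{T}$. Let $m$ be a nonnegative integer, let $a_0,a_1,b_0,\dots,b_m,\hat a_0,\hat a_1,\hat b_0,\dots,\hat b_m\in\mathbb{C}$, let $c_1,\dots,c_m\in\mathbb{C}$ be nonzero with $|c_j|\neq 1$, and put $$q_1(z)=a_0+a_1z+\frac{b_0}{z}+\sum_{j=1}^m\frac{b_jz}{z-c_j},\qquad q_2(z)=\hat a_0+\hat a_1z+\frac{\hat b_0}{z}+\sum_{j=1}^m\frac{\hat b_j}{z-c_j},\qquad \psi(z)=q_1(z)\phi(z)+q_2(z).$$ Then there is a constant $\mathfrak{c}>0$ such that, as $N\to\infty$, $$D^B_N[\phi;\psi]=G[\phi]^N E[\phi]\left(F[\phi;\psi]+O(e^{-\mathfrak{c}N})\right),$$ where $$F[\phi;\psi]=a_0+b_0[\log\phi]_1+\sum_{\substack{1\le j\le m\\ 0<|c_j|<1}}b_j\frac{\alpha(c_j)}{\alpha(0)}+\frac{1}{\alpha(0)}\left(\hat a_0-\hat a_1[\log\phi]_{-1}-\sum_{\substack{1\le j\le m\\ |c_j|>1}}\frac{\hat b_j}{c_j}\alpha(c_j)\right).$$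
   Context: $\mathbb{T}=\{z\in\mathbb{C}:|z|=1\}$, positively oriented. For $f\in L^1(\mathbb{T})$, $f_n=[f]_n=\int_{\mathbb{T}}z^{-n}f(z)\frac{dz}{2\pi i z}$ denotes the $n$-th Fourier coefficient. The bordered Toeplitz determinant is, for $N>1$, $$D^B_N[\phi;\psi]=\det\begin{pmatrix}\phi_0&\cdots&\phi_{N-2}&\psi_{N-1}\\ \phi_{-1}&\cdots&\phi_{N-3}&\psi_{N-2}\\ \vdots&&\vdots&\vdots\\ \phi_{1-N}&\cdots&\phi_{-1}&\psi_0\end{pmatrix},$$ i.e. with rows and columns indexed by $0,\dots,N-1$, the $(j,k)$ entry is $\phi_{k-j}$ for $k\le N-2$ and $\psi_{N-1-j}$ for $k=N-1$. A symbol $\phi$ is of Szegő type if it is smooth and nonzero on $\mathbb{T}$, has winding number zero, and admits an analytic continuation to a neighborhood of $\mathbb{T}$. $\log\phi=\ln\phi$ denotes a continuous logarithm of $\phi$ on $\mathbb{T}$, and $$G[\phi]=\exp([\log\phi]_0),\qquad E[\phi]=\exp\Big(\sum_{n\ge1}n[\log\phi]_n[\log\phi]_{-n}\Big),\qquad \alpha(z)=\exp\left[\frac{1}{2\pi i}\int_{\mathbb{T}}\frac{\ln\phi(\tau)}{\tau-z}\,d\tau\right]\ (z\notin\mathbb{T}).$$ *)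

theory Defs
  imports "HOL-Complex_Analysis.Complex_Analysis" "HOL-Library.Landau_Symbols"
    "Jordan_Normal_Form.Determinant"
begin

text \<open>Functions on the unit circle are represented as total functions on \<^typ>\<open>complex\<close>;
  only their values on \<^term>\<open>sphere (0 :: complex) 1\<close> are ever used.\<close>

definition fourier_coeff :: "(complex \<Rightarrow> complex) \<Rightarrow> int \<Rightarrow> complex" where
  "fourier_coeff f n =
     contour_integral (circlepath 0 1) (\<lambda>z. z powi (-n) * f z / (2 * of_real pi * \<i> * z))"

definition bordered_toeplitz_det ::
  "nat \<Rightarrow> (complex \<Rightarrow> complex) \<Rightarrow> (complex \<Rightarrow> complex) \<Rightarrow> complex" where
  "bordered_toeplitz_det N \<phi> \<psi> =
     Determinant.det (Matrix.mat N N (\<lambda>(j, k).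
       if k = N - 1 then fourier_coeff \<psi> (int N - 1 - int j)
       else fourier_coeff \<phi> (int k - int j)))"

text \<open>Smoothness is meant in the angular variable: all iterated derivatives of
  \<open>t \<mapsto> \<phi>(e\<^sup>i\<^sup>t)\<close> exist.\<close>

definition smooth_on_circle :: "(complex \<Rightarrow> complex) \<Rightarrow> bool" where
  "smooth_on_circle \<phi> \<longleftrightarrow>
     (\<forall>n. ((\<lambda>f t. vector_derivative f (at t)) ^^ n) (\<lambda>t::real. \<phi> (cis t)) differentiable_on UNIV)"

definition szego_type :: "(complex \<Rightarrow> complex) \<Rightarrow> bool" where
  "szego_type \<phi> \<longleftrightarrow>
     smooth_on_circle \<phi> \<and>
     (\<forall>z\<in>sphere 0 1. \<phi> z \<noteq> 0) \<and>
     winding_number (\<phi> \<circ> circlepath 0 1) 0 = 0 \<and>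
     (\<exists>U g. open U \<and> sphere 0 1 \<subseteq> U \<and> g holomorphic_on U \<and> (\<forall>z\<in>sphere 0 1. g z = \<phi> z))"

text \<open>Two continuous logarithms on the circle differ by a constant in \<open>2\<pi>i\<int>\<close>, so the choice
  made here affects none of \<open>G\<close>, \<open>E\<close>, \<open>\<alpha>\<close> below, nor the Fourier coefficients of the
  logarithm of index different from \<open>0\<close>.\<close>

definition circle_log :: "(complex \<Rightarrow> complex) \<Rightarrow> complex \<Rightarrow> complex" where
  "circle_log \<phi> =
     (SOME L. continuous_on (sphere 0 1) L \<and> (\<forall>z\<in>sphere 0 1. exp (L z) = \<phi> z))"

definition szego_G :: "(complex \<Rightarrow> complex) \<Rightarrow> complex" where
  "szego_G \<phi> = exp (fourier_coeff (circle_log \<phi>) 0)"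

definition szego_E :: "(complex \<Rightarrow> complex) \<Rightarrow> complex" where
  "szego_E \<phi> =
     exp (\<Sum>n. of_nat (Suc n) * fourier_coeff (circle_log \<phi>) (int (Suc n))
                              * fourier_coeff (circle_log \<phi>) (- int (Suc n)))"

definition szego_alpha :: "(complex \<Rightarrow> complex) \<Rightarrow> complex \<Rightarrow> complex" where
  "szego_alpha \<phi> z =
     exp (1 / (2 * of_real pi * \<i>) *
          contour_integral (circlepath 0 1) (\<lambda>\<tau>. circle_log \<phi> \<tau> / (\<tau> - z)))"

end

theory Submission
  imports Defs "HOL-Real_Asymp.Real_Asymp"
begin

text \<open>
  Write \<open>\<phi> = G f\<^sub>+ f\<^sub>-\<close> on the circle with \<open>f\<^sub>+(z) = exp (A z)\<close> and \<open>f\<^sub>-(z) = exp (B (1/z))\<close>, where \<open>A\<close> and \<open>B\<close> are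
  holomorphic on a disc of radius greater than 1 and vanish at 0. After reversing both index ranges, the
  \<open>N \<times> N\<close> Toeplitz matrix of \<open>f\<^sub>+ f\<^sub>-\<close> is \<open>T = L U + H\<close> with unitriangular Toeplitz matrices \<open>L\<close>, \<open>U\<close> and a
  Hankel-type matrix \<open>H\<close> decaying exponentially away from the corner (0, 0). Hence
  \<open>det T = det (I + L\<^sup>-\<^sup>1 H U\<^sup>-\<^sup>1)\<close>, and as the entries of \<open>L\<^sup>-\<^sup>1 H U\<^sup>-\<^sup>1\<close> do not depend on \<open>N\<close>, the determinants
  converge exponentially fast to a limit \<open>S\<close>.

  The limit is multiplicative in \<open>f\<^sub>+\<close> and in \<open>f\<^sub>-\<close> separately. Replacing \<open>A\<close>, \<open>B\<close> by \<open>A/n\<close>, \<open>B/n\<close> therefore turns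
  \<open>S\<close> into its \<open>n\<^sup>2\<close>-th root, which equals \<open>1 + \<kappa>/n\<^sup>2 + O(1/n\<^sup>3)\<close> with \<open>\<kappa> = \<Sum> k A\<^sub>k B\<^sub>k\<close>; so \<open>S = exp \<kappa> = E\<close>.

  For the bordered determinant the reversed border is the first column. If \<open>x\<close> solves the semi-infinite
  Toeplitz system with right-hand side \<open>\<psi>\<^sub>0, \<psi>\<^sub>1, \<dots>\<close>, then up to an exponentially small column the border is the
  combination of the columns of \<open>T\<close> with coefficients \<open>x\<close>, so the determinant is \<open>x\<^sub>0 det T\<close> up to an
  exponentially small error. Back substitution gives \<open>x\<^sub>0 = [\<psi> / f\<^sub>-]\<^sub>0 / G\<close>, which evaluates to \<open>F\<close>.
\<close>

section \<open>Determinants of finite sections\<close>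

text \<open>Two orders of the triangular factors compete. With the lower factor first, a finite
  section of the product is the product of the finite sections, so \<open>L U\<close> has
  determinant exactly 1 and can be cancelled exactly; the price is the Hankel defect. With the upper
  factor first, the semi-infinite Toeplitz matrix factors without defect, which solves infinite
  systems; the price is a truncation error at the corner (n, n). Reversing the indices puts the
  border in column 0, so truncating the system costs only the tail of a decaying solution.
  Multiplicativity rests on the second order: \<open>U\<^sub>1 U\<^sub>2 L = (U\<^sub>1 L)
  L\<^sup>-\<^sup>1 (U\<^sub>2 L)\<close>, where the middle factor has determinant 1. The limit is
  never treated as an operator determinant. Only finite determinants of \<open>I + K\<close> are
  compared, by bounds in which the size n enters solely through norms of \<open>K\<close>, and these
  stay bounded because the entries of \<open>K\<close> decay geometrically in both indices. Taking
  \<open>n\<^sup>2\<close>-th roots moves the evaluation of the limit to small exponents, where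
  \<open>K\<close> is quadratically small and the trace alone decides.\<close>

text \<open>Matrices of varying size are functions on all pairs of indices; the operations with argument \<open>n\<close>
  only see the leading \<open>n \<times> n\<close> block.\<close>

definition fdet :: "nat \<Rightarrow> (nat \<Rightarrow> nat \<Rightarrow> complex) \<Rightarrow> complex" where
  "fdet n f = Determinant.det (Matrix.mat n n (\<lambda>(j, k). f j k))"

definition fmul :: "nat \<Rightarrow> (nat \<Rightarrow> nat \<Rightarrow> complex) \<Rightarrow> (nat \<Rightarrow> nat \<Rightarrow> complex) \<Rightarrow> nat \<Rightarrow> nat \<Rightarrow> complex" where
  "fmul n f g = (\<lambda>j k. \<Sum>l<n. f j l * g l k)"

definition fone :: "nat \<Rightarrow> nat \<Rightarrow> complex" where
  "fone j k = (if j = k then 1 else 0)"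

text \<open>The entrywise sum is submultiplicative, is the sum of the row sums that occur in
  determinant bounds, and stays bounded in \<open>n\<close> for entries decaying geometrically in
  both indices.\<close>

definition fnorm :: "nat \<Rightarrow> (nat \<Rightarrow> nat \<Rightarrow> complex) \<Rightarrow> real" where
  "fnorm n f = (\<Sum>j<n. \<Sum>k<n. norm (f j k))"

lemma fdet_cong:
  assumes "\<And>j k. j < n \<Longrightarrow> k < n \<Longrightarrow> f j k = g j k"
  shows "fdet n f = fdet n g"
  unfolding fdet_def by (rule arg_cong[where f = Determinant.det]) (auto intro!: eq_matI simp: assms)

lemma fdet_fmul: "fdet n (fmul n f g) = fdet n f * fdet n g"
proof -
  have "Matrix.mat n n (\<lambda>(j, k). fmul n f g j k)
      = Matrix.mat n n (\<lambda>(j, k). f j k) * Matrix.mat n n (\<lambda>(j, k). g j k)"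
    by (rule eq_matI) (auto simp: fmul_def scalar_prod_def atLeast0LessThan intro!: sum.cong)
  then show ?thesis
    unfolding fdet_def by (simp add: det_mult[where n = n])
qed

lemma fdet_transpose: "fdet n (\<lambda>j k. f k j) = fdet n f"
proof -
  have "Matrix.mat n n (\<lambda>(j, k). f k j) = transpose_mat (Matrix.mat n n (\<lambda>(j, k). f j k))"
    by (rule eq_matI) auto
  then show ?thesis
    unfolding fdet_def by (simp add: det_transpose[where n = n])
qed

lemma fdet_leibniz: "fdet n f = (\<Sum>p | p permutes {0..<n}. signof p * (\<Prod>i<n. f i (p i)))"
proof -
  have "(\<Prod>i = 0..<n. Matrix.mat n n (\<lambda>(j, k). f j k) $$ (i, p i)) = (\<Prod>i<n. f i (p i))"
    if "p permutes {0..<n}" for p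
    unfolding atLeast0LessThan[symmetric]
    using that by (intro prod.cong) (auto dest: permutes_in_image)
  then show ?thesis
    unfolding fdet_def by (subst det_def'[where n = n]) (auto intro!: sum.cong)
qed

lemma fdet_scale: "fdet n (\<lambda>j k. c * f j k) = c ^ n * fdet n f"
  by (simp add: fdet_leibniz prod.distrib sum_distrib_left mult_ac)

text \<open>Rows and columns undergo the same permutation, so its sign enters twice and cancels.
  This carries a border in the last column to the first one.\<close>

lemma fdet_reverse: "fdet n (\<lambda>j k. f (n - 1 - j) (n - 1 - k)) = fdet n f"
proof -
  define p where "p = (\<lambda>i. if i < n then n - 1 - i else i)"
  have "p (p x) = x" for x
    unfolding p_def by (cases "x < n") auto
  then have p: "p permutes {0..<n}"
    unfolding permutes_def by (metis p_def atLeastLessThan_iff le0)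
  have row: "fdet n (\<lambda>j k. g (p j) k) = signof p * fdet n g" for g
  proof -
    have "Matrix.mat n n (\<lambda>(i, j). Matrix.mat n n (\<lambda>(j, k). g j k) $$ (p i, j)) = Matrix.mat n n (\<lambda>(j, k). g (p j) k)"
      by (rule eq_matI) (auto simp: p_def)
    then show ?thesis
      using det_permute_rows[OF mat_carrier p, of "\<lambda>(j, k). g j k"]
      unfolding fdet_def by simp
  qed
  have "fdet n (\<lambda>j k. f (n - 1 - j) (n - 1 - k)) = fdet n (\<lambda>j k. f (p j) (p k))"
    by (rule fdet_cong) (auto simp: p_def)
  also have "\<dots> = signof p * fdet n (\<lambda>j k. f j (p k))"
    by (rule row)
  also have "fdet n (\<lambda>j k. f j (p k)) = fdet n (\<lambda>j k. f k (p j))"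
    by (rule fdet_transpose[symmetric])
  also have "\<dots> = signof p * fdet n (\<lambda>j k. f k j)"
    by (rule row)
  also have "fdet n (\<lambda>j k. f k j) = fdet n f"
    by (rule fdet_transpose)
  finally show ?thesis
    using p by (simp add: sign_def)
qed

lemma fdet_lower_triangular:
  assumes "\<And>j k. j < k \<Longrightarrow> f j k = 0"
  shows "fdet n f = (\<Prod>i<n. f i i)"
proof -
  have "fdet n f = prod_list (diag_mat (Matrix.mat n n (\<lambda>(j, k). f j k)))"
    unfolding fdet_def using assms by (intro det_lower_triangular[where n = n]) auto
  also have "\<dots> = (\<Prod>i<n. f i i)"
    by (simp add: prod_list_diag_prod lessThan_atLeast0)
  finally show ?thesis .
qed

lemma fdet_upper_triangular:
  assumes "\<And>j k. k < j \<Longrightarrow> f j k = 0"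
  shows "fdet n f = (\<Prod>i<n. f i i)"
proof -
  have "fdet n f = fdet n (\<lambda>j k. f k j)"
    by (rule fdet_transpose[symmetric])
  also have "\<dots> = (\<Prod>i<n. f i i)"
    by (rule fdet_lower_triangular) (rule assms)
  finally show ?thesis .
qed

section \<open>Comparing determinants row by row\<close>

lemma prod_diff_telescope:
  fixes a b :: "nat \<Rightarrow> 'a::comm_ring_1"
  shows "(\<Prod>i<n. a i) - (\<Prod>i<n. b i) =
    (\<Sum>i<n. \<Prod>j<n. if j < i then a j else if j = i then a j - b j else b j)"
proof (induction n)
  case (Suc n)
  have "(\<Prod>j<Suc n. if j < i then a j else if j = i then a j - b j else b j)
      = (\<Prod>j<n. if j < i then a j else if j = i then a j - b j else b j) * b n" if "i < n" for i
    using that by simp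
  moreover have "(\<Prod>j<Suc n. if j < n then a j else if j = n then a j - b j else b j)
      = (\<Prod>j<n. a j) * (a n - b n)"
    by (simp cong: prod.cong_simp)
  ultimately have "(\<Sum>i<Suc n. \<Prod>j<Suc n. if j < i then a j else if j = i then a j - b j else b j)
      = ((\<Prod>i<n. a i) - (\<Prod>i<n. b i)) * b n + (\<Prod>j<n. a j) * (a n - b n)"
    unfolding sum.lessThan_Suc[of _ n] Suc.IH
    by (simp only: sum_distrib_right) simp
  then show ?case
    by (simp add: algebra_simps)
qed simp

definition telescope_rows ::
    "nat \<Rightarrow> (nat \<Rightarrow> nat \<Rightarrow> complex) \<Rightarrow> (nat \<Rightarrow> nat \<Rightarrow> complex) \<Rightarrow> nat \<Rightarrow> nat \<Rightarrow> complex" where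
  "telescope_rows i f g j k = (if j < i then f j k else if j = i then f j k - g j k else g j k)"

text \<open>Telescoping every Leibniz product and exchanging the sums gives n determinants, each
  with exactly one row of differences; that row is the source of smallness in all later
  comparisons.\<close>

lemma fdet_diff_telescope: "fdet n f - fdet n g = (\<Sum>i<n. fdet n (telescope_rows i f g))"
proof -
  have "fdet n f - fdet n g
      = (\<Sum>p | p permutes {0..<n}. signof p * ((\<Prod>i<n. f i (p i)) - (\<Prod>i<n. g i (p i))))"
    by (simp add: fdet_leibniz sum_subtractf right_diff_distrib)
  also have "\<dots> = (\<Sum>p | p permutes {0..<n}. \<Sum>i<n. signof p *
      (\<Prod>j<n. if j < i then f j (p j) else if j = i then f j (p j) - g j (p j) else g j (p j)))"
    by (simp add: prod_diff_telescope sum_distrib_left)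
  also have "\<dots> = (\<Sum>i<n. \<Sum>p | p permutes {0..<n}. signof p *
      (\<Prod>j<n. if j < i then f j (p j) else if j = i then f j (p j) - g j (p j) else g j (p j)))"
    by (rule sum.swap)
  finally show ?thesis
    by (simp add: fdet_leibniz telescope_rows_def)
qed

text \<open>Without signs, the Leibniz sum over permutations is dominated by the sum over all maps
  of the index set, and that sum factors into row sums.\<close>

lemma norm_fdet_le: "norm (fdet n f) \<le> (\<Prod>j<n. \<Sum>k<n. norm (f j k))"
proof -
  have "norm (fdet n f) \<le> (\<Sum>p | p permutes {0..<n}. \<Prod>j<n. norm (f j (p j)))"
    unfolding fdet_leibniz
    by (rule sum_norm_le) (auto simp: norm_mult sign_def prod_norm)
  \<comment> \<open>Permutations are total functions, whereas the expansion of a product of sums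
    runs over extensional ones; restriction identifies the two injectively, since a permutation
    fixes everything outside the range.\<close>
  also have "\<dots> = (\<Sum>q\<in>(\<lambda>p. restrict p {0..<n}) ` {p. p permutes {0..<n}}. \<Prod>j<n. norm (f j (q j)))"
  proof (subst sum.reindex)
    show "inj_on (\<lambda>p. restrict p {0..<n}) {p. p permutes {0..<n}}"
    proof (rule inj_onI, rule ext)
      fix p q x
      assume pq: "p \<in> {p. p permutes {0..<n}}" "q \<in> {p. p permutes {0..<n}}"
        and eq: "restrict p {0..<n} = restrict q {0..<n}"
      show "p x = q x"
      proof (cases "x \<in> {0..<n}")
        case True
        then show ?thesis using fun_cong[OF eq, of x] by simp
      next
        case False
        then show ?thesis using pq by (simp add: permutes_not_in)
      qed
    qed
  qed (auto intro!: sum.cong prod.cong)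
  also have "\<dots> \<le> (\<Sum>p\<in>{..<n} \<rightarrow>\<^sub>E {..<n}. \<Prod>j<n. norm (f j (p j)))"
  proof (rule sum_mono2)
    show "(\<lambda>p. restrict p {0..<n}) ` {p. p permutes {0..<n}} \<subseteq> {..<n} \<rightarrow>\<^sub>E {..<n}"
      by (auto simp: lessThan_atLeast0 permutes_in_image)
  qed (auto intro!: prod_nonneg finite_PiE)
  also have "\<dots> = (\<Prod>j<n. \<Sum>k<n. norm (f j k))"
    by (rule prod_sum_PiE[symmetric]) auto
  finally show ?thesis .
qed

text \<open>The exponentials absorb the rows close to identity rows, so that n of them contribute a
  bounded factor; the weights \<open>w\<close> single out the few small rows.\<close>

lemma norm_fdet_le_exp:
  assumes "\<And>j. j < n \<Longrightarrow> (\<Sum>k<n. norm (f j k)) \<le> w j * exp (a j)"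
  shows "norm (fdet n f) \<le> (\<Prod>j<n. w j) * exp (\<Sum>j<n. a j)"
proof -
  have "norm (fdet n f) \<le> (\<Prod>j<n. \<Sum>k<n. norm (f j k))"
    by (rule norm_fdet_le)
  also have "\<dots> \<le> (\<Prod>j<n. w j * exp (a j))"
    by (rule prod_mono) (auto simp: assms sum_nonneg)
  finally show ?thesis
    by (simp add: prod.distrib exp_sum)
qed

lemma fnorm_nonneg: "0 \<le> fnorm n f"
  unfolding fnorm_def by (intro sum_nonneg norm_ge_zero)

lemma rowsum_fone_add_le: "(\<Sum>k<n. norm (fone j k + A j k)) \<le> exp (\<Sum>k<n. norm (A j k))"
proof -
  have "(\<Sum>k<n. norm (fone j k + A j k)) \<le> (\<Sum>k<n. norm (fone j k) + norm (A j k))"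
    by (intro sum_mono norm_triangle_ineq)
  also have "\<dots> = (\<Sum>k<n. norm (fone j k)) + (\<Sum>k<n. norm (A j k))"
    by (rule sum.distrib)
  also have "(\<Sum>k<n. norm (fone j k)) \<le> 1"
    by (simp add: fone_def if_distrib[of norm] cong: if_cong)
  finally show ?thesis
    using exp_ge_add_one_self[of "\<Sum>k<n. norm (A j k)"] by linarith
qed

text \<open>In each telescoped matrix one row is a row of \<open>A - B\<close>, and every other row
  sum is at most the exponential of a row sum of \<open>A\<close> or \<open>B\<close>. The size
  \<open>n\<close> enters only through the norms.\<close>

lemma fdet_perturb:
  "norm (fdet n (\<lambda>j k. fone j k + A j k) - fdet n (\<lambda>j k. fone j k + B j k))
     \<le> fnorm n (\<lambda>j k. A j k - B j k) * exp (fnorm n A + fnorm n B)"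
proof -
  define ra where "ra j = (\<Sum>k<n. norm (A j k))" for j
  define rb where "rb j = (\<Sum>k<n. norm (B j k))" for j
  define rd where "rd j = (\<Sum>k<n. norm (A j k - B j k))" for j
  have nn: "0 \<le> ra j" "0 \<le> rb j" "0 \<le> rd j" for j
    by (auto simp: ra_def rb_def rd_def sum_nonneg)
  define M where "M i = telescope_rows i (\<lambda>j k. fone j k + A j k) (\<lambda>j k. fone j k + B j k)" for i
  have "norm (fdet n (\<lambda>j k. fone j k + A j k) - fdet n (\<lambda>j k. fone j k + B j k)) \<le> (\<Sum>i<n. norm (fdet n (M i)))"
    unfolding fdet_diff_telescope M_def by (rule norm_sum)
  also have "\<dots> \<le> (\<Sum>i<n. rd i * exp (\<Sum>j<n. ra j + rb j))"
  proof (rule sum_mono)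
    fix i assume i: "i \<in> {..<n}"
    have "norm (fdet n (M i)) \<le> (\<Prod>j<n. if j = i then rd j else 1) * exp (\<Sum>j<n. ra j + rb j)"
    proof (rule norm_fdet_le_exp)
      fix j
      have "exp (ra j) \<le> exp (ra j + rb j)" "exp (rb j) \<le> exp (ra j + rb j)" "1 \<le> exp (ra j + rb j)"
        using nn by auto
      then have *: "(\<Sum>k<n. norm (fone j k + A j k)) \<le> exp (ra j + rb j)"
        "(\<Sum>k<n. norm (fone j k + B j k)) \<le> exp (ra j + rb j)"
        "rd j \<le> rd j * exp (ra j + rb j)"
        using rowsum_fone_add_le[of j A n, folded ra_def] rowsum_fone_add_le[of j B n, folded rb_def]
          nn(3)[of j] mult_left_mono[of 1 "exp (ra j + rb j)" "rd j"]
        by linarith+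
      show "(\<Sum>k<n. norm (M i j k)) \<le> (if j = i then rd j else 1) * exp (ra j + rb j)"
        using * by (cases j i rule: linorder_cases) (auto simp: M_def telescope_rows_def rd_def)
    qed
    also have "(\<Prod>j<n. if j = i then rd j else 1) = rd i"
      using i by (simp add: prod.delta)
    finally show "norm (fdet n (M i)) \<le> rd i * exp (\<Sum>j<n. ra j + rb j)" .
  qed
  also have "\<dots> = fnorm n (\<lambda>j k. A j k - B j k) * exp (fnorm n A + fnorm n B)"
    by (simp add: fnorm_def rd_def ra_def rb_def sum.distrib sum_distrib_right)
  finally show ?thesis .
qed

lemma fdet_one: "fdet n fone = 1"
  by (subst fdet_lower_triangular) (auto simp: fone_def)

text \<open>Telescoping twice. Against the identity, it leaves \<open>M i\<close>, with rows of
  \<open>I + K\<close> above row i, the row of \<open>K\<close> at i, and identity rows below.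
  Replacing the rows above by identity rows costs a second factor of \<open>K\<close> and leaves
  \<open>P i\<close>, whose determinant is the diagonal entry.\<close>

lemma fdet_second_order:
  "norm (fdet n (\<lambda>j k. fone j k + K j k) - 1 - (\<Sum>i<n. K i i)) \<le> (fnorm n K)\<^sup>2 * exp (fnorm n K)"
proof -
  define r where "r j = (\<Sum>k<n. norm (K j k))" for j
  have nn: "0 \<le> r j" for j by (auto simp: r_def sum_nonneg)
  define M where "M i = (\<lambda>j k. if j < i then fone j k + K j k else if j = i then K j k else fone j k)" for i
  define P where "P i = (\<lambda>j k. if j = i then K j k else fone j k)" for i
  have "fdet n (\<lambda>j k. fone j k + K j k) - 1 = fdet n (\<lambda>j k. fone j k + K j k) - fdet n fone"
    by (simp only: fdet_one)
  also have "\<dots> = (\<Sum>i<n. fdet n (M i))"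
    unfolding fdet_diff_telescope by (intro sum.cong fdet_cong refl) (simp add: M_def telescope_rows_def)
  finally have M: "fdet n (\<lambda>j k. fone j k + K j k) - 1 = (\<Sum>i<n. fdet n (M i))" .
  have P: "fdet n (P i) = K i i" if i: "i < n" for i
  proof -
    \<comment> \<open>A permutation other than the identity moves at least two points, hence some
      row different from i, and there \<open>P i\<close> is an identity row read off the
      diagonal.\<close>
    have "(\<Prod>l<n. P i l (p l)) = 0" if p: "p permutes {0..<n}" "p \<noteq> id" for p
    proof -
      obtain a where a: "p a \<noteq> a" using p(2) by (auto simp: fun_eq_iff)
      have "\<exists>l. l \<noteq> i \<and> p l \<noteq> l"
        by (metis a injD permutes_inj[OF p(1)])
      then obtain l where "l \<noteq> i" "p l \<noteq> l" by blast
      moreover from this have "l < n" using permutes_not_in[OF p(1), of l] by auto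
      ultimately show ?thesis
        by (intro prod_zero bexI[of _ l]) (auto simp: P_def fone_def)
    qed
    then have "fdet n (P i) = (\<Sum>p\<in>{id}. signof p * (\<Prod>l<n. P i l (p l)))"
      unfolding fdet_leibniz
      by (intro sum.mono_neutral_right) (auto simp: permutes_id finite_permutations)
    also have "\<dots> = (\<Prod>l<n. P i l l)"
      by simp
    also have "\<dots> = (\<Prod>l<n. if l = i then K i i else 1)"
      by (intro prod.cong) (auto simp: P_def fone_def)
    finally show ?thesis using i by (simp add: prod.delta)
  qed
  have "norm (fdet n (M i) - fdet n (P i)) \<le> (\<Sum>l<n. r i * r l * exp (\<Sum>j<n. r j))" if i: "i < n" for i
  proof -
    have "norm (fdet n (M i) - fdet n (P i)) \<le> (\<Sum>l<n. norm (fdet n (telescope_rows l (M i) (P i))))"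
      unfolding fdet_diff_telescope by (rule norm_sum)
    also have "\<dots> \<le> (\<Sum>l<n. r i * r l * exp (\<Sum>j<n. r j))"
    proof (rule sum_mono)
      fix l assume l: "l \<in> {..<n}"
      have one: "(\<Sum>k<n. norm (fone j k)) \<le> exp (r j)" for j
        by (rule order.trans[of _ 1]) (use rowsum_fone_add_le[of j "\<lambda>_ _. 0" n] nn[of j] in auto)
      have ree: "r j \<le> r j * exp (r j)" for j
        using mult_left_mono[of 1 "exp (r j)" "r j"] nn[of j] by simp
      show "norm (fdet n (telescope_rows l (M i) (P i))) \<le> r i * r l * exp (\<Sum>j<n. r j)"
      \<comment> \<open>\<open>M i\<close> and \<open>P i\<close> differ only in rows above i; for
        any other l the row of differences vanishes and so does the determinant.\<close>
      proof (cases "l < i")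
        case True
        have "norm (fdet n (telescope_rows l (M i) (P i)))
          \<le> (\<Prod>j<n. (if j = i then r j else 1) * (if j = l then r j else 1)) * exp (\<Sum>j<n. r j)"
        proof (rule norm_fdet_le_exp)
          fix j
          show "(\<Sum>k<n. norm (telescope_rows l (M i) (P i) j k))
            \<le> (if j = i then r j else 1) * (if j = l then r j else 1) * exp (r j)"
            using True one[of j] ree[of j] rowsum_fone_add_le[of j K n]
            by (cases j l rule: linorder_cases) (auto simp: telescope_rows_def M_def P_def r_def)
        qed
        also have "(\<Prod>j<n. (if j = i then r j else 1) * (if j = l then r j else 1)) = r i * r l"
          using i l by (simp add: prod.distrib prod.delta)
        finally show ?thesis .
      next
        case False
        have "norm (fdet n (telescope_rows l (M i) (P i))) \<le> (\<Prod>j<n. \<Sum>k<n. norm (telescope_rows l (M i) (P i) j k))"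
          by (rule norm_fdet_le)
        also have "\<dots> = 0"
          using l False by (intro prod_zero bexI[of _ l]) (auto simp: telescope_rows_def M_def P_def)
        finally show ?thesis using nn by (auto intro!: mult_nonneg_nonneg order.trans[rotated])
      qed
    qed
    finally show ?thesis .
  qed
  then have "norm ((\<Sum>i<n. fdet n (M i)) - (\<Sum>i<n. K i i)) \<le> (\<Sum>i<n. \<Sum>l<n. r i * r l * exp (\<Sum>j<n. r j))"
    unfolding sum_subtractf[symmetric] using P by (intro sum_norm_le) auto
  also have "\<dots> = (fnorm n K)\<^sup>2 * exp (fnorm n K)"
    by (simp add: fnorm_def r_def power2_eq_square sum_product sum_distrib_right sum_distrib_left mult_ac)
  finally show ?thesis
    by (simp add: M)
qed

text \<open>Lets sections of consecutive sizes be compared as matrices of the same size.\<close>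

lemma fdet_Suc_fone:
  assumes "\<And>k. k \<le> n \<Longrightarrow> f n k = fone n k"
  shows "fdet (Suc n) f = fdet n f"
proof -
  define A where "A = Matrix.mat (Suc n) (Suc n) (\<lambda>(j, k). f j k)"
  have "fdet (Suc n) f = (\<Sum>j<Suc n. A $$ (n, j) * cofactor A n j)"
    unfolding fdet_def A_def by (subst laplace_expansion_row[where n = "Suc n" and i = n]) auto
  also have "\<dots> = (\<Sum>j<Suc n. if j = n then cofactor A n n else 0)"
    by (intro sum.cong) (auto simp: A_def assms fone_def)
  also have "\<dots> = cofactor A n n" by simp
  also have "\<dots> = Determinant.det (mat_delete A n n)"
    by (simp add: cofactor_def)
  also have "mat_delete A n n = Matrix.mat n n (\<lambda>(j, k). f j k)"
    by (rule eq_matI) (auto simp: mat_delete_def A_def)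
  finally show ?thesis by (simp add: fdet_def)
qed

lemma geometric_increments_converge:
  fixes d :: "nat \<Rightarrow> complex"
  assumes r: "0 \<le> r" "r < 1" and d: "\<And>N. norm (d (Suc N) - d N) \<le> C * r ^ N"
  shows "\<exists>S. \<forall>N. norm (d N - S) \<le> C / (1 - r) * r ^ N"
proof -
  define e where "e N = d (Suc N) - d N" for N
  have sm: "summable (\<lambda>N. C * r ^ N)"
    using r by (intro summable_mult summable_geometric) auto
  have se: "summable e"
    by (rule summable_comparison_test'[OF sm]) (auto simp: e_def d)
  have "norm (d N - (d 0 + suminf e)) \<le> C / (1 - r) * r ^ N" for N
  proof -
    have "d N = d 0 + sum e {..<N}"
      by (induction N) (auto simp: e_def)
    moreover have "suminf e = (\<Sum>k. e (k + N)) + sum e {..<N}"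
      by (rule suminf_split_initial_segment[OF se])
    ultimately have "norm (d N - (d 0 + suminf e)) = norm (\<Sum>k. e (k + N))"
      using norm_minus_cancel[of "\<Sum>k. e (k + N)"] by (simp add: algebra_simps)
    also have "\<dots> \<le> (\<Sum>k. C * r ^ N * r ^ k)"
      using r by (intro norm_suminf_le summable_mult summable_geometric)
        (auto simp: e_def power_add intro!: order.trans[OF d])
    also have "\<dots> = C / (1 - r) * r ^ N"
      using r by (subst suminf_mult) (auto simp: suminf_geometric intro!: summable_geometric)
    finally show ?thesis .
  qed
  then show ?thesis by blast
qed

lemma sum_power_le_geometric:
  fixes r :: real
  assumes "0 \<le> r" "r < 1"
  shows "(\<Sum>k<n. r ^ k) \<le> 1 / (1 - r)"
  using assms by (simp add: sum_gp_strict divide_right_mono)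

lemma fnorm_le_geometric:
  assumes r: "0 \<le> r" "r < 1" and "0 \<le> C"
    and "\<And>j k. j < n \<Longrightarrow> k < n \<Longrightarrow> norm (A j k) \<le> C * r ^ (j + k)"
  shows "fnorm n A \<le> C / (1 - r)\<^sup>2"
proof -
  have "fnorm n A \<le> (\<Sum>j<n. \<Sum>k<n. C * r ^ (j + k))"
    unfolding fnorm_def by (intro sum_mono) (auto simp: assms)
  also have "\<dots> = C * ((\<Sum>j<n. r ^ j) * (\<Sum>k<n. r ^ k))"
    by (simp add: sum_product power_add flip: sum_distrib_left)
  also have "\<dots> \<le> C * (1 / (1 - r) * (1 / (1 - r)))"
    using assms by (intro mult_left_mono mult_mono sum_power_le_geometric sum_nonneg) auto
  finally show ?thesis by (simp add: power2_eq_square)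
qed

text \<open>The entries of \<open>K\<close> do not depend on the size, so passing from N to N + 1
  only adds a last row and column, of total norm O(\<open>r ^ N\<close>); the increments of the
  determinants are therefore geometric.\<close>

lemma fdet_fone_add_converges:
  assumes r: "0 \<le> r" "r < 1" and C: "0 \<le> C"
    and K: "\<And>j k. norm (K j k) \<le> C * r ^ (j + k)"
  shows "\<exists>S D. \<forall>N. norm (fdet N (\<lambda>j k. fone j k + K j k) - S) \<le> D * r ^ N"
proof -
  define M where "M = C / (1 - r)\<^sup>2"
  have "norm (fdet (Suc N) (\<lambda>j k. fone j k + K j k) - fdet N (\<lambda>j k. fone j k + K j k))
      \<le> (2 * C / (1 - r) * exp (M + M)) * r ^ N" for N
  proof -
    define K' where "K' = (\<lambda>j k. if j < N \<and> k < N then K j k else 0)"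
    have "fdet N (\<lambda>j k. fone j k + K j k) = fdet N (\<lambda>j k. fone j k + K' j k)"
      by (rule fdet_cong) (auto simp: K'_def)
    also have "\<dots> = fdet (Suc N) (\<lambda>j k. fone j k + K' j k)"
      by (rule fdet_Suc_fone[symmetric]) (auto simp: K'_def)
    finally have "norm (fdet (Suc N) (\<lambda>j k. fone j k + K j k) - fdet N (\<lambda>j k. fone j k + K j k))
       \<le> fnorm (Suc N) (\<lambda>j k. K j k - K' j k) * exp (fnorm (Suc N) K + fnorm (Suc N) K')"
      using fdet_perturb[of "Suc N" K K'] by simp
    also have "\<dots> \<le> (2 * C / (1 - r) * r ^ N) * exp (M + M)"
    proof (rule mult_mono)
      have "fnorm (Suc N) (\<lambda>j k. K j k - K' j k) \<le>
          (\<Sum>j<Suc N. \<Sum>k<Suc N. (if j = N then C * r ^ N * r ^ k else 0) + (if k = N then C * r ^ N * r ^ j else 0))"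
        unfolding fnorm_def
      proof (intro sum_mono)
        fix j k assume "j \<in> {..<Suc N}" "k \<in> {..<Suc N}"
        then consider "j < N" "k < N" | "j = N" | "k = N" by force
        then show "norm (K j k - K' j k) \<le> (if j = N then C * r ^ N * r ^ k else 0) + (if k = N then C * r ^ N * r ^ j else 0)"
          using K[of j k] C r by cases (auto simp: K'_def power_add mult_ac intro: add_nonneg_nonneg order.trans)
      qed
      also have "\<dots> = 2 * C * r ^ N * (\<Sum>k<Suc N. r ^ k)"
      proof -
        have "(\<Sum>j<Suc N. \<Sum>k<Suc N. if j = N then C * r ^ N * r ^ k else 0) = C * r ^ N * (\<Sum>k<Suc N. r ^ k)"
          by (simp add: sum_distrib_left algebra_simps)
        moreover have "(\<Sum>j<Suc N. \<Sum>k<Suc N. if k = N then C * r ^ N * r ^ j else 0) = C * r ^ N * (\<Sum>k<Suc N. r ^ k)"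
          by (simp add: sum_distrib_left algebra_simps)
        ultimately show ?thesis by (simp only: sum.distrib)
      qed
      also have "\<dots> \<le> 2 * C * r ^ N * (1 / (1 - r))"
        using r C by (intro mult_left_mono sum_power_le_geometric) auto
      finally show "fnorm (Suc N) (\<lambda>j k. K j k - K' j k) \<le> 2 * C / (1 - r) * r ^ N"
        by simp
      have "fnorm (Suc N) K \<le> M" "fnorm (Suc N) K' \<le> M"
        unfolding M_def using r C K by (auto intro!: fnorm_le_geometric simp: K'_def)
      then show "exp (fnorm (Suc N) K + fnorm (Suc N) K') \<le> exp (M + M)" by simp
    qed (use r C in \<open>auto intro!: divide_nonneg_pos mult_nonneg_nonneg simp: fnorm_nonneg\<close>)
    finally show ?thesis by (simp add: mult_ac)
  qed
  then show ?thesis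
    using geometric_increments_converge[OF r, of "\<lambda>N. fdet N (\<lambda>j k. fone j k + K j k)"] by blast
qed

section \<open>Toeplitz matrices with triangular factors\<close>

text \<open>The bound makes the family absolutely summable over pairs, so Fubini for
  \<open>infsum\<close> applies. Decay in both indices separately is demanded since it also
  identifies each \<open>infsum\<close> with the corresponding \<open>suminf\<close>.\<close>

lemma suminf_swap_geometric:
  fixes f :: "nat \<Rightarrow> nat \<Rightarrow> complex"
  assumes q: "0 \<le> q" "q < 1" and f: "\<And>i l. norm (f i l) \<le> D * q ^ i * q ^ l"
  shows "(\<Sum>i. \<Sum>l. f i l) = (\<Sum>l. \<Sum>i. f i l)"
proof -
  have inf: "infsum g UNIV = suminf g" if "g summable_on UNIV" for g :: "nat \<Rightarrow> complex"
    using has_sum_imp_sums[of g "infsum g UNIV"] that by (simp add: sums_iff)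
  have gq: "summable (\<lambda>i. E * q ^ i)" for E
    using q by (intro summable_mult summable_geometric) auto
  have sb: "f' summable_on UNIV" if "\<And>i. norm (f' i) \<le> E * q ^ i" for f' :: "nat \<Rightarrow> complex" and E
    using that by (intro norm_summable_imp_summable_on summable_comparison_test'[OF gq[of E]]) auto
  have D: "0 \<le> D"
    using order.trans[OF norm_ge_zero f[of 0 0]] by simp
  have gsum: "suminf (\<lambda>l. E * q ^ l) = E / (1 - q)" for E
    using q by (subst suminf_mult) (auto simp: suminf_geometric intro!: summable_geometric)
  have "(\<lambda>(i, l). D * q ^ i * q ^ l) summable_on (UNIV \<times> UNIV)"
  proof (rule summable_on_SigmaI[where g = "\<lambda>i. D * q ^ i / (1 - q)"])
    fix i
    have "(\<lambda>l. D * q ^ i * q ^ l) sums (D * q ^ i / (1 - q))"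
      using gq[of "D * q ^ i"] gsum[of "D * q ^ i"] by (simp add: sums_iff)
    then show "((\<lambda>l. case (i, l) of (i, l) \<Rightarrow> D * q ^ i * q ^ l) has_sum (D * q ^ i / (1 - q))) UNIV"
      using D q by (auto intro!: sums_nonneg_imp_has_sum)
    show "(\<lambda>i. D * q ^ i / (1 - q)) summable_on UNIV"
      using gq[of "D / (1 - q)"] D q by (intro norm_summable_imp_summable_on) (simp add: abs_mult)
  qed (use D q in auto)
  then have "(\<lambda>x. norm ((\<lambda>(i, l). f i l) x)) summable_on (UNIV \<times> UNIV)"
    by (rule Infinite_Sum.abs_summable_on_comparison_test') (auto intro!: f)
  then have "(\<lambda>(i, l). f i l) summable_on (UNIV \<times> UNIV)"
    by (rule abs_summable_summable)
  then have sw: "infsum (\<lambda>i. infsum (\<lambda>l. f i l) UNIV) UNIV = infsum (\<lambda>l. infsum (\<lambda>i. f i l) UNIV) UNIV"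
    by (rule infsum_swap_banach)
  have 1: "infsum (\<lambda>l. f i l) UNIV = (\<Sum>l. f i l)" for i
    by (intro inf sb[of _ "D * q ^ i"]) (rule f)
  have 2: "infsum (\<lambda>i. f i l) UNIV = (\<Sum>i. f i l)" for l
    by (intro inf sb[of _ "D * q ^ l"]) (use f in \<open>auto simp: mult_ac\<close>)
  have n1: "norm (\<Sum>l. f i l) \<le> D / (1 - q) * q ^ i" for i
    using norm_suminf_le[of "f i" "\<lambda>l. D * q ^ i * q ^ l", OF f gq] by (simp add: gsum)
  have n2: "norm (\<Sum>i. f i l) \<le> D / (1 - q) * q ^ l" for l
  proof -
    have "norm (f i l) \<le> D * q ^ l * q ^ i" for i
      using f[of i l] by (simp add: mult_ac)
    from norm_suminf_le[OF this gq] show ?thesis by (simp add: gsum)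
  qed
  show ?thesis
    using sw unfolding 1 2 by (simp add: inf[OF sb, OF n1] inf[OF sb, OF n2])
qed

lemma fmul_assoc: "fmul n (fmul n f g) h = fmul n f (fmul n g h)"
proof (intro ext)
  fix j k
  have "fmul n (fmul n f g) h j k = (\<Sum>l<n. \<Sum>i<n. f j i * g i l * h l k)"
    by (simp add: fmul_def sum_distrib_right)
  also have "\<dots> = (\<Sum>i<n. \<Sum>l<n. f j i * g i l * h l k)"
    by (rule sum.swap)
  also have "\<dots> = fmul n f (fmul n g h) j k"
    by (simp add: fmul_def sum_distrib_left mult.assoc)
  finally show "fmul n (fmul n f g) h j k = fmul n f (fmul n g h) j k" .
qed

lemma fmul_add_left: "fmul n (\<lambda>j k. f j k + g j k) h = (\<lambda>j k. fmul n f h j k + fmul n g h j k)"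
  by (simp add: fmul_def fun_eq_iff distrib_right sum.distrib)

lemma fmul_add_right: "fmul n h (\<lambda>j k. f j k + g j k) = (\<lambda>j k. fmul n h f j k + fmul n h g j k)"
  by (simp add: fmul_def fun_eq_iff distrib_left sum.distrib)

lemma fmul_diff_left: "fmul n (\<lambda>j k. f j k - g j k) h = (\<lambda>j k. fmul n f h j k - fmul n g h j k)"
  by (simp add: fmul_def fun_eq_iff left_diff_distrib sum_subtractf)

lemma fmul_diff_right: "fmul n h (\<lambda>j k. f j k - g j k) = (\<lambda>j k. fmul n h f j k - fmul n h g j k)"
  by (simp add: fmul_def fun_eq_iff right_diff_distrib sum_subtractf)

text \<open>\<open>fmul n\<close> sums over indices below \<open>n\<close> only, so the identities
  between triangular matrices are stated on the leading block.\<close>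

definition feq :: "nat \<Rightarrow> (nat \<Rightarrow> nat \<Rightarrow> complex) \<Rightarrow> (nat \<Rightarrow> nat \<Rightarrow> complex) \<Rightarrow> bool" where
  "feq n f g \<longleftrightarrow> (\<forall>j<n. \<forall>k<n. f j k = g j k)"

lemma feq_refl [simp]: "feq n f f"
  by (simp add: feq_def)

lemma feq_trans [trans]: "feq n f g \<Longrightarrow> feq n g h \<Longrightarrow> feq n f h"
  by (simp add: feq_def)

lemma feq_fmul: "feq n f f' \<Longrightarrow> feq n g g' \<Longrightarrow> feq n (fmul n f g) (fmul n f' g')"
  by (simp add: feq_def fmul_def)

lemma feq_fdet: "feq n f g \<Longrightarrow> fdet n f = fdet n g"
  by (rule fdet_cong) (simp add: feq_def)

lemma fmul_fone_left: "feq n (fmul n fone f) f"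
  by (simp add: feq_def fmul_def fone_def if_distrib[of "\<lambda>x. x * _"] cong: if_cong)

lemma fmul_fone_right: "feq n (fmul n f fone) f"
  by (simp add: feq_def fmul_def fone_def if_distrib[of "\<lambda>x. _ * x"] cong: if_cong)

lemma fnorm_fmul_le: "fnorm n (fmul n f g) \<le> fnorm n f * fnorm n g"
proof -
  have "fnorm n (fmul n f g) \<le> (\<Sum>j<n. \<Sum>k<n. \<Sum>l<n. norm (f j l) * norm (g l k))"
    unfolding fnorm_def fmul_def
    by (intro sum_mono order.trans[OF norm_sum]) (simp add: norm_mult)
  also have "\<dots> = (\<Sum>j<n. \<Sum>l<n. norm (f j l) * (\<Sum>k<n. norm (g l k)))"
    by (rule sum.cong[OF refl]) (subst sum.swap, simp add: sum_distrib_left)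
  also have "\<dots> \<le> (\<Sum>j<n. \<Sum>l<n. norm (f j l) * fnorm n g)"
  proof (intro sum_mono mult_left_mono)
    fix l assume "l \<in> {..<n}"
    then show "(\<Sum>k<n. norm (g l k)) \<le> fnorm n g"
      unfolding fnorm_def by (intro member_le_sum[of l "{..<n}" "\<lambda>l. \<Sum>k<n. norm (g l k)"]) (auto intro: sum_nonneg)
  qed auto
  also have "\<dots> = fnorm n f * fnorm n g"
    by (simp add: fnorm_def[of n f] sum_distrib_right)
  finally show ?thesis .
qed

lemma fnorm_le_const:
  assumes "\<And>j k. j < n \<Longrightarrow> k < n \<Longrightarrow> norm (f j k) \<le> c"
  shows "fnorm n f \<le> real n ^ 2 * c"
proof -
  have "fnorm n f \<le> (\<Sum>j<n. \<Sum>k<n. c)"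
    unfolding fnorm_def by (intro sum_mono) (auto simp: assms)
  then show ?thesis by (simp add: power2_eq_square)
qed

lemma fnorm_diff_le: "fnorm n (\<lambda>j k. f j k - g j k) \<le> fnorm n f + fnorm n g"
  unfolding fnorm_def sum.distrib[symmetric] by (intro sum_mono norm_triangle_ineq4)

section \<open>Triangular Toeplitz matrices and the Hankel defect\<close>

definition upper :: "complex fps \<Rightarrow> nat \<Rightarrow> nat \<Rightarrow> complex" where
  "upper f j k = (if j \<le> k then fps_nth f (k - j) else 0)"

definition lower :: "complex fps \<Rightarrow> nat \<Rightarrow> nat \<Rightarrow> complex" where
  "lower f j k = upper f k j"

text \<open>For \<open>f\<^sub>+(z) = \<Sum> p\<^sub>n z\<^sup>n\<close> and \<open>f\<^sub>-(z) = \<Sum> m\<^sub>n z\<^sup>-\<^sup>n\<close>, the entry with indices \<open>j, k\<close> is the Fourier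
  coefficient of \<open>f\<^sub>+ f\<^sub>-\<close> with index \<open>j - k\<close>.\<close>

definition toep :: "complex fps \<Rightarrow> complex fps \<Rightarrow> nat \<Rightarrow> nat \<Rightarrow> complex" where
  "toep p m j k = (\<Sum>i. upper m j i * upper p k i)"

text \<open>The product of the two Hankel matrices of \<open>p\<close> and \<open>m\<close>: the
  defect between the upper-lower product \<open>toep\<close> and the lower-upper product. The shift
  by 1 keeps the constant coefficients out of it.\<close>

definition hank :: "complex fps \<Rightarrow> complex fps \<Rightarrow> nat \<Rightarrow> nat \<Rightarrow> complex" where
  "hank p m j k = (\<Sum>i. fps_nth p (j + i + 1) * fps_nth m (k + i + 1))"

definition geom_bdd :: "real \<Rightarrow> real \<Rightarrow> complex fps \<Rightarrow> bool" where
  "geom_bdd C s f \<longleftrightarrow> (\<forall>n. norm (fps_nth f n) \<le> C * s ^ n)"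

lemma geom_bddD: "geom_bdd C s f \<Longrightarrow> norm (fps_nth f n) \<le> C * s ^ n"
  by (simp add: geom_bdd_def)

lemma geom_bdd_nonneg: "geom_bdd C s f \<Longrightarrow> 0 \<le> C"
  using order.trans[OF norm_ge_zero geom_bddD[of C s f 0]] by simp

lemma toep_transpose: "toep p m j k = toep m p k j"
  by (simp add: toep_def mult.commute)

text \<open>For triangular matrices truncation commutes with multiplication, so inverting a power
  series inverts every finite section.\<close>

lemma fmul_upper_upper: "feq n (fmul n (upper f) (upper g)) (upper (f * g))"
  unfolding feq_def
proof (intro allI impI)
  fix j k assume jk: "j < n" "k < n"
  have "fmul n (upper f) (upper g) j k = (\<Sum>l\<in>{j..k}. fps_nth f (l - j) * fps_nth g (k - l))"
    unfolding fmul_def using jk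
    by (intro sum.mono_neutral_cong_right) (auto simp: upper_def)
  also have "\<dots> = upper (f * g) j k"
  proof (cases "j \<le> k")
    case True
    have "(\<Sum>l\<in>{j..k}. fps_nth f (l - j) * fps_nth g (k - l)) = (\<Sum>i=0..k-j. fps_nth f i * fps_nth g (k - j - i))"
      using True by (intro sum.reindex_bij_witness[of _ "\<lambda>i. i + j" "\<lambda>l. l - j"]) auto
    then show ?thesis using True by (simp add: upper_def fps_mult_nth)
  qed (simp add: upper_def)
  finally show "fmul n (upper f) (upper g) j k = upper (f * g) j k" .
qed

lemma fmul_lower_lower: "feq n (fmul n (lower f) (lower g)) (lower (f * g))"
  using fmul_upper_upper[of n g f] by (simp add: feq_def fmul_def lower_def mult.commute)

lemma upper_1: "upper 1 = fone" and lower_1: "lower 1 = fone"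
  by (auto simp: upper_def lower_def fone_def fun_eq_iff fps_one_def)

lemma fdet_upper: "fdet n (upper f) = fps_nth f 0 ^ n"
  by (subst fdet_upper_triangular) (auto simp: upper_def)

lemma fdet_lower: "fdet n (lower f) = fps_nth f 0 ^ n"
  by (subst fdet_lower_triangular) (auto simp: lower_def upper_def)

lemma norm_upper_le:
  assumes "geom_bdd C s f"
  shows "norm (upper f j k) \<le> (if j \<le> k then C * s ^ (k - j) else 0)"
  using assms by (simp add: upper_def geom_bddD)

lemma norm_upper_le_const:
  assumes "geom_bdd C s f" "0 \<le> s" "s < 1"
  shows "norm (upper f j k) \<le> C"
proof -
  have "C * s ^ (k - j) \<le> C * 1"
    using assms geom_bdd_nonneg[OF assms(1)] by (intro mult_left_mono power_le_one) auto
  then show ?thesis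
    using norm_upper_le[OF assms(1), of j k] geom_bdd_nonneg[OF assms(1)] by (auto split: if_splits)
qed

lemma norm_hank_le:
  assumes s: "0 \<le> s" "s < 1" and "geom_bdd C s p" "geom_bdd D s m"
  shows "norm (hank p m j k) \<le> C * D / (1 - s) * s ^ (j + k)"
    and "summable (\<lambda>i. fps_nth p (j + i + 1) * fps_nth m (k + i + 1))"
proof -
  note nn = geom_bdd_nonneg[OF assms(3)] geom_bdd_nonneg[OF assms(4)]
  have *: "norm (fps_nth p (j + i + 1) * fps_nth m (k + i + 1)) \<le> C * D * s ^ (j + k) * s ^ i" for i
  proof -
    have "norm (fps_nth p (j + i + 1) * fps_nth m (k + i + 1)) \<le> (C * s ^ (j + i + 1)) * (D * s ^ (k + i + 1))"
      unfolding norm_mult using assms nn by (intro mult_mono geom_bddD) auto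
    also have "\<dots> = C * D * (s ^ (j + k) * s ^ i) * s ^ (i + 2)"
      by (simp add: power_add mult_ac power2_eq_square)
    also have "\<dots> \<le> C * D * (s ^ (j + k) * s ^ i) * 1"
      using s nn by (intro mult_left_mono power_le_one) auto
    finally show ?thesis by (simp add: mult_ac)
  qed
  have sm: "summable (\<lambda>i. C * D * s ^ (j + k) * s ^ i)"
    using s by (intro summable_mult summable_geometric) auto
  show "norm (hank p m j k) \<le> C * D / (1 - s) * s ^ (j + k)"
    using norm_suminf_le[OF * sm] s unfolding hank_def
    by (subst (asm) suminf_mult) (auto simp: suminf_geometric mult_ac intro!: summable_geometric)
  show "summable (\<lambda>i. fps_nth p (j + i + 1) * fps_nth m (k + i + 1))"
    by (rule summable_comparison_test'[OF sm]) (rule *)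
qed

text \<open>Both factors decay with the distance of their index from n, so the tail of the
  upper-lower product is concentrated at the corner (n, n). One of the two powers
  \<open>s ^ i\<close> is given up.\<close>

lemma norm_upper_upper_le:
  assumes s: "0 \<le> s" "s < 1" and "geom_bdd C s m" "geom_bdd D s p" and "j \<le> n" "k \<le> n"
  shows "norm (upper m j (i + n) * upper p k (i + n)) \<le> C * D * s ^ ((n - j) + (n - k)) * s ^ i"
proof -
  note nn = geom_bdd_nonneg[OF assms(3)] geom_bdd_nonneg[OF assms(4)]
  have "norm (upper m j (i + n) * upper p k (i + n)) \<le> (C * s ^ (i + n - j)) * (D * s ^ (i + n - k))"
    unfolding norm_mult using assms nn norm_upper_le[of C s m j "i + n"] norm_upper_le[of D s p k "i + n"]
    by (intro mult_mono) auto
  also have "\<dots> = C * D * (s ^ ((n - j) + (n - k)) * s ^ i) * s ^ i"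
  proof -
    have "i + n - j = n - j + i" "i + n - k = n - k + i"
      using assms by auto
    then show ?thesis by (simp only: power_add mult_ac)
  qed
  also have "\<dots> \<le> C * D * (s ^ ((n - j) + (n - k)) * s ^ i) * 1"
    using s nn by (intro mult_left_mono power_le_one) auto
  finally show ?thesis by (simp add: mult_ac)
qed

lemma summable_toep:
  assumes s: "0 \<le> s" "s < 1" and "geom_bdd C s m" "geom_bdd D s p"
  shows "summable (\<lambda>i. upper m j i * upper p k i)"
proof -
  have "summable (\<lambda>i. C * D * s ^ ((max j k - j) + (max j k - k)) * s ^ i)"
    using s by (intro summable_mult summable_geometric) auto
  then have "summable (\<lambda>i. upper m j (i + max j k) * upper p k (i + max j k))"
    by (rule summable_comparison_test') (rule norm_upper_upper_le[OF assms], auto)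
  then show ?thesis by (simp add: summable_iff_shift[of "\<lambda>i. upper m j i * upper p k i"])
qed

text \<open>The reflection l -> j + k - l turns the first j + k + 1 terms of the upper-lower product
  into the lower-upper product; the later terms are the Hankel defect. By triangularity only l up to
  min j k matter, so one index below \<open>n\<close> suffices; rows beyond n are thereby covered
  too.\<close>

lemma toep_eq_sum_add_hank:
  assumes s: "0 \<le> s" "s < 1" and "geom_bdd C s m" "geom_bdd D s p"
    and "min j k < n"
  shows "toep p m j k = (\<Sum>l<n. lower p j l * upper m l k) + hank p m j k"
proof -
  have "toep p m j k = (\<Sum>i. upper m j (i + (j + k + 1)) * upper p k (i + (j + k + 1)))
      + (\<Sum>i<j + k + 1. upper m j i * upper p k i)"
    unfolding toep_def by (rule suminf_split_initial_segment[OF summable_toep[OF assms(1-4)]])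
  also have "(\<Sum>i. upper m j (i + (j + k + 1)) * upper p k (i + (j + k + 1))) = hank p m j k"
    unfolding hank_def by (intro suminf_cong) (simp add: upper_def add_ac)
  also have "(\<Sum>i<j + k + 1. upper m j i * upper p k i) = (\<Sum>l<j + k + 1. upper m j (j + k - l) * upper p k (j + k - l))"
    by (rule sum.reindex_bij_witness[of _ "\<lambda>l. j + k - l" "\<lambda>l. j + k - l"]) auto
  also have "\<dots> = (\<Sum>l<j + k + 1. lower p j l * upper m l k)"
    by (intro sum.cong refl) (auto simp: lower_def upper_def)
  also have "\<dots> = (\<Sum>l<n. lower p j l * upper m l k)"
  proof (rule sum.mono_neutral_cong)
    show "lower p j l * upper m l k = 0" if "l \<in> {..<n} - {..<j + k + 1}" for l
      using that by (auto simp: lower_def upper_def)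
    show "lower p j l * upper m l k = 0" if "l \<in> {..<j + k + 1} - {..<n}" for l
      using that assms(5) by (auto simp: lower_def upper_def)
  qed auto
  finally show ?thesis by simp
qed

lemma toep_feq_lower_upper:
  assumes s: "0 \<le> s" "s < 1" and "geom_bdd C s m" "geom_bdd D s p"
  shows "feq n (toep p m) (\<lambda>j k. fmul n (lower p) (upper m) j k + hank p m j k)"
  using toep_eq_sum_add_hank[OF assms] by (simp add: feq_def fmul_def)

text \<open>The entries of \<open>L\<^sup>-\<^sup>1 H U\<^sup>-\<^sup>1\<close>: by triangularity they do not depend on the size of the matrices.\<close>

definition kern :: "complex fps \<Rightarrow> complex fps \<Rightarrow> complex fps \<Rightarrow> complex fps \<Rightarrow> nat \<Rightarrow> nat \<Rightarrow> complex" where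
  "kern p p' m m' j k = (\<Sum>a\<le>j. \<Sum>b\<le>k. lower p' j a * hank p m a b * upper m' b k)"

lemma fmul_fmul_kern: "feq n (fmul n (lower p') (fmul n (hank p m) (upper m'))) (kern p p' m m')"
  unfolding feq_def
proof (intro allI impI)
  fix j k assume "j < n" "k < n"
  have "fmul n (lower p') (fmul n (hank p m) (upper m')) j k
      = (\<Sum>a<n. \<Sum>b<n. lower p' j a * hank p m a b * upper m' b k)"
    by (simp add: fmul_def sum_distrib_left mult_ac)
  also have "\<dots> = (\<Sum>a\<le>j. \<Sum>b<n. lower p' j a * hank p m a b * upper m' b k)"
    using \<open>j < n\<close> by (intro sum.mono_neutral_right) (auto simp: lower_def upper_def)
  also have "\<dots> = kern p p' m m' j k"
    unfolding kern_def using \<open>k < n\<close>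
    by (intro sum.cong sum.mono_neutral_right refl) (auto simp: lower_def upper_def)
  finally show "fmul n (lower p') (fmul n (hank p m) (upper m')) j k = kern p p' m m' j k" .
qed

lemma fmul_toep_kern:
  assumes s: "0 \<le> s" "s < 1" and "geom_bdd C s m" "geom_bdd D s p" and "p' * p = 1" "m * m' = 1"
  shows "feq n (fmul n (lower p') (fmul n (toep p m) (upper m'))) (\<lambda>j k. fone j k + kern p p' m m' j k)"
proof -
  have "feq n (fmul n (lower p') (fmul n (toep p m) (upper m')))
     (fmul n (lower p') (fmul n (\<lambda>j k. fmul n (lower p) (upper m) j k + hank p m j k) (upper m')))"
    by (intro feq_fmul toep_feq_lower_upper[OF assms(1-4)] feq_refl)
  also have "fmul n (lower p') (fmul n (\<lambda>j k. fmul n (lower p) (upper m) j k + hank p m j k) (upper m'))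
     = (\<lambda>j k. fmul n (fmul n (lower p') (lower p)) (fmul n (upper m) (upper m')) j k
        + fmul n (lower p') (fmul n (hank p m) (upper m')) j k)"
    by (simp only: fmul_add_left fmul_add_right fmul_assoc)
  also have "feq n \<dots> (\<lambda>j k. fone j k + kern p p' m m' j k)"
  proof -
    have "feq n (fmul n (fmul n (lower p') (lower p)) (fmul n (upper m) (upper m'))) (fmul n fone fone)"
      using fmul_lower_lower[of n p' p] fmul_upper_upper[of n m m'] assms
      by (intro feq_fmul) (auto simp: upper_1 lower_1)
    then show ?thesis
      using fmul_fmul_kern[of n p' p m m'] fmul_fone_left[of n fone] by (simp add: feq_def)
  qed
  finally show ?thesis .
qed

text \<open>Trades a linear factor for a larger rate: with x = s/r, (n + 1) x^n is at most the
  geometric sum of x.\<close>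

lemma Suc_times_power_le:
  fixes s r :: real
  assumes "0 \<le> s" "s < r"
  shows "real (Suc n) * s ^ n \<le> r / (r - s) * r ^ n"
proof -
  define x where "x = s / r"
  have x: "0 \<le> x" "x < 1" "s = x * r" using assms by (auto simp: x_def)
  have "real (Suc n) * x ^ n = (\<Sum>k<Suc n. x ^ n)" by simp
  also have "\<dots> \<le> (\<Sum>k<Suc n. x ^ k)"
    using x by (intro sum_mono power_decreasing) auto
  also have "\<dots> \<le> 1 / (1 - x)" by (rule sum_power_le_geometric) (use x in auto)
  also have "\<dots> = r / (r - s)" using assms by (simp add: x_def divide_simps)
  finally have "real (Suc n) * x ^ n * r ^ n \<le> r / (r - s) * r ^ n"
    using assms by (intro mult_right_mono) auto
  then show ?thesis by (simp add: x(3) power_mult_distrib mult_ac)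
qed

text \<open>The powers along each triangular factor and the Hankel matrix combine to
  \<open>s ^ j * s ^ k\<close>, independently of a and b; the number (j + 1)(k + 1) of terms is
  absorbed by enlarging s to r. The Hankel bound \<open>H\<close> is kept apart from
  \<open>C\<close> and \<open>D\<close> because it alone is quadratically small in the expansion
  near the identity.\<close>

lemma norm_kern_le:
  assumes sr: "0 \<le> s" "s < r" "r < 1"
    and h: "\<And>j k. norm (hank p m j k) \<le> H * s ^ (j + k)"
    and "geom_bdd C s p'" "geom_bdd D s m'"
  shows "norm (kern p p' m m' j k) \<le> C * D * H * (r / (r - s))\<^sup>2 * r ^ (j + k)"
proof -
  note nn = geom_bdd_nonneg[OF assms(5)] geom_bdd_nonneg[OF assms(6)]
  have H: "0 \<le> H" using order.trans[OF norm_ge_zero h[of 0 0]] by simp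
  have "norm (kern p p' m m' j k) \<le> (\<Sum>a\<le>j. \<Sum>b\<le>k. C * D * H * s ^ j * s ^ k)"
    unfolding kern_def
  proof (intro order.trans[OF norm_sum] sum_mono)
    fix a b assume ab: "a \<in> {..j}" "b \<in> {..k}"
    have "norm (lower p' j a * hank p m a b * upper m' b k) \<le> (C * s ^ (j - a)) * (H * s ^ (a + b)) * (D * s ^ (k - b))"
      unfolding norm_mult using assms ab nn H norm_upper_le[OF assms(5), of a j] norm_upper_le[OF assms(6), of b k]
      by (intro mult_mono h) (auto simp: lower_def)
    also have "\<dots> = C * D * H * (s ^ (j - a) * s ^ a) * (s ^ (k - b) * s ^ b)"
      by (simp add: power_add mult_ac)
    also have "\<dots> = C * D * H * s ^ j * s ^ k"
      using ab by (simp add: power_add[symmetric])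
    finally show "norm (lower p' j a * hank p m a b * upper m' b k) \<le> C * D * H * s ^ j * s ^ k" .
  qed
  also have "\<dots> = C * D * H * ((real (Suc j) * s ^ j) * (real (Suc k) * s ^ k))"
    by simp
  also have "\<dots> \<le> C * D * H * ((r / (r - s) * r ^ j) * (r / (r - s) * r ^ k))"
    using sr nn H by (intro mult_left_mono mult_mono Suc_times_power_le) auto
  finally show ?thesis by (simp add: power2_eq_square power_add mult_ac)
qed

lemma suminf_geometric_mult:
  fixes s :: real
  assumes "0 \<le> s" "s < 1"
  shows "(\<Sum>i. C * s ^ i) = C / (1 - s)" "summable (\<lambda>i. C * s ^ i)"
  using assms by (auto simp: suminf_mult suminf_geometric summable_geometric intro!: summable_mult)

lemma norm_toep_le:
  assumes s: "0 \<le> s" "s < 1" and "geom_bdd C s m" "geom_bdd D s p"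
  shows "norm (toep p m j k) \<le> C * D / (1 - s) * s ^ ((max j k - j) + (max j k - k))"
proof -
  define M where "M = max j k"
  have "(\<Sum>i<M. upper m j i * upper p k i) = 0"
    by (intro sum.neutral) (auto simp: upper_def M_def)
  then have "toep p m j k = (\<Sum>i. upper m j (i + M) * upper p k (i + M))"
    unfolding toep_def using suminf_split_initial_segment[OF summable_toep[OF assms, of j k], of M] by simp
  moreover have "norm (upper m j (i + M) * upper p k (i + M)) \<le> C * D * s ^ ((M - j) + (M - k)) * s ^ i" for i
    by (rule norm_upper_upper_le[OF assms]) (auto simp: M_def)
  ultimately show ?thesis
    using norm_suminf_le[of "\<lambda>i. upper m j (i + M) * upper p k (i + M)"
        "\<lambda>i. C * D * s ^ ((M - j) + (M - k)) * s ^ i"] s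
    by (simp add: suminf_geometric_mult M_def)
qed

section \<open>Asymptotic multiplicativity of the determinant\<close>

lemma toep_mult_right:
  assumes s: "0 < s" "s < 1" and m1: "geom_bdd C s m1" and m2: "geom_bdd C s m2" and p: "geom_bdd C s p"
  shows "toep p (m1 * m2) j k = (\<Sum>i. upper m1 j i * toep p m2 i k)"
proof -
  note nn = geom_bdd_nonneg[OF m1]
  \<comment> \<open>For i between j and l the product only decays like \<open>s ^ (l - j)\<close>.
    Writing s = q * q and spending one power of q on i gives decay in both summation
    indices.\<close>
  define q where "q = sqrt s"
  have q: "0 < q" "q < 1" "q * q = s" using s by (auto simp: q_def)
  define f where "f = (\<lambda>i l. upper m1 j i * upper m2 i l * upper p k l)"
  have f: "norm (f i l) \<le> C * C * C / s ^ j * q ^ i * q ^ l" for i l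
  proof (cases "j \<le> i \<and> i \<le> l")
    case True
    have "norm (f i l) \<le> (C * s ^ (i - j)) * (C * s ^ (l - i)) * C"
      unfolding f_def norm_mult using True nn s norm_upper_le[OF m1, of j i] norm_upper_le[OF m2, of i l] norm_upper_le_const[OF p, of k l]
      by (intro mult_mono) auto
    also have "\<dots> = C * C * C * s ^ (l - j)"
      using True by (simp add: power_add[symmetric])
    also have "s ^ (l - j) = q ^ l * q ^ l / s ^ j"
      using True s q by (simp add: power_diff power_mult_distrib[symmetric])
    also have "C * C * C * (q ^ l * q ^ l / s ^ j) \<le> C * C * C * (q ^ i * q ^ l / s ^ j)"
      using True s q nn
      by (intro mult_left_mono divide_right_mono mult_right_mono power_decreasing) auto
    finally have "norm (f i l) \<le> C * C * C * (q ^ i * q ^ l / s ^ j)" .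
    then show ?thesis by (simp add: mult_ac)
  next
    case False
    then have "f i l = 0" by (auto simp: f_def upper_def)
    then show ?thesis using nn q s by simp
  qed
  have "toep p (m1 * m2) j k = (\<Sum>l. \<Sum>i. f i l)"
    unfolding toep_def
  proof (rule suminf_cong)
    fix l
    have "upper (m1 * m2) j l = (\<Sum>i<Suc (j + l). upper m1 j i * upper m2 i l)"
      using fmul_upper_upper[of "Suc (j + l)" m1 m2] by (simp add: feq_def fmul_def)
    then have "upper (m1 * m2) j l * upper p k l = (\<Sum>i<Suc (j + l). f i l)"
      by (simp add: f_def sum_distrib_right del: sum.lessThan_Suc)
    also have "\<dots> = (\<Sum>i. f i l)"
      by (rule suminf_finite[symmetric]) (auto simp: f_def upper_def)
    finally show "upper (m1 * m2) j l * upper p k l = (\<Sum>i. f i l)" .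
  qed
  also have "\<dots> = (\<Sum>i. \<Sum>l. f i l)"
    using suminf_swap_geometric[of q f "C * C * C / s ^ j"] q f by simp
  also have "\<dots> = (\<Sum>i. upper m1 j i * toep p m2 i k)"
    unfolding toep_def f_def
    using summable_toep[OF _ _ m2 p] s by (intro suminf_cong) (simp add: mult.assoc suminf_mult)
  finally show ?thesis .
qed

text \<open>Both error terms are exponentially small: \<open>E\<close> because its Hankel factor starts at row \<open>n\<close>, and the product
  because \<open>Z\<close> is concentrated at the corner \<open>(n, n)\<close> and the Hankel matrix at the corner \<open>(0, 0)\<close>.\<close>

lemma toep_mult_right_feq:
  fixes n :: nat
  assumes s: "0 < s" "s < 1" and m1: "geom_bdd C s m1" and m2: "geom_bdd C s m2" and p: "geom_bdd C s p"
    and p': "p * p' = 1"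
  defines "Z \<equiv> \<lambda>j k. \<Sum>i. upper m1 j (i + n) * upper p k (i + n)"
    and "E \<equiv> \<lambda>j k. \<Sum>i. upper m1 j (i + n) * hank p m2 (i + n) k"
  shows "feq n (\<lambda>j k. toep p (m1 * m2) j k - fmul n (toep p m1) (fmul n (lower p') (toep p m2)) j k)
    (\<lambda>j k. E j k - fmul n Z (fmul n (lower p') (hank p m2)) j k)"
proof -
  have s': "0 \<le> s" using s by simp
  note nn = geom_bdd_nonneg[OF m1]
  have sZ: "summable (\<lambda>i. upper m1 j (i + n) * upper p k (i + n))" for j k
    using summable_toep[OF s' s(2) m1 p, of j k]
    by (simp add: summable_iff_shift[of "\<lambda>i. upper m1 j i * upper p k i"])
  have sE: "summable (\<lambda>i. upper m1 j (i + n) * hank p m2 (i + n) k)" for j k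
  proof (rule summable_comparison_test'[OF suminf_geometric_mult(2)[OF s' s(2)]])
    fix i
    have "norm (upper m1 j (i + n) * hank p m2 (i + n) k) \<le> C * (C * C / (1 - s) * s ^ (i + n + k))"
      unfolding norm_mult using s nn
      by (intro mult_mono norm_upper_le_const[OF m1] norm_hank_le[OF _ _ p m2]) auto
    also have "\<dots> = C * (C * C / (1 - s) * s ^ (n + k)) * s ^ i"
      by (simp add: power_add mult_ac)
    finally show "norm (upper m1 j (i + n) * hank p m2 (i + n) k) \<le> C * (C * C / (1 - s) * s ^ (n + k)) * s ^ i" .
  qed
  have T1: "feq n (toep p m1) (\<lambda>j k. fmul n (upper m1) (lower p) j k + Z j k)"
    unfolding feq_def
  proof (intro allI impI)
    fix j k assume "j < n" "k < n"
    then show "toep p m1 j k = fmul n (upper m1) (lower p) j k + Z j k"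
      using suminf_split_initial_segment[OF summable_toep[OF s' s(2) m1 p, of j k], of n]
      by (simp add: toep_def Z_def fmul_def lower_def)
  qed
  have sT: "summable (\<lambda>i. upper m1 j i * toep p m2 i k)" for j k
  proof (rule summable_comparison_test'[OF suminf_geometric_mult(2)[OF s' s(2)], of j])
    fix i assume "j \<le> i"
    have "norm (upper m1 j i * toep p m2 i k) \<le> (C * s ^ (i - j)) * (C * C / (1 - s) * 1)"
      unfolding norm_mult
    proof (rule mult_mono)
      show "norm (upper m1 j i) \<le> C * s ^ (i - j)"
        using norm_upper_le[OF m1, of j i] \<open>j \<le> i\<close> by simp
      have "norm (toep p m2 i k) \<le> C * C / (1 - s) * s ^ ((max i k - i) + (max i k - k))"
        by (rule norm_toep_le[OF s' s(2) m2 p])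
      also have "\<dots> \<le> C * C / (1 - s) * 1"
        using s nn by (intro mult_left_mono power_le_one) auto
      finally show "norm (toep p m2 i k) \<le> C * C / (1 - s) * 1" .
    qed (use s nn in auto)
    also have "\<dots> = C * (C * C / (1 - s)) / s ^ j * s ^ i"
      using \<open>j \<le> i\<close> s by (simp add: power_diff mult_ac)
    finally show "norm (upper m1 j i * toep p m2 i k) \<le> C * (C * C / (1 - s)) / s ^ j * s ^ i" .
  qed
  have T12: "feq n (toep p (m1 * m2))
     (\<lambda>j k. fmul n (upper m1) (toep p m2) j k + (fmul n Z (upper m2) j k + E j k))"
    unfolding feq_def
  proof (intro allI impI)
    fix j k assume jk: "j < n" "k < n"
    have "toep p (m1 * m2) j k = (\<Sum>i. upper m1 j (i + n) * toep p m2 (i + n) k) + fmul n (upper m1) (toep p m2) j k"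
      unfolding toep_mult_right[OF s m1 m2 p] fmul_def
      by (rule suminf_split_initial_segment[OF sT])
    also have "(\<Sum>i. upper m1 j (i + n) * toep p m2 (i + n) k)
       = (\<Sum>i. (\<Sum>l<n. upper m1 j (i + n) * upper p l (i + n) * upper m2 l k) + upper m1 j (i + n) * hank p m2 (i + n) k)"
    proof (rule suminf_cong)
      fix i
      \<comment> \<open>In the rows beyond n the lower-upper form is used; its triangular part only
        needs columns below n and reassembles to \<open>Z\<close> times \<open>upper m2\<close>, its
        Hankel part to \<open>E\<close>.\<close>
      have "toep p m2 (i + n) k = (\<Sum>l<n. lower p (i + n) l * upper m2 l k) + hank p m2 (i + n) k"
        using jk by (intro toep_eq_sum_add_hank[OF s' s(2) m2 p]) auto
      then show "upper m1 j (i + n) * toep p m2 (i + n) k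
        = (\<Sum>l<n. upper m1 j (i + n) * upper p l (i + n) * upper m2 l k) + upper m1 j (i + n) * hank p m2 (i + n) k"
        by (simp add: distrib_left sum_distrib_left lower_def mult.assoc)
    qed
    also have "\<dots> = (\<Sum>i. \<Sum>l<n. upper m1 j (i + n) * upper p l (i + n) * upper m2 l k) + E j k"
      unfolding E_def by (intro suminf_add[symmetric] sE summable_sum summable_mult2 sZ)
    also have "(\<Sum>i. \<Sum>l<n. upper m1 j (i + n) * upper p l (i + n) * upper m2 l k) = fmul n Z (upper m2) j k"
      unfolding Z_def fmul_def
      by (subst suminf_sum) (auto intro!: summable_mult2 sZ sum.cong simp: suminf_mult2[OF sZ])
    finally show "toep p (m1 * m2) j k = fmul n (upper m1) (toep p m2) j k + (fmul n Z (upper m2) j k + E j k)"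
      by simp
  qed
  have LL: "feq n (fmul n (lower p) (lower p')) fone" "feq n (fmul n (lower p') (lower p)) fone"
    using fmul_lower_lower[of n p p'] fmul_lower_lower[of n p' p] p' by (auto simp: lower_1 mult.commute)
  \<comment> \<open>Splitting \<open>toep p m1\<close> as upper-lower plus \<open>Z\<close>, and
    then \<open>toep p m2\<close> as lower-upper plus Hankel next to \<open>Z\<close>, cancels
    \<open>lower p'\<close> on both sides. The term \<open>Z\<close> times \<open>upper m2\<close>
    arises here and in \<open>T12\<close>, so it drops out of the difference.\<close>
  have "feq n (fmul n (toep p m1) (fmul n (lower p') (toep p m2)))
     (fmul n (\<lambda>j k. fmul n (upper m1) (lower p) j k + Z j k) (fmul n (lower p') (toep p m2)))"
    by (intro feq_fmul T1 feq_refl)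
  also have "\<dots> = (\<lambda>j k. fmul n (upper m1) (fmul n (fmul n (lower p) (lower p')) (toep p m2)) j k
      + fmul n Z (fmul n (lower p') (toep p m2)) j k)"
    by (simp only: fmul_add_left fmul_assoc)
  finally have A: "feq n (fmul n (toep p m1) (fmul n (lower p') (toep p m2))) \<dots>" .
  have B: "feq n (fmul n (upper m1) (fmul n (fmul n (lower p) (lower p')) (toep p m2))) (fmul n (upper m1) (toep p m2))"
    by (intro feq_fmul feq_refl feq_trans[OF feq_fmul[OF LL(1) feq_refl] fmul_fone_left])
  have "feq n (fmul n Z (fmul n (lower p') (toep p m2)))
     (fmul n Z (fmul n (lower p') (\<lambda>j k. fmul n (lower p) (upper m2) j k + hank p m2 j k)))"
    by (intro feq_fmul toep_feq_lower_upper[OF s' s(2) m2 p] feq_refl)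
  also have "\<dots> = (\<lambda>j k. fmul n Z (fmul n (fmul n (lower p') (lower p)) (upper m2)) j k
      + fmul n Z (fmul n (lower p') (hank p m2)) j k)"
    by (simp only: fmul_add_right fmul_assoc)
  finally have C: "feq n (fmul n Z (fmul n (lower p') (toep p m2))) \<dots>" .
  have D: "feq n (fmul n Z (fmul n (fmul n (lower p') (lower p)) (upper m2))) (fmul n Z (upper m2))"
    by (intro feq_fmul feq_refl feq_trans[OF feq_fmul[OF LL(2) feq_refl] fmul_fone_left])
  show ?thesis
    using T12 A B C D by (simp add: feq_def)
qed

lemma fps_nth_0_right_inverse: "f * g = 1 \<Longrightarrow> fps_nth f 0 = 1 \<Longrightarrow> fps_nth g 0 = (1 :: complex)"
  by (metis fps_mult_nth_0 fps_one_nth mult_1)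

lemma fdet_toep_kern:
  assumes s: "0 \<le> s" "s < 1" and "geom_bdd C s m" "geom_bdd D s p" and "p' * p = 1" "m * m' = 1"
    and "fps_nth p 0 = 1" "fps_nth m 0 = 1"
  shows "fdet n (toep p m) = fdet n (\<lambda>j k. fone j k + kern p p' m m' j k)"
proof -
  have 1: "fps_nth p' 0 = 1" "fps_nth m' 0 = 1"
    using assms fps_nth_0_right_inverse[of p p'] fps_nth_0_right_inverse[of m m'] by (simp_all add: mult.commute)
  have "fdet n (\<lambda>j k. fone j k + kern p p' m m' j k) = fdet n (fmul n (lower p') (fmul n (toep p m) (upper m')))"
    by (rule feq_fdet[OF fmul_toep_kern[OF assms(1-6)], symmetric])
  then show ?thesis by (simp add: fdet_fmul fdet_lower fdet_upper 1)
qed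

text \<open>The inserted factor \<open>lower p'\<close> has determinant 1, so the matrix product has
  determinant equal to the product of the two determinants. Multiplying by \<open>lower p'\<close>
  and \<open>upper (m1' * m2')\<close>, again of determinant 1, brings both sides to the form
  identity plus a bounded kernel, as \<open>fdet_perturb\<close> requires.\<close>

lemma fdet_toep_mult_tendsto:
  assumes s: "0 < s" "s < 1"
    and b: "geom_bdd C s p" "geom_bdd C s p'" "geom_bdd C s m1" "geom_bdd C s m2"
      "geom_bdd C s (m1 * m2)" "geom_bdd C s (m1' * m2')"
    and inv: "p * p' = 1" "m1 * m1' = 1" "m2 * m2' = 1"
    and 1: "fps_nth p 0 = 1" "fps_nth m1 0 = 1" "fps_nth m2 0 = 1"
  shows "(\<lambda>n. fdet n (toep p (m1 * m2)) - fdet n (toep p m1) * fdet n (toep p m2)) \<longlonglongrightarrow> 0"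
proof -
  have s': "0 \<le> s" using s by simp
  note nn = geom_bdd_nonneg[OF b(1)]
  define K where "K = kern p p' (m1 * m2) (m1' * m2')"
  define H where "H = C * C / (1 - s)"
  have H: "0 \<le> H" using nn s by (simp add: H_def)
  have h: "norm (hank p m2 j k) \<le> H * s ^ (j + k)" for j k
    unfolding H_def by (rule norm_hank_le[OF s' s(2) b(1,4)])
  have p'0: "fps_nth p' 0 = 1" and m'0: "fps_nth (m1' * m2') 0 = 1"
    using 1 inv[THEN fps_nth_0_right_inverse] by (simp_all add: fps_mult_nth_0)
  have inv12: "(m1 * m2) * (m1' * m2') = 1"
    using inv by (metis mult.assoc mult.commute mult_1)
  define r where "r = (s + 1) / 2"
  have r: "0 \<le> r" "s < r" "r < 1" using s by (auto simp: r_def)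
  define Kc where "Kc = C * C * (C * C / (1 - s)) * (r / (r - s))\<^sup>2"
  have Kc: "0 \<le> Kc" using nn s r by (auto simp: Kc_def)
  have K: "norm (K j k) \<le> Kc * r ^ (j + k)" for j k
    unfolding K_def Kc_def
    by (rule norm_kern_le[OF s' r(2,3) _ b(2,6)]) (rule norm_hank_le[OF s' s(2) b(1,5)])
  define M where "M = Kc / (1 - r)\<^sup>2"
  have M: "fnorm n K \<le> M" for n
    unfolding M_def by (rule fnorm_le_geometric[OF r(1,3) Kc K])
  define \<Delta> where "\<Delta> n = (\<lambda>j k. toep p (m1 * m2) j k - fmul n (toep p m1) (fmul n (lower p') (toep p m2)) j k)" for n
  have \<Delta>: "norm (\<Delta> n j k) \<le> (C * H / (1 - s) + real n ^ 2 * (H * (C * H))) * s ^ n" if jk: "j < n" "k < n" for n j k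
  proof -
    define Z where "Z = (\<lambda>j k. \<Sum>i. upper m1 j (i + n) * upper p k (i + n))"
    define E where "E = (\<lambda>j k. \<Sum>i. upper m1 j (i + n) * hank p m2 (i + n) k)"
    have eq: "\<Delta> n j k = E j k - fmul n Z (fmul n (lower p') (hank p m2)) j k"
      using toep_mult_right_feq[OF s b(3,4,1) inv(1), of n] jk
      by (simp add: feq_def \<Delta>_def E_def Z_def)
    have E: "norm (E j k) \<le> C * H / (1 - s) * s ^ n"
    proof -
      have "norm (upper m1 j (i + n) * hank p m2 (i + n) k) \<le> C * (H * s ^ n) * s ^ i" for i
      proof -
        have "norm (upper m1 j (i + n) * hank p m2 (i + n) k) \<le> C * (H * s ^ (i + n + k))"
          unfolding norm_mult using s nn
          by (intro mult_mono norm_upper_le_const[OF b(3)] h) auto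
        also have "\<dots> \<le> C * (H * s ^ (i + n))"
          using s nn H by (intro mult_left_mono power_decreasing) auto
        finally show ?thesis by (simp add: power_add mult_ac)
      qed
      from norm_suminf_le[OF this suminf_geometric_mult(2)[OF s' s(2)]] show ?thesis
        by (simp add: E_def suminf_geometric_mult[OF s' s(2)])
    qed
    \<comment> \<open>Only the decay in the inner index l is kept: \<open>s ^ (n - l)\<close> here
      meets \<open>s ^ l\<close> from the Hankel side in \<open>LH\<close>, and every summand gets
      the full \<open>s ^ n\<close>.\<close>
    have Z: "norm (Z j l) \<le> H * s ^ (n - l)" if l: "l < n" for l
    proof -
      have "norm (upper m1 j (i + n) * upper p l (i + n)) \<le> C * C * s ^ (n - l) * s ^ i" for i
      proof -
        have "norm (upper m1 j (i + n) * upper p l (i + n)) \<le> C * C * s ^ ((n - j) + (n - l)) * s ^ i"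
          using jk l by (intro norm_upper_upper_le[OF s' s(2) b(3,1)]) auto
        also have "\<dots> \<le> C * C * s ^ (n - l) * s ^ i"
          using s nn by (intro mult_right_mono mult_left_mono power_decreasing) auto
        finally show ?thesis .
      qed
      from norm_suminf_le[OF this suminf_geometric_mult(2)[OF s' s(2)]] show ?thesis
        by (simp add: Z_def H_def suminf_geometric_mult[OF s' s(2)])
    qed
    have LH: "norm (fmul n (lower p') (hank p m2) l k) \<le> real n * (C * H) * s ^ l" for l
    proof -
      have "norm (fmul n (lower p') (hank p m2) l k) \<le> (\<Sum>a<n. C * H * s ^ l)"
        unfolding fmul_def
      proof (intro order.trans[OF norm_sum] sum_mono)
        fix a
        show "norm (lower p' l a * hank p m2 a k) \<le> C * H * s ^ l"
        proof (cases "a \<le> l")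
          case True
          have "norm (lower p' l a * hank p m2 a k) \<le> (C * s ^ (l - a)) * (H * s ^ (a + k))"
            unfolding norm_mult lower_def using True s nn norm_upper_le[OF b(2), of a l]
            by (intro mult_mono h) auto
          also have "\<dots> = C * H * s ^ (l + k)"
            using True by (simp add: power_add[symmetric])
          also have "\<dots> \<le> C * H * s ^ l"
            using s nn H by (intro mult_left_mono power_decreasing) auto
          finally show ?thesis .
        qed (use nn H s in \<open>auto simp: lower_def upper_def\<close>)
      qed
      then show ?thesis by simp
    qed
    have "norm (fmul n Z (fmul n (lower p') (hank p m2)) j k) \<le> (\<Sum>l<n. H * s ^ (n - l) * (real n * (C * H) * s ^ l))"
      unfolding fmul_def[of n Z] using Z H s
      by (intro order.trans[OF norm_sum] sum_mono) (auto simp: norm_mult intro!: mult_mono LH)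
    also have "\<dots> = (\<Sum>l<n. H * (real n * (C * H)) * s ^ n)"
    proof (rule sum.cong[OF refl])
      fix l assume "l \<in> {..<n}"
      then have "s ^ n = s ^ (n - l) * s ^ l" by (simp add: power_add[symmetric])
      then show "H * s ^ (n - l) * (real n * (C * H) * s ^ l) = H * (real n * (C * H)) * s ^ n"
        by (simp add: mult_ac)
    qed
    also have "\<dots> = real n ^ 2 * (H * (C * H)) * s ^ n"
      by (simp add: power2_eq_square)
    finally show ?thesis
      unfolding eq using E norm_triangle_ineq4[of "E j k" "fmul n Z (fmul n (lower p') (hank p m2)) j k"]
      by (simp add: distrib_right)
  qed
  \<comment> \<open>The triangular factors are bounded crudely by n^2 C; all polynomial factors lose
    against \<open>s ^ n\<close>.\<close>
  define \<delta> where "\<delta> n = real n ^ 2 * C * (real n ^ 2 * ((C * H / (1 - s) + real n ^ 2 * (H * (C * H))) * s ^ n) * (real n ^ 2 * C))" for n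
  have "\<delta> \<longlonglongrightarrow> 0"
    unfolding \<delta>_def using s by real_asymp
  then have lim: "(\<lambda>n. \<delta> n * exp (2 * M + \<delta> n)) \<longlonglongrightarrow> 0"
    by (auto intro!: tendsto_eq_intros)
  show ?thesis
  proof (rule Lim_null_comparison[OF _ lim], rule always_eventually, rule allI)
    fix n
    define \<Delta>' where "\<Delta>' = fmul n (lower p') (fmul n (\<Delta> n) (upper (m1' * m2')))"
    have "fnorm n \<Delta>' \<le> fnorm n (lower p') * (fnorm n (\<Delta> n) * fnorm n (upper (m1' * m2')))"
      unfolding \<Delta>'_def
      by (intro order.trans[OF fnorm_fmul_le] mult_left_mono fnorm_fmul_le fnorm_nonneg)
    also have "\<dots> \<le> \<delta> n"
    proof -
      have "fnorm n (lower p') \<le> real n ^ 2 * C" "fnorm n (upper (m1' * m2')) \<le> real n ^ 2 * C"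
        using norm_upper_le_const[OF b(2) s' s(2)] norm_upper_le_const[OF b(6) s' s(2)]
        by (auto intro!: fnorm_le_const simp: lower_def)
      moreover have "fnorm n (\<Delta> n) \<le> real n ^ 2 * ((C * H / (1 - s) + real n ^ 2 * (H * (C * H))) * s ^ n)"
        by (rule fnorm_le_const[OF \<Delta>])
      ultimately show ?thesis
        unfolding \<delta>_def using nn H s by (intro mult_mono) (auto simp: fnorm_nonneg)
    qed
    finally have \<delta>: "fnorm n \<Delta>' \<le> \<delta> n" .
    define P where "P = fmul n (toep p m1) (fmul n (lower p') (toep p m2))"
    have A: "fdet n (toep p (m1 * m2)) = fdet n (\<lambda>j k. fone j k + K j k)"
      unfolding K_def using 1 inv
      by (intro fdet_toep_kern[OF s' s(2) b(5,1)] inv12) (auto simp: mult.commute fps_mult_nth)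
    have "fdet n (toep p m1) * fdet n (toep p m2) = fdet n (fmul n (lower p') (fmul n P (upper (m1' * m2'))))"
      by (simp add: P_def fdet_fmul fdet_lower fdet_upper p'0 m'0 del: fps_mult_nth_0)
    also have "\<dots> = fdet n (\<lambda>j k. fone j k + (K j k - \<Delta>' j k))"
    proof (rule feq_fdet)
      have "P = (\<lambda>j k. toep p (m1 * m2) j k - \<Delta> n j k)"
        by (simp add: P_def \<Delta>_def)
      then have "fmul n (lower p') (fmul n P (upper (m1' * m2')))
         = (\<lambda>j k. fmul n (lower p') (fmul n (toep p (m1 * m2)) (upper (m1' * m2'))) j k - \<Delta>' j k)"
        by (simp only: \<Delta>'_def fmul_diff_left fmul_diff_right)
      then show "feq n (fmul n (lower p') (fmul n P (upper (m1' * m2')))) (\<lambda>j k. fone j k + (K j k - \<Delta>' j k))"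
        using fmul_toep_kern[OF s' s(2) b(5,1), of p' "m1' * m2'" n] inv12 inv(1)
        by (simp add: feq_def K_def mult.commute)
    qed
    finally have B: "fdet n (toep p m1) * fdet n (toep p m2) = fdet n (\<lambda>j k. fone j k + (K j k - \<Delta>' j k))" .
    have "norm (fdet n (toep p (m1 * m2)) - fdet n (toep p m1) * fdet n (toep p m2))
      \<le> fnorm n (\<lambda>j k. K j k - (K j k - \<Delta>' j k)) * exp (fnorm n K + fnorm n (\<lambda>j k. K j k - \<Delta>' j k))"
      unfolding A B by (rule fdet_perturb)
    also have "\<dots> \<le> \<delta> n * exp (2 * M + \<delta> n)"
    proof (rule mult_mono)
      show "fnorm n (\<lambda>j k. K j k - (K j k - \<Delta>' j k)) \<le> \<delta> n" using \<delta> by simp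
      show "exp (fnorm n K + fnorm n (\<lambda>j k. K j k - \<Delta>' j k)) \<le> exp (2 * M + \<delta> n)"
        using fnorm_diff_le[of n K \<Delta>'] M[of n] \<delta> by simp
    qed (use order.trans[OF fnorm_nonneg \<delta>] in auto)
    finally show "norm (fdet n (toep p (m1 * m2)) - fdet n (toep p m1) * fdet n (toep p m2)) \<le> \<delta> n * exp (2 * M + \<delta> n)" .
  qed
qed

section \<open>Exponentials of functions holomorphic on a disc\<close>

lemma geom_bdd_mono: "geom_bdd C s f \<Longrightarrow> C \<le> D \<Longrightarrow> 0 \<le> s \<Longrightarrow> geom_bdd D s f"
  unfolding geom_bdd_def by (meson mult_right_mono order_trans zero_le_power)

lemma geom_bdd_fps_expansion:
  assumes "0 < \<rho>" "\<rho> < R" "f holomorphic_on ball 0 R" "\<And>z. norm z = \<rho> \<Longrightarrow> norm (f z) \<le> M"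
  shows "geom_bdd M (1 / \<rho>) (fps_expansion f 0)"
  unfolding geom_bdd_def
proof
  fix n
  have sub: "cball 0 \<rho> \<subseteq> ball (0::complex) R" using assms by auto
  have "norm ((deriv ^^ n) f 0) \<le> fact n * M / \<rho> ^ n"
  proof (rule Cauchy_inequality)
    show "f holomorphic_on ball 0 \<rho>"
      by (rule holomorphic_on_subset[OF assms(3)]) (use sub in auto)
    show "continuous_on (cball 0 \<rho>) f"
      by (rule continuous_on_subset[OF holomorphic_on_imp_continuous_on[OF assms(3)] sub])
  qed (use assms in auto)
  then show "norm (fps_nth (fps_expansion f 0) n) \<le> M * (1 / \<rho>) ^ n"
    by (simp add: fps_expansion_def norm_divide field_simps)
qed

lemma continuous_on_sphere_bounded:
  fixes f :: "complex \<Rightarrow> complex"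
  assumes "continuous_on (sphere 0 \<rho>) f"
  shows "\<exists>M. \<forall>z. norm z = \<rho> \<longrightarrow> norm (f z) \<le> M"
proof -
  have "bounded (f ` sphere 0 \<rho>)"
    by (intro compact_imp_bounded compact_continuous_image assms compact_sphere)
  then obtain M where M: "\<And>w. w \<in> f ` sphere 0 \<rho> \<Longrightarrow> norm w \<le> M"
    unfolding bounded_iff by blast
  show ?thesis
    by (rule exI[of _ M]) (auto intro!: M)
qed

text \<open>The parameter supplies all factors at once: t = 1 the Wiener-Hopf factor, t = -1 its
  inverse, t = 1/n its n-th root.\<close>

definition exp_fps :: "(complex \<Rightarrow> complex) \<Rightarrow> complex \<Rightarrow> complex fps" where
  "exp_fps A t = fps_expansion (\<lambda>z. exp (t * A z)) 0"

locale disc_function =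
  fixes A :: "complex \<Rightarrow> complex" and R :: real
  assumes R: "1 < R" and hol: "A holomorphic_on ball 0 R" and A0: "A 0 = 0"
begin

lemma hol_exp: "(\<lambda>z. exp (t * A z)) holomorphic_on ball 0 R"
  by (intro holomorphic_intros hol)

lemma has_fps_expansion_exp_fps: "(\<lambda>z. exp (t * A z)) has_fps_expansion exp_fps A t"
  unfolding exp_fps_def using R hol_exp by (intro has_fps_expansion_fps_expansion[of "ball 0 R"]) auto

lemma has_fps_expansion_disc: "A has_fps_expansion fps_expansion A 0"
  using R hol by (intro has_fps_expansion_fps_expansion[of "ball 0 R"]) auto

lemma exp_fps_add: "exp_fps A (t + u) = exp_fps A t * exp_fps A u"
proof (rule fps_expansion_unique_complex)
  show "(\<lambda>z. exp ((t + u) * A z)) has_fps_expansion exp_fps A (t + u)"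
    by (rule has_fps_expansion_exp_fps)
  show "(\<lambda>z. exp ((t + u) * A z)) has_fps_expansion exp_fps A t * exp_fps A u"
    using has_fps_expansion_mult[OF has_fps_expansion_exp_fps[of t] has_fps_expansion_exp_fps[of u]]
    by (simp add: exp_add distrib_right)
qed

lemma exp_fps_0: "exp_fps A 0 = 1"
  by (rule fps_expansion_unique_complex[OF has_fps_expansion_exp_fps[of 0]]) simp

lemma exp_fps_uminus: "exp_fps A t * exp_fps A (- t) = 1"
  using exp_fps_add[of t "- t"] by (simp add: exp_fps_0)

lemma exp_fps_nth_0: "fps_nth (exp_fps A t) 0 = 1"
  by (simp add: exp_fps_def fps_expansion_def A0)

lemma fps_expansion_nth_0: "fps_nth (fps_expansion A 0) 0 = 0"
  by (simp add: fps_expansion_def A0)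

lemma exp_fps_nth_1: "fps_nth (exp_fps A t) 1 = t * fps_nth (fps_expansion A 0) 1"
proof -
  have "(A has_field_derivative deriv A 0) (at 0)"
    using hol R by (intro holomorphic_derivI[of _ "ball 0 R"]) auto
  then have "((\<lambda>z. exp (t * A z)) has_field_derivative (t * deriv A 0)) (at 0)"
    by (auto intro!: derivative_eq_intros simp: A0)
  then show ?thesis
    by (simp add: exp_fps_def fps_expansion_def DERIV_imp_deriv)
qed

lemma exp_fps_sums: "norm z < R \<Longrightarrow> (\<lambda>n. fps_nth (exp_fps A t) n * z ^ n) sums exp (t * A z)"
  by (rule has_fps_expansion_imp_sums_complex[OF has_fps_expansion_exp_fps, where r = R]) (use hol_exp in auto)

lemma disc_sums: "norm z < R \<Longrightarrow> (\<lambda>n. fps_nth (fps_expansion A 0) n * z ^ n) sums A z"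
  by (rule has_fps_expansion_imp_sums_complex[OF has_fps_expansion_disc, where r = R]) (use hol in auto)

lemma geom_bdd_exp_fps: "\<exists>C. geom_bdd C (2 / (1 + R)) (exp_fps A t)"
proof -
  \<comment> \<open>Any radius strictly between 1 and R would do for the Cauchy estimates; the
    midpoint gives the rate 2 / (1 + R).\<close>
  define \<rho> where "\<rho> = (1 + R) / 2"
  have \<rho>: "0 < \<rho>" "\<rho> < R" using R by (auto simp: \<rho>_def)
  have "continuous_on (sphere 0 \<rho>) (\<lambda>z. exp (t * A z))"
    using \<rho> by (intro continuous_on_subset[OF holomorphic_on_imp_continuous_on[OF hol_exp]]) auto
  then obtain M where "\<And>z. norm z = \<rho> \<Longrightarrow> norm (exp (t * A z)) \<le> M"
    using continuous_on_sphere_bounded by blast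
  then have "geom_bdd M (1 / \<rho>) (exp_fps A t)"
    unfolding exp_fps_def by (intro geom_bdd_fps_expansion[OF \<rho> hol_exp]) auto
  then show ?thesis by (auto simp: \<rho>_def)
qed

text \<open>Cauchy estimates on one circle for e^(tA) and its first two Taylor remainders in t. The
  constant is shared by all |t| <= 1, as the expansion of the limit for t -> 0 needs.\<close>

lemma geom_bdd_exp_fps_uniform:
  "\<exists>C. geom_bdd C (2 / (1 + R)) (fps_expansion A 0) \<and> (\<forall>t. norm t \<le> 1 \<longrightarrow>
     geom_bdd C (2 / (1 + R)) (exp_fps A t) \<and>
     geom_bdd (norm t * C) (2 / (1 + R)) (exp_fps A t - 1) \<and>
     geom_bdd (norm t ^ 2 * C) (2 / (1 + R)) (exp_fps A t - 1 - fps_const t * fps_expansion A 0))"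
proof -
  define \<rho> where "\<rho> = (1 + R) / 2"
  have \<rho>: "0 < \<rho>" "\<rho> < R" using R by (auto simp: \<rho>_def)
  have "continuous_on (sphere 0 \<rho>) A"
    using \<rho> by (intro continuous_on_subset[OF holomorphic_on_imp_continuous_on[OF hol]]) auto
  then obtain M0 where M0: "\<And>z. norm z = \<rho> \<Longrightarrow> norm (A z) \<le> M0"
    using continuous_on_sphere_bounded by blast
  define M where "M = max M0 1"
  have M: "norm (A z) \<le> M" if "norm z = \<rho>" for z using M0[OF that] by (simp add: M_def)
  have M1: "1 \<le> M" by (simp add: M_def)
  \<comment> \<open>The constant of the second-order remainder; since M >= 1 it dominates the other
    bounds.\<close>
  define C where "C = exp M * M ^ 2"
  have "M * 1 \<le> M * M" using M1 by (intro mult_left_mono) auto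
  moreover have "M ^ 2 * 1 \<le> M ^ 2 * exp M" using M1 by (intro mult_left_mono) auto
  moreover have "exp M * 1 \<le> exp M * M ^ 2" "exp M * M \<le> exp M * M ^ 2"
    using M1 by (auto simp: power2_eq_square intro: order.trans[of 1 "M * 1"])
  ultimately have C: "M \<le> C" "exp M \<le> C" "exp M * M \<le> C"
    by (auto simp: C_def power2_eq_square mult_ac)
  have tA: "norm (t * A z) \<le> norm t * M" "norm (t * A z) \<le> M" if "norm t \<le> 1" "norm z = \<rho>" for t z
    using M[OF that(2)] that(1) mult_mono[of "norm t" 1 "norm (A z)" M]
    by (auto simp: norm_mult intro: mult_left_mono)
  have 0: "geom_bdd C (1 / \<rho>) (fps_expansion A 0)"
    using M C by (intro geom_bdd_fps_expansion[OF \<rho> hol]) force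
  have 1: "geom_bdd C (1 / \<rho>) (exp_fps A t)" if t: "norm t \<le> 1" for t
    unfolding exp_fps_def
  proof (rule geom_bdd_fps_expansion[OF \<rho> hol_exp])
    fix z :: complex assume z: "norm z = \<rho>"
    have "norm (exp (t * A z)) \<le> exp (norm (t * A z))"
      by (rule norm_exp)
    also have "\<dots> \<le> exp M" using tA(2)[OF t z] by simp
    also have "\<dots> \<le> C" by (rule C(2))
    finally show "norm (exp (t * A z)) \<le> C" .
  qed
  have 2: "geom_bdd (norm t * C) (1 / \<rho>) (exp_fps A t - 1)" if t: "norm t \<le> 1" for t
  proof -
    have "(\<lambda>z. exp (t * A z) - 1) has_fps_expansion exp_fps A t - 1"
      by (intro fps_expansion_intros has_fps_expansion_exp_fps)
    then have "exp_fps A t - 1 = fps_expansion (\<lambda>z. exp (t * A z) - 1) 0"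
      by (rule fps_expansion_eqI[symmetric])
    also have "geom_bdd (norm t * C) (1 / \<rho>) \<dots>"
    proof (rule geom_bdd_fps_expansion[OF \<rho>])
      show "(\<lambda>z. exp (t * A z) - 1) holomorphic_on ball 0 R"
        by (intro holomorphic_intros hol)
      fix z :: complex assume z: "norm z = \<rho>"
      have "norm (exp (t * A z) - 1) \<le> exp (norm (t * A z)) * norm (t * A z)"
        using Taylor_exp_field[of "t * A z" 0] by simp
      also have "\<dots> \<le> exp M * (norm t * M)"
        using tA[OF t z] by (intro mult_mono) auto
      also have "\<dots> = norm t * (exp M * M)" by simp
      also have "\<dots> \<le> norm t * C" using C by (intro mult_left_mono) auto
      finally show "norm (exp (t * A z) - 1) \<le> norm t * C" .
    qed
    finally show ?thesis .
  qed
  have 3: "geom_bdd (norm t ^ 2 * C) (1 / \<rho>) (exp_fps A t - 1 - fps_const t * fps_expansion A 0)" if t: "norm t \<le> 1" for t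
  proof -
    have "(\<lambda>z. exp (t * A z) - 1 - t * A z) has_fps_expansion exp_fps A t - 1 - fps_const t * fps_expansion A 0"
      by (intro fps_expansion_intros has_fps_expansion_exp_fps has_fps_expansion_disc)
    then have "exp_fps A t - 1 - fps_const t * fps_expansion A 0 = fps_expansion (\<lambda>z. exp (t * A z) - 1 - t * A z) 0"
      by (rule fps_expansion_eqI[symmetric])
    also have "geom_bdd (norm t ^ 2 * C) (1 / \<rho>) \<dots>"
    proof (rule geom_bdd_fps_expansion[OF \<rho>])
      show "(\<lambda>z. exp (t * A z) - 1 - t * A z) holomorphic_on ball 0 R"
        by (intro holomorphic_intros hol)
      fix z :: complex assume z: "norm z = \<rho>"
      have "norm (exp (t * A z) - 1 - t * A z) \<le> exp (norm (t * A z)) * norm (t * A z) ^ 2"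
        using Taylor_exp_field[of "t * A z" 1] by (simp add: power2_eq_square diff_diff_eq)
      also have "\<dots> \<le> exp M * (norm t * M) ^ 2"
        using tA[OF t z] by (intro mult_mono power_mono) auto
      also have "\<dots> = norm t ^ 2 * C" by (simp add: C_def power_mult_distrib)
      finally show "norm (exp (t * A z) - 1 - t * A z) \<le> norm t ^ 2 * C" .
    qed
    finally show ?thesis .
  qed
  have "2 / (1 + R) = 1 / \<rho>" by (simp add: \<rho>_def)
  then show ?thesis using 0 1 2 3 by metis
qed

end

section \<open>The limit of the normalised Toeplitz determinants\<close>

lemma hank_diff_left:
  assumes "0 \<le> s" "s < 1" "geom_bdd C s f" "geom_bdd D s g" "geom_bdd E s m"
  shows "hank (f - g) m j k = hank f m j k - hank g m j k"
  unfolding hank_def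
  by (subst suminf_diff) (use norm_hank_le(2)[OF assms(1,2,3,5)] norm_hank_le(2)[OF assms(1,2,4,5)] in
      \<open>auto simp: left_diff_distrib\<close>)

lemma hank_commute: "hank p m j k = hank m p k j"
  by (simp add: hank_def mult.commute)

lemma hank_diff_1: "hank (p - 1) (m - 1) = hank p m"
  by (simp add: hank_def fun_eq_iff)

text \<open>The triangular factors are replaced by the identity one at a time; each error contains
  \<open>p' - 1\<close> or \<open>m' - 1\<close>, which is one order smaller near t = 0.\<close>

lemma kern_diff:
  "kern p p' m m' j k - hank p m j k = kern p (p' - 1) m m' j k + kern p 1 m (m' - 1) j k"
proof -
  have "kern p 1 m 1 j k = (\<Sum>a\<le>j. \<Sum>b\<le>k. if a = j then (if b = k then hank p m j k else 0) else 0)"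
    unfolding kern_def by (intro sum.cong refl) (auto simp: lower_1 upper_1 fone_def)
  also have "\<dots> = (\<Sum>a\<le>j. if a = j then (\<Sum>b\<le>k. if b = k then hank p m j k else 0) else 0)"
    by (intro sum.cong) auto
  also have "\<dots> = hank p m j k"
    by simp
  finally have H: "kern p 1 m 1 j k = hank p m j k" .
  have low: "lower (f - g) j k = lower f j k - lower g j k" and upp: "upper (f - g) j k = upper f j k - upper g j k" for f g j k
    by (auto simp: lower_def upper_def)
  have "kern p (p' - 1) m m' j k = kern p p' m m' j k - kern p 1 m m' j k"
    by (simp add: kern_def low left_diff_distrib sum_subtractf)
  moreover have "kern p 1 m (m' - 1) j k = kern p 1 m m' j k - kern p 1 m 1 j k"
    by (simp add: kern_def upp right_diff_distrib sum_subtractf)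
  ultimately show ?thesis by (simp add: H)
qed

text \<open>Compare with v = exp (\<kappa> / n^2), whose n^2-th power is exp \<kappa>: the distance
  of \<open>w n\<close> from v is O(1/n^3) and taking n^2-th powers multiplies it by n^2 at most,
  leaving O(1/n).\<close>

lemma power_square_tendsto_exp:
  fixes w :: "nat \<Rightarrow> complex"
  assumes w: "\<And>n. n > 0 \<Longrightarrow> norm (w n - 1 - \<kappa> / of_nat n ^ 2) \<le> C / real n ^ 3"
  shows "(\<lambda>n. w n ^ (n ^ 2)) \<longlonglongrightarrow> exp \<kappa>"
proof -
  define Q where "Q = norm \<kappa> + max C 0"
  define E where "E = exp (norm \<kappa>) * norm \<kappa> ^ 2"
  have "norm (w n ^ (n ^ 2) - exp \<kappa>) \<le> exp Q * (max C 0 + E) / real n" if n: "n > 0" for n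
  proof -
    define v where "v = exp (\<kappa> / of_nat n ^ 2)"
    \<comment> \<open>A common bound for |w n| and |v|. Division by \<open>e\<close> brings both
      into the unit disc, where k-th powers are k-Lipschitz; undoing it costs
      \<open>e ^ (n ^ 2)\<close> = exp Q, which is free of n.\<close>
    define e where "e = exp (Q / real n ^ 2)"
    have n1: "1 \<le> real n" using n by simp
    have n2: "1 \<le> real n ^ 2" "1 \<le> real n ^ 3" using n1 by simp_all
    have nk: "norm (\<kappa> / of_nat n ^ 2) = norm \<kappa> / real n ^ 2"
      by (simp add: norm_divide norm_power)
    have nk1: "norm \<kappa> / real n ^ 2 \<le> norm \<kappa>"
      using n2 by (simp add: divide_le_eq mult_le_cancel_left1)
    have Cn: "C / real n ^ 3 \<le> max C 0 / real n ^ 2"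
    proof -
      have "C / real n ^ 3 \<le> max C 0 / real n ^ 3" using n by (intro divide_right_mono) auto
      also have "\<dots> \<le> max C 0 / real n ^ 2"
        using n n1 by (intro divide_left_mono power_increasing mult_pos_pos) auto
      finally show ?thesis .
    qed
    have "norm (w n) \<le> norm (w n - 1 - \<kappa> / of_nat n ^ 2) + norm (1 + \<kappa> / of_nat n ^ 2)"
      using norm_triangle_ineq[of "w n - 1 - \<kappa> / of_nat n ^ 2" "1 + \<kappa> / of_nat n ^ 2"] by simp
    also have "\<dots> \<le> max C 0 / real n ^ 2 + (1 + norm \<kappa> / real n ^ 2)"
      using norm_triangle_ineq[of 1 "\<kappa> / of_nat n ^ 2"] w[OF n] Cn nk by simp
    also have "\<dots> = 1 + Q / real n ^ 2" by (simp add: Q_def add_divide_distrib)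
    also have "\<dots> \<le> e" unfolding e_def by (rule exp_ge_add_one_self)
    finally have we: "norm (w n) \<le> e" .
    have "norm v \<le> exp (norm (\<kappa> / of_nat n ^ 2))" unfolding v_def by (rule norm_exp)
    also have "\<dots> \<le> e" unfolding e_def nk by (simp add: Q_def divide_right_mono)
    finally have ve: "norm v \<le> e" .
    have e: "0 < e" by (simp add: e_def)
    have "norm (v - 1 - \<kappa> / of_nat n ^ 2) \<le> exp (norm \<kappa> / real n ^ 2) * (norm \<kappa> / real n ^ 2) ^ 2"
      using Taylor_exp_field[of "\<kappa> / of_nat n ^ 2" 1] unfolding v_def nk by (simp add: power2_eq_square diff_diff_eq)
    also have "\<dots> \<le> exp (norm \<kappa>) * (norm \<kappa> / real n ^ 2) ^ 2"
      using nk1 by (intro mult_right_mono) auto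
    also have "\<dots> = E / real n ^ 4" by (simp add: E_def power_divide)
    also have "\<dots> \<le> E / real n ^ 3"
      using n n1 by (intro divide_left_mono power_increasing mult_pos_pos) (auto simp: E_def)
    finally have vn: "norm (v - 1 - \<kappa> / of_nat n ^ 2) \<le> E / real n ^ 3" .
    have "norm (w n - v) \<le> norm (w n - 1 - \<kappa> / of_nat n ^ 2) + norm (v - 1 - \<kappa> / of_nat n ^ 2)"
      using norm_triangle_ineq4[of "w n - 1 - \<kappa> / of_nat n ^ 2" "v - 1 - \<kappa> / of_nat n ^ 2"] by simp
    also have "\<dots> \<le> max C 0 / real n ^ 3 + E / real n ^ 3"
      using w[OF n] vn divide_right_mono[of C "max C 0" "real n ^ 3"] by simp
    finally have wv: "norm (w n - v) \<le> (max C 0 + E) / real n ^ 3" by (simp add: add_divide_distrib)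
    have "norm ((w n / of_real e) ^ (n ^ 2) - (v / of_real e) ^ (n ^ 2)) \<le> real (n ^ 2) * norm (w n / of_real e - v / of_real e)"
      using we ve e by (intro norm_power_diff) (auto simp: norm_divide)
    also have "(w n / of_real e) ^ (n ^ 2) - (v / of_real e) ^ (n ^ 2) = (w n ^ (n ^ 2) - v ^ (n ^ 2)) / of_real (e ^ (n ^ 2))"
      by (simp add: power_divide diff_divide_distrib)
    also have "e ^ (n ^ 2) = exp Q"
      using n unfolding e_def by (subst exp_of_nat_mult[symmetric]) simp
    also have "v ^ (n ^ 2) = exp \<kappa>"
      using n unfolding v_def by (subst exp_of_nat_mult[symmetric]) simp
    also have "norm ((w n ^ (n ^ 2) - exp \<kappa>) / of_real (exp Q)) = norm (w n ^ (n ^ 2) - exp \<kappa>) / exp Q"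
      by (simp add: norm_divide)
    also have "real (n ^ 2) * norm (w n / of_real e - v / of_real e) \<le> real n ^ 2 * ((max C 0 + E) / real n ^ 3)"
    proof -
      have "1 \<le> e" unfolding e_def by (simp add: Q_def)
      then have "norm (w n / of_real e - v / of_real e) \<le> norm (w n - v)"
        by (simp add: diff_divide_distrib[symmetric] norm_divide divide_le_eq mult_le_cancel_left1)
      then show ?thesis using wv by (intro mult_mono) auto
    qed
    also have "\<dots> = (max C 0 + E) / real n"
      using n by (simp add: power2_eq_square power3_eq_cube)
    finally show ?thesis by (simp add: divide_le_eq mult_ac)
  qed
  then have "eventually (\<lambda>n. norm (w n ^ (n ^ 2) - exp \<kappa>) \<le> exp Q * (max C 0 + E) / real n) sequentially"
    by (intro eventually_sequentiallyI[of 1]) auto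
  moreover have "(\<lambda>n. exp Q * (max C 0 + E) / real n) \<longlonglongrightarrow> 0"
    by real_asymp
  ultimately have "(\<lambda>n. w n ^ (n ^ 2) - exp \<kappa>) \<longlonglongrightarrow> 0"
    by (rule Lim_null_comparison)
  then show ?thesis by (simp add: LIM_zero_iff)
qed

locale disc_pair = A: disc_function A R + B: disc_function B R for A B R
begin

text \<open>Decay rate of all coefficients, from the Cauchy estimates at radius (1 + R) / 2; the
  larger rate \<open>r\<close> leaves room to absorb polynomial factors.\<close>

definition s :: real where "s = 2 / (1 + R)"
definition r :: real where "r = (1 + s) / 2"

lemma s: "0 < s" "0 \<le> s" "s < 1"
  using A.R by (auto simp: s_def)

lemma r: "0 < r" "0 \<le> r" "s < r" "r < 1"
  using s by (auto simp: r_def)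

lemma common_bound: "\<exists>C. geom_bdd C s (exp_fps A t) \<and> geom_bdd C s (exp_fps A u) \<and> geom_bdd C s (exp_fps A t')
   \<and> geom_bdd C s (exp_fps B v) \<and> geom_bdd C s (exp_fps B w) \<and> geom_bdd C s (exp_fps B v') \<and> geom_bdd C s (exp_fps B w')"
proof -
  have "\<exists>C. \<forall>D\<ge>C. geom_bdd D s (exp_fps A x)" for x
    using A.geom_bdd_exp_fps[of x] s geom_bdd_mono unfolding s_def by blast
  moreover have "\<exists>C. \<forall>D\<ge>C. geom_bdd D s (exp_fps B x)" for x
    using B.geom_bdd_exp_fps[of x] s geom_bdd_mono unfolding s_def by blast
  ultimately obtain a b where a: "\<And>x D. a x \<le> D \<Longrightarrow> geom_bdd D s (exp_fps A x)"
    and b: "\<And>x D. b x \<le> D \<Longrightarrow> geom_bdd D s (exp_fps B x)"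
    by metis
  define M where "M = Max {a t, a u, a t', b v, b w, b v', b w'}"
  have M: "a t \<le> M" "a u \<le> M" "a t' \<le> M" "b v \<le> M" "b w \<le> M" "b v' \<le> M" "b w' \<le> M"
    unfolding M_def by (rule Max_ge; simp)+
  show ?thesis
    using a[OF M(1)] a[OF M(2)] a[OF M(3)] b[OF M(4)] b[OF M(5)] b[OF M(6)] b[OF M(7)] by blast
qed

lemma fdet_toep_converges:
  "\<exists>S D. \<forall>N. norm (fdet N (toep (exp_fps A t) (exp_fps B u)) - S) \<le> D * r ^ N"
proof -
  obtain C where b: "geom_bdd C s (exp_fps A t)" "geom_bdd C s (exp_fps A (- t))"
    "geom_bdd C s (exp_fps B u)" "geom_bdd C s (exp_fps B (- u))"
    using common_bound by metis
  define K where "K = kern (exp_fps A t) (exp_fps A (- t)) (exp_fps B u) (exp_fps B (- u))"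
  define c where "c = C * C * (C * C / (1 - s)) * (r / (r - s))\<^sup>2"
  have "norm (K j k) \<le> c * r ^ (j + k)" for j k
    unfolding K_def c_def
    by (rule norm_kern_le[OF s(2) r(3,4) _ b(2,4)]) (rule norm_hank_le[OF s(2,3) b(1,3)])
  moreover have "0 \<le> c" using geom_bdd_nonneg[OF b(1)] s r by (simp add: c_def)
  ultimately have "\<exists>S D. \<forall>N. norm (fdet N (\<lambda>j k. fone j k + K j k) - S) \<le> D * r ^ N"
    using r by (intro fdet_fone_add_converges)
  moreover have "fdet N (toep (exp_fps A t) (exp_fps B u)) = fdet N (\<lambda>j k. fone j k + K j k)" for N
    unfolding K_def using A.exp_fps_uminus[of t] B.exp_fps_uminus[of u]
    by (intro fdet_toep_kern[OF s(2,3) b(3,1)]) (auto simp: mult.commute A.exp_fps_nth_0 B.exp_fps_nth_0)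
  ultimately show ?thesis by simp
qed

text \<open>The arguments scale \<open>A\<close> and \<open>B\<close> independently, because
  multiplicativity is available in one factor while the other is held fixed.\<close>

definition S :: "complex \<Rightarrow> complex \<Rightarrow> complex" where
  "S t u = lim (\<lambda>N. fdet N (toep (exp_fps A t) (exp_fps B u)))"

lemma geometric_tendsto_0: "(\<lambda>N. D * r ^ N) \<longlonglongrightarrow> 0"
  using tendsto_mult_left[OF LIMSEQ_realpow_zero[OF r(2,4)], of D] by simp

lemma fdet_toep_rate: "\<exists>D. \<forall>N. norm (fdet N (toep (exp_fps A t) (exp_fps B u)) - S t u) \<le> D * r ^ N"
proof -
  obtain L D where L: "\<And>N. norm (fdet N (toep (exp_fps A t) (exp_fps B u)) - L) \<le> D * r ^ N"
    using fdet_toep_converges by blast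
  have "(\<lambda>N. fdet N (toep (exp_fps A t) (exp_fps B u)) - L) \<longlonglongrightarrow> 0"
    by (rule Lim_null_comparison[OF _ geometric_tendsto_0[of D]]) (simp add: L)
  then have "(\<lambda>N. fdet N (toep (exp_fps A t) (exp_fps B u))) \<longlonglongrightarrow> L"
    by (simp only: LIM_zero_iff)
  then have "S t u = L"
    unfolding S_def by (rule limI)
  then show ?thesis using L by blast
qed

lemma fdet_toep_tendsto: "(\<lambda>N. fdet N (toep (exp_fps A t) (exp_fps B u))) \<longlonglongrightarrow> S t u"
proof -
  obtain D where D: "\<And>N. norm (fdet N (toep (exp_fps A t) (exp_fps B u)) - S t u) \<le> D * r ^ N"
    using fdet_toep_rate by blast
  have "(\<lambda>N. fdet N (toep (exp_fps A t) (exp_fps B u)) - S t u) \<longlonglongrightarrow> 0"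
    by (rule Lim_null_comparison[OF _ geometric_tendsto_0[of D]]) (simp add: D)
  then show ?thesis by (simp only: LIM_zero_iff)
qed

lemma S_add_right: "S t (u + v) = S t u * S t v"
proof -
  obtain C where b: "geom_bdd C s (exp_fps A t)" "geom_bdd C s (exp_fps A (- t))"
    "geom_bdd C s (exp_fps B u)" "geom_bdd C s (exp_fps B v)" "geom_bdd C s (exp_fps B (u + v))"
    "geom_bdd C s (exp_fps B (- u + - v))"
    using common_bound by metis
  have "(\<lambda>n. fdet n (toep (exp_fps A t) (exp_fps B (u + v)))
      - fdet n (toep (exp_fps A t) (exp_fps B u)) * fdet n (toep (exp_fps A t) (exp_fps B v))) \<longlonglongrightarrow> 0"
    unfolding B.exp_fps_add
    by (rule fdet_toep_mult_tendsto[OF s(1,3) b(1-4) b(5,6)[unfolded B.exp_fps_add]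
      A.exp_fps_uminus B.exp_fps_uminus B.exp_fps_uminus A.exp_fps_nth_0 B.exp_fps_nth_0 B.exp_fps_nth_0])
  moreover have "(\<lambda>n. fdet n (toep (exp_fps A t) (exp_fps B (u + v)))
      - fdet n (toep (exp_fps A t) (exp_fps B u)) * fdet n (toep (exp_fps A t) (exp_fps B v)))
     \<longlonglongrightarrow> S t (u + v) - S t u * S t v"
    by (intro tendsto_diff tendsto_mult fdet_toep_tendsto)
  ultimately have "S t (u + v) - S t u * S t v = 0"
    using LIMSEQ_unique by blast
  then show ?thesis by simp
qed

lemma S_nat_right: "k > 0 \<Longrightarrow> S t (of_nat k * u) = S t u ^ k"
proof (induction k rule: nat_induct_non_zero)
  case (Suc n)
  have "of_nat (Suc n) * u = of_nat n * u + u"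
    by (simp add: distrib_right)
  then show ?case
    using Suc by (simp add: S_add_right)
qed simp

end

text \<open>Transposing the Toeplitz matrix exchanges the two factors; this transfers
  multiplicativity from the second argument to the first.\<close>

lemma disc_pair_S_swap:
  assumes "disc_pair A B R"
  shows "disc_pair.S A B t u = disc_pair.S B A u t"
proof -
  have "disc_pair B A R" using assms by (auto simp: disc_pair_def)
  moreover have "fdet N (toep p m) = fdet N (toep m p)" for N p m
    using fdet_transpose[of N "toep m p"] unfolding toep_transpose[of m p] .
  ultimately show ?thesis using assms by (simp add: disc_pair.S_def)
qed

lemma hank_diff_right:
  assumes "0 \<le> s" "s < 1" "geom_bdd C s f" "geom_bdd D s g" "geom_bdd E s m"
  shows "hank m (f - g) j k = hank m f j k - hank m g j k"
  using hank_diff_left[OF assms, of k j] by (simp add: hank_commute)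

lemma hank_const_mult:
  assumes "0 \<le> s" "s < 1" "geom_bdd C s f" "geom_bdd D s g"
  shows "hank (fps_const t * f) (fps_const u * g) j k = t * u * hank f g j k"
  unfolding hank_def
  by (subst suminf_mult[symmetric]) (use norm_hank_le(2)[OF assms] in \<open>auto simp: mult_ac\<close>)

lemma geom_bdd_const_mult:
  assumes "geom_bdd C s f"
  shows "geom_bdd (norm t * C) s (fps_const t * f)"
  using assms by (auto simp: geom_bdd_def norm_mult mult.assoc intro!: mult_left_mono)

lemma geom_bdd_1: "1 \<le> C \<Longrightarrow> 0 \<le> s \<Longrightarrow> geom_bdd C s 1"
  by (auto simp: geom_bdd_def fps_one_def)

context disc_pair
begin

abbreviation "Ac \<equiv> fps_expansion A 0"
abbreviation "Bc \<equiv> fps_expansion B 0"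

text \<open>The trace of the Hankel product of the logarithms, the form in which it arises from the
  second-order expansion.\<close>

definition \<kappa> :: complex where
  "\<kappa> = (\<Sum>i. hank Ac Bc i i)"

text \<open>Three replacements, each uniform in the size n: the determinant by 1 + tr K, the trace
  of K by the trace of \<open>hank p m\<close>, and the latter by \<open>t\<^sup>2\<close> times the
  trace of \<open>hank Ac Bc\<close>. Uniformity lets the bound survive the limit n ->
  infinity.\<close>

lemma S_small:
  "\<exists>C. \<forall>t. norm t \<le> 1 \<longrightarrow> norm (S t t - 1 - t\<^sup>2 * \<kappa>) \<le> C * norm t ^ 3"
proof -
  obtain C1 where C1: "geom_bdd C1 s Ac" "\<And>t. norm t \<le> 1 \<Longrightarrow> geom_bdd C1 s (exp_fps A t) \<and>
     geom_bdd (norm t * C1) s (exp_fps A t - 1) \<and>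
     geom_bdd (norm t ^ 2 * C1) s (exp_fps A t - 1 - fps_const t * Ac)"
    using A.geom_bdd_exp_fps_uniform unfolding s_def by blast
  obtain C2 where C2: "geom_bdd C2 s Bc" "\<And>t. norm t \<le> 1 \<Longrightarrow> geom_bdd C2 s (exp_fps B t) \<and>
     geom_bdd (norm t * C2) s (exp_fps B t - 1) \<and>
     geom_bdd (norm t ^ 2 * C2) s (exp_fps B t - 1 - fps_const t * Bc)"
    using B.geom_bdd_exp_fps_uniform unfolding s_def by blast
  define C where "C = max 1 (max C1 C2)"
  have CC: "C1 \<le> C" "C2 \<le> C" and C: "1 \<le> C" by (auto simp: C_def)
  have bA: "geom_bdd C s Ac" and bB: "geom_bdd C s Bc"
    using C1(1) C2(1) CC s by (auto intro: geom_bdd_mono)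
  have m: "norm t * C1 \<le> norm t * C" "norm t * C2 \<le> norm t * C"
    "norm t ^ 2 * C1 \<le> norm t ^ 2 * C" "norm t ^ 2 * C2 \<le> norm t ^ 2 * C" for t :: complex
    using CC by (auto intro: mult_left_mono)
  have b: "geom_bdd C s (exp_fps A t)" "geom_bdd (norm t * C) s (exp_fps A t - 1)"
    "geom_bdd (norm t ^ 2 * C) s (exp_fps A t - 1 - fps_const t * Ac)"
    "geom_bdd C s (exp_fps B t)" "geom_bdd (norm t * C) s (exp_fps B t - 1)"
    "geom_bdd (norm t ^ 2 * C) s (exp_fps B t - 1 - fps_const t * Bc)" if "norm t \<le> 1" for t
    using C1(2)[OF that] C2(2)[OF that] geom_bdd_mono[OF _ CC(1) s(2)] geom_bdd_mono[OF _ CC(2) s(2)]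
      geom_bdd_mono[OF _ m(1) s(2)] geom_bdd_mono[OF _ m(2) s(2)] geom_bdd_mono[OF _ m(3) s(2)] geom_bdd_mono[OF _ m(4) s(2)]
    by blast+
  define q where "q = (r / (r - s))\<^sup>2"
  have q: "0 \<le> q" by (simp add: q_def)
  define M where "M = C * C * (C * C / (1 - s)) * q / (1 - r)\<^sup>2"
  have M: "0 \<le> M" using C q s r by (simp add: M_def)
  \<comment> \<open>One summand for each of the three errors; the first is even of order
    T^4.\<close>
  define C' where "C' = M\<^sup>2 * exp M + 2 * (C * C * (C * C / (1 - s)) * q) / (1 - r) + 2 * (C * C / (1 - s)) / (1 - s)"
  have "norm (S t t - 1 - t\<^sup>2 * \<kappa>) \<le> C' * norm t ^ 3" if t: "norm t \<le> 1" for t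
  proof -
    define T where "T = norm t"
    have T: "0 \<le> T" "T \<le> 1" using t by (auto simp: T_def)
    have t': "norm (- t) \<le> 1" using t by simp
    note bt = b[OF t, folded T_def] and bt' = b[OF t', simplified norm_minus_cancel, folded T_def]
    define p where "p = exp_fps A t"
    define p' where "p' = exp_fps A (- t)"
    define m where "m = exp_fps B t"
    define m' where "m' = exp_fps B (- t)"
    note bp = bt(1-3)[folded p_def] and bm = bt(4-6)[folded m_def]
      and bp' = bt'(1,2)[folded p'_def] and bm' = bt'(4,5)[folded m'_def]
    \<comment> \<open>Hankel entries never see the constant coefficients, so \<open>p - 1\<close>
      and \<open>m - 1\<close>, both O(T), may be used for the bound; this makes \<open>K\<close> of
      order T^2.\<close>
    define h where "h = T * C * (T * C) / (1 - s)"
    have h0: "0 \<le> h" using C T s by (simp add: h_def)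
    have h: "norm (hank p m j k) \<le> h * s ^ (j + k)" for j k
      using norm_hank_le(1)[OF s(2,3) bp(2) bm(2)] by (simp add: hank_diff_1 h_def)
    define K where "K = kern p p' m m'"
    have K: "norm (K j k) \<le> C * C * h * q * r ^ (j + k)" for j k
      unfolding K_def q_def by (rule norm_kern_le[OF s(2) r(3,4) h bp'(1) bm'(1)])
    have "fnorm n K \<le> C * C * h * q / (1 - r)\<^sup>2" for n
      using C h0 q by (intro fnorm_le_geometric[OF r(2,4) _ K]) auto
    also have "C * C * h * q / (1 - r)\<^sup>2 = T\<^sup>2 * M"
      by (simp add: M_def h_def power2_eq_square)
    finally have nK: "fnorm n K \<le> T\<^sup>2 * M" for n .
    have T2M: "T\<^sup>2 * M \<le> M" using T M by (simp add: mult_left_le_one_le power_le_one)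
    have T43: "T ^ 4 \<le> T ^ 3" using T by (intro power_decreasing) auto
    have bound: "norm (fdet n (toep p m) - 1 - t\<^sup>2 * (\<Sum>i<n. hank Ac Bc i i)) \<le> C' * T ^ 3" for n
    proof -
      have D: "fdet n (toep p m) = fdet n (\<lambda>j k. fone j k + K j k)"
        unfolding K_def p_def m_def p'_def m'_def
        using A.exp_fps_uminus[of t] B.exp_fps_uminus[of t]
        by (intro fdet_toep_kern[OF s(2,3) bt(4,1)]) (auto simp: mult.commute A.exp_fps_nth_0 B.exp_fps_nth_0)
      have "norm (fdet n (toep p m) - 1 - (\<Sum>i<n. K i i)) \<le> (fnorm n K)\<^sup>2 * exp (fnorm n K)"
        unfolding D by (rule fdet_second_order)
      also have "\<dots> \<le> (T\<^sup>2 * M)\<^sup>2 * exp M"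
        using nK[of n] T2M by (intro mult_mono power_mono) (auto simp: fnorm_nonneg)
      also have "\<dots> = T ^ 4 * (M\<^sup>2 * exp M)" by (simp add: power2_eq_square power4_eq_xxxx)
      also have "\<dots> \<le> T ^ 3 * (M\<^sup>2 * exp M)" using T43 by (intro mult_right_mono) auto
      finally have 1: "norm (fdet n (toep p m) - 1 - (\<Sum>i<n. K i i)) \<le> T ^ 3 * (M\<^sup>2 * exp M)" .
      have "norm ((\<Sum>i<n. K i i) - (\<Sum>i<n. hank p m i i)) \<le> (\<Sum>i<n. 2 * (T * C * C * h * q) * r ^ i)"
        unfolding sum_subtractf[symmetric]
      proof (intro sum_norm_le)
        fix i
        have "norm (K i i - hank p m i i) \<le> norm (kern p (p' - 1) m m' i i) + norm (kern p 1 m (m' - 1) i i)"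
          unfolding K_def kern_diff by (rule norm_triangle_ineq)
        also have "\<dots> \<le> T * C * C * h * q * r ^ (i + i) + C * (T * C) * h * q * r ^ (i + i)"
          unfolding q_def
          by (intro add_mono norm_kern_le[OF s(2) r(3,4) h bp'(2) bm'(1)]
              norm_kern_le[OF s(2) r(3,4) h geom_bdd_1[OF C s(2)] bm'(2)])
        also have "\<dots> = 2 * (T * C * C * h * q) * r ^ (i + i)" by simp
        also have "\<dots> \<le> 2 * (T * C * C * h * q) * r ^ i"
          using r T C h0 q by (intro mult_left_mono power_decreasing) auto
        finally show "norm (K i i - hank p m i i) \<le> 2 * (T * C * C * h * q) * r ^ i" .
      qed
      also have "\<dots> \<le> 2 * (T * C * C * h * q) * (1 / (1 - r))"
        unfolding sum_distrib_left[symmetric] using r T C h0 q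
        by (intro mult_left_mono sum_power_le_geometric) auto
      also have "\<dots> = T ^ 3 * (2 * (C * C * (C * C / (1 - s)) * q) / (1 - r))"
        by (simp add: h_def power3_eq_cube)
      finally have 2: "norm ((\<Sum>i<n. K i i) - (\<Sum>i<n. hank p m i i))
        \<le> T ^ 3 * (2 * (C * C * (C * C / (1 - s)) * q) / (1 - r))" .
      have "norm ((\<Sum>i<n. hank p m i i) - t\<^sup>2 * (\<Sum>i<n. hank Ac Bc i i)) \<le> (\<Sum>i<n. 2 * (T ^ 3 * (C * C / (1 - s))) * s ^ i)"
        unfolding sum_distrib_left[of "t\<^sup>2"] sum_subtractf[symmetric]
      proof (intro sum_norm_le)
        fix i
        note bAt = geom_bdd_const_mult[OF bA, of t, folded T_def] and bBt = geom_bdd_const_mult[OF bB, of t, folded T_def]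
        have "hank p m i i - t\<^sup>2 * hank Ac Bc i i
          = hank (p - 1) (m - 1) i i - hank (fps_const t * Ac) (fps_const t * Bc) i i"
          by (simp add: hank_diff_1 hank_const_mult[OF s(2,3) bA bB] power2_eq_square)
        also have "\<dots> = hank (p - 1 - fps_const t * Ac) (m - 1) i i + hank (fps_const t * Ac) (m - 1 - fps_const t * Bc) i i"
          by (simp add: hank_diff_left[OF s(2,3) bp(2) bAt bm(2)] hank_diff_right[OF s(2,3) bm(2) bBt bAt])
        also have "norm \<dots> \<le> T\<^sup>2 * C * (T * C) / (1 - s) * s ^ (i + i) + T * C * (T\<^sup>2 * C) / (1 - s) * s ^ (i + i)"
          by (rule norm_triangle_le[OF add_mono[OF norm_hank_le(1)[OF s(2,3) bp(3) bm(2)] norm_hank_le(1)[OF s(2,3) bAt bm(3)]]])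
        also have "\<dots> = 2 * (T ^ 3 * (C * C / (1 - s))) * s ^ (i + i)"
          by (simp add: power2_eq_square power3_eq_cube)
        also have "\<dots> \<le> 2 * (T ^ 3 * (C * C / (1 - s))) * s ^ i"
          using s T C by (intro mult_left_mono power_decreasing) auto
        finally show "norm (hank p m i i - t\<^sup>2 * hank Ac Bc i i) \<le> 2 * (T ^ 3 * (C * C / (1 - s))) * s ^ i" .
      qed
      also have "\<dots> \<le> 2 * (T ^ 3 * (C * C / (1 - s))) * (1 / (1 - s))"
        unfolding sum_distrib_left[symmetric] using s T C
        by (intro mult_left_mono sum_power_le_geometric) auto
      also have "\<dots> = T ^ 3 * (2 * (C * C / (1 - s)) / (1 - s))" by simp
      finally have 3: "norm ((\<Sum>i<n. hank p m i i) - t\<^sup>2 * (\<Sum>i<n. hank Ac Bc i i)) \<le> T ^ 3 * (2 * (C * C / (1 - s)) / (1 - s))" .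
      have "norm (fdet n (toep p m) - 1 - t\<^sup>2 * (\<Sum>i<n. hank Ac Bc i i))
        \<le> norm (fdet n (toep p m) - 1 - (\<Sum>i<n. K i i)) + norm ((\<Sum>i<n. K i i) - (\<Sum>i<n. hank p m i i))
          + norm ((\<Sum>i<n. hank p m i i) - t\<^sup>2 * (\<Sum>i<n. hank Ac Bc i i))"
      proof -
        have "norm (x + y + z) \<le> norm x + norm y + norm z" for x y z :: complex
          by (rule order.trans[OF norm_triangle_ineq add_right_mono[OF norm_triangle_ineq]])
        from this[of "fdet n (toep p m) - 1 - (\<Sum>i<n. K i i)" "(\<Sum>i<n. K i i) - (\<Sum>i<n. hank p m i i)"
          "(\<Sum>i<n. hank p m i i) - t\<^sup>2 * (\<Sum>i<n. hank Ac Bc i i)"]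
        show ?thesis by (simp add: algebra_simps)
      qed
      also have "\<dots> \<le> C' * T ^ 3"
        using 1 2 3 unfolding C'_def distrib_right mult.commute[of "T ^ 3"] by linarith
      finally show ?thesis .
    qed
    have "summable (\<lambda>i. hank Ac Bc i i)"
    proof (rule summable_comparison_test'[OF suminf_geometric_mult(2)[OF s(2,3)]])
      fix i
      have "norm (hank Ac Bc i i) \<le> C * C / (1 - s) * s ^ (i + i)"
        by (rule norm_hank_le[OF s(2,3) bA bB])
      also have "\<dots> \<le> C * C / (1 - s) * s ^ i"
        using s C by (intro mult_left_mono power_decreasing) auto
      finally show "norm (hank Ac Bc i i) \<le> C * C / (1 - s) * s ^ i" .
    qed
    then have "(\<lambda>n. \<Sum>i<n. hank Ac Bc i i) \<longlonglongrightarrow> \<kappa>"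
      unfolding \<kappa>_def by (rule summable_LIMSEQ)
    then have "(\<lambda>n. norm (fdet n (toep p m) - 1 - t\<^sup>2 * (\<Sum>i<n. hank Ac Bc i i))) \<longlonglongrightarrow> norm (S t t - 1 - t\<^sup>2 * \<kappa>)"
      unfolding p_def m_def
      by (intro tendsto_norm tendsto_diff tendsto_mult tendsto_const fdet_toep_tendsto)
    then show ?thesis
      unfolding T_def[symmetric] using bound by (intro LIMSEQ_le_const2) auto
  qed
  then show ?thesis by blast
qed

end

lemma (in disc_pair) S_nat_left: "k > 0 \<Longrightarrow> S (of_nat k * t) u = S t u ^ k"
proof -
  assume k: "k > 0"
  have dp: "disc_pair A B R" "disc_pair B A R"
    by (auto simp: disc_pair_def A.disc_function_axioms B.disc_function_axioms)
  show ?thesis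
    using disc_pair.S_nat_right[OF dp(2) k, of u t] by (simp add: disc_pair_S_swap[OF dp(1)])
qed

lemma (in disc_pair) S_1_1: "S 1 1 = exp \<kappa>"
proof -
  obtain C where C: "\<And>t. norm t \<le> 1 \<Longrightarrow> norm (S t t - 1 - t\<^sup>2 * \<kappa>) \<le> C * norm t ^ 3"
    using S_small by blast
  define w where "w n = S (1 / of_nat n) (1 / of_nat n)" for n :: nat
  have "(\<lambda>n. w n ^ (n ^ 2)) \<longlonglongrightarrow> exp \<kappa>"
  proof (rule power_square_tendsto_exp)
    fix n :: nat assume "n > 0"
    then show "norm (w n - 1 - \<kappa> / of_nat n ^ 2) \<le> C / real n ^ 3"
      using C[of "1 / of_nat n"] by (simp add: w_def norm_divide power_divide)
  qed
  moreover have "w n ^ (n ^ 2) = S 1 1" if "n > 0" for n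
  proof -
    have "S 1 1 = S (of_nat n * (1 / of_nat n)) (of_nat n * (1 / of_nat n))" using that by simp
    also have "\<dots> = w n ^ (n ^ 2)"
      using that by (simp only: S_nat_left S_nat_right w_def power_mult[symmetric] power2_eq_square)
    finally show ?thesis by simp
  qed
  then have "(\<lambda>n. w n ^ (n ^ 2)) \<longlonglongrightarrow> S 1 1"
    by (intro tendsto_eventually eventually_sequentiallyI[of 1]) auto
  ultimately show ?thesis using LIMSEQ_unique by blast
qed

section \<open>Toeplitz systems and bordered determinants\<close>

text \<open>The product of the coefficients of index n + 1 occurs in exactly the diagonal entries 0,
  ..., n, which produces the weight n + 1 in the exponent of E.\<close>

lemma suminf_hank_diagonal:
  assumes s: "0 \<le> s" "s < 1" and a: "geom_bdd C s a" and b: "geom_bdd D s b"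
  shows "(\<Sum>i. hank a b i i) = (\<Sum>n. of_nat (Suc n) * fps_nth a (Suc n) * fps_nth b (Suc n))"
proof -
  note nn = geom_bdd_nonneg[OF a] geom_bdd_nonneg[OF b]
  define g where "g n = fps_nth a (Suc n) * fps_nth b (Suc n)" for n
  define f where "f = (\<lambda>i n. if i \<le> n then g n else 0)"
  have g: "norm (g n) \<le> C * D * s ^ n * s ^ n" for n
  proof -
    have "norm (g n) \<le> (C * s ^ Suc n) * (D * s ^ Suc n)"
      unfolding g_def norm_mult using nn s by (intro mult_mono geom_bddD[OF a] geom_bddD[OF b]) auto
    also have "\<dots> \<le> (C * s ^ n) * (D * s ^ n)"
      using nn s by (intro mult_mono mult_left_mono power_decreasing) auto
    finally show ?thesis by (simp add: mult_ac)
  qed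
  have f: "norm (f i n) \<le> C * D * s ^ i * s ^ n" for i n
  proof (cases "i \<le> n")
    case True
    have "C * D * s ^ n * s ^ n \<le> C * D * s ^ i * s ^ n"
      using True nn s by (intro mult_right_mono mult_left_mono power_decreasing) auto
    then show ?thesis using True g[of n] by (simp add: f_def)
  qed (use nn s in \<open>auto simp: f_def\<close>)
  have inner: "(\<Sum>i. f i n) = of_nat (Suc n) * g n" for n
    by (subst suminf_finite[of "{..n}"]) (auto simp: f_def)
  have "hank a b i i = (\<Sum>n. f i n)" for i
  proof -
    have "summable (f i)"
      using f[of i] by (intro summable_comparison_test'[OF suminf_geometric_mult(2)[OF s]])
    then have "(\<Sum>n. f i n) = (\<Sum>n. f i (n + i)) + sum (f i) {..<i}"
      by (rule suminf_split_initial_segment)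
    then show ?thesis
      by (simp add: hank_def f_def g_def add.commute)
  qed
  then have "(\<Sum>i. hank a b i i) = (\<Sum>i. \<Sum>n. f i n)" by simp
  also have "\<dots> = (\<Sum>n. \<Sum>i. f i n)"
    by (rule suminf_swap_geometric[OF s f])
  also have "\<dots> = (\<Sum>n. of_nat (Suc n) * g n)"
    by (simp only: inner)
  finally show ?thesis by (simp add: g_def mult.assoc)
qed

text \<open>The solution of the semi-infinite Toeplitz system with right-hand side \<open>\<Psi>\<close>, obtained from the
  factorisation of the Toeplitz matrix into an upper times a lower triangular one.\<close>

definition back_subst :: "complex fps \<Rightarrow> complex fps \<Rightarrow> nat \<Rightarrow> complex" where
  "back_subst m' \<Psi> j = (\<Sum>l. upper m' j l * fps_nth \<Psi> l)"

definition toep_solution :: "complex fps \<Rightarrow> complex fps \<Rightarrow> complex fps \<Rightarrow> nat \<Rightarrow> complex" where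
  "toep_solution p' m' \<Psi> k = (\<Sum>i\<le>k. lower p' k i * back_subst m' \<Psi> i)"

lemma norm_back_subst_le:
  assumes s: "0 \<le> s" "s < 1" and m': "geom_bdd C s m'" and \<Psi>: "geom_bdd D s \<Psi>"
  shows "norm (back_subst m' \<Psi> j) \<le> C * D / (1 - s) * s ^ j"
proof -
  note nn = geom_bdd_nonneg[OF m'] geom_bdd_nonneg[OF \<Psi>]
  have b: "norm (upper m' j l * fps_nth \<Psi> l) \<le> C * D * s ^ l" for l
    unfolding norm_mult using mult_mono[OF norm_upper_le_const[OF m' s, of j l] geom_bddD[OF \<Psi>, of l]] nn s by (simp add: mult_ac)
  have "summable (\<lambda>l. upper m' j l * fps_nth \<Psi> l)"
    by (rule summable_comparison_test'[OF suminf_geometric_mult(2)[OF s]]) (rule b)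
  from suminf_split_initial_segment[OF this, of j]
  have "back_subst m' \<Psi> j = (\<Sum>l. upper m' j (l + j) * fps_nth \<Psi> (l + j))"
    by (simp add: back_subst_def upper_def)
  also have "norm \<dots> \<le> (\<Sum>l. C * D * s ^ j * s ^ l)"
  proof (rule norm_suminf_le[OF _ suminf_geometric_mult(2)[OF s]])
    fix l show "norm (upper m' j (l + j) * fps_nth \<Psi> (l + j)) \<le> C * D * s ^ j * s ^ l"
      using b[of "l + j"] by (simp add: power_add mult_ac)
  qed
  finally show ?thesis by (simp add: suminf_geometric_mult[OF s])
qed

lemma norm_toep_solution_le:
  assumes sr: "0 \<le> s" "s < r" "r < 1" and p': "geom_bdd C s p'" and m': "geom_bdd C s m'" and \<Psi>: "geom_bdd D s \<Psi>"
  shows "norm (toep_solution p' m' \<Psi> k) \<le> C * (C * D / (1 - s)) * (r / (r - s)) * r ^ k"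
proof -
  note nn = geom_bdd_nonneg[OF m'] geom_bdd_nonneg[OF \<Psi>]
  have "norm (toep_solution p' m' \<Psi> k) \<le> (\<Sum>i\<le>k. C * (C * D / (1 - s)) * s ^ k)"
    unfolding toep_solution_def
  proof (intro order.trans[OF norm_sum] sum_mono)
    fix i assume i: "i \<in> {..k}"
    have "norm (lower p' k i * back_subst m' \<Psi> i) \<le> (C * s ^ (k - i)) * (C * D / (1 - s) * s ^ i)"
      unfolding norm_mult lower_def using i sr nn norm_upper_le[OF p', of i k]
      by (intro mult_mono norm_back_subst_le[OF _ _ m' \<Psi>]) auto
    also have "\<dots> = C * (C * D / (1 - s)) * (s ^ (k - i) * s ^ i)" by simp
    also have "s ^ (k - i) * s ^ i = s ^ k" using i by (simp add: power_add[symmetric])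
    finally show "norm (lower p' k i * back_subst m' \<Psi> i) \<le> C * (C * D / (1 - s)) * s ^ k" .
  qed
  also have "\<dots> = C * (C * D / (1 - s)) * (real (Suc k) * s ^ k)" by simp
  also have "\<dots> \<le> C * (C * D / (1 - s)) * (r / (r - s) * r ^ k)"
    using sr nn by (intro mult_left_mono Suc_times_power_le) auto
  finally show ?thesis by (simp add: mult.assoc)
qed

text \<open>As infinite matrices \<open>toep p m\<close> is \<open>upper m\<close> times
  \<open>lower p\<close>, and the solution applies the inverses in the opposite order. The work lies
  in justifying the exchanges of infinite sums.\<close>

lemma suminf_toep_solution:
  assumes s: "0 < s" "s < 1"
    and p: "geom_bdd C s p" and p': "geom_bdd C s p'" and m: "geom_bdd C s m" and m': "geom_bdd C s m'" and \<Psi>: "geom_bdd C s \<Psi>"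
    and inv: "p * p' = 1" "m * m' = 1"
  shows "(\<Sum>k. toep p m j k * toep_solution p' m' \<Psi> k) = fps_nth \<Psi> j"
proof -
  define r where "r = (1 + s) / 2"
  have r: "0 < r" "s < r" "r < 1" using s by (auto simp: r_def)
  have s': "0 \<le> s" using s by simp
  note nn = geom_bdd_nonneg[OF m]
  define X where "X = C * (C * C / (1 - s)) * (r / (r - s))"
  have X: "norm (toep_solution p' m' \<Psi> k) \<le> X * r ^ k" for k
    unfolding X_def by (rule norm_toep_solution_le[OF s' r(2,3) p' m' \<Psi>])
  have X0: "0 \<le> X" using nn s r by (simp add: X_def)
  define y where "y = back_subst m' \<Psi>"
  define x where "x = toep_solution p' m' \<Psi>"
  define f where "f = (\<lambda>k i. upper m j i * upper p k i * x k)"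
  have f: "norm (f k i) \<le> C * C * X / s ^ j * r ^ k * r ^ i" for k i
  proof (cases "j \<le> i")
    case True
    have "norm (f k i) \<le> (C * s ^ (i - j)) * C * (X * r ^ k)"
      unfolding f_def norm_mult x_def using True nn X0 r s norm_upper_le[OF m, of j i] norm_upper_le_const[OF p, of k i]
      by (intro mult_mono X) auto
    also have "\<dots> = C * C * X / s ^ j * r ^ k * s ^ i"
      using True s by (simp add: power_diff)
    also have "\<dots> \<le> C * C * X / s ^ j * r ^ k * r ^ i"
      using s r nn X0 by (intro mult_left_mono power_mono) auto
    finally show ?thesis .
  qed (use nn X0 s r in \<open>auto simp: f_def upper_def\<close>)
  \<comment> \<open>Each cancellation happens inside a finite sum: k <= i for the lower factors
    here, j <= i <= l for the upper ones in \<open>inner2\<close>.\<close>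
  have inner1: "(\<Sum>k. f k i) = upper m j i * y i" for i
  proof -
    have "(\<Sum>k. f k i) = (\<Sum>k<Suc i. f k i)"
      by (rule suminf_finite) (auto simp: f_def upper_def)
    also have "\<dots> = upper m j i * (\<Sum>k<Suc i. lower p i k * x k)"
      by (simp add: f_def lower_def sum_distrib_left mult.assoc del: sum.lessThan_Suc)
    also have "(\<Sum>k<Suc i. lower p i k * x k) = (\<Sum>k<Suc i. \<Sum>l<Suc i. lower p i k * lower p' k l * y l)"
    proof (intro sum.cong refl)
      fix k assume k: "k \<in> {..<Suc i}"
      have "x k = (\<Sum>l<Suc i. lower p' k l * y l)"
        unfolding x_def y_def toep_solution_def using k
        by (intro sum.mono_neutral_left) (auto simp: lower_def upper_def)
      then show "lower p i k * x k = (\<Sum>l<Suc i. lower p i k * lower p' k l * y l)"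
        by (simp add: sum_distrib_left mult.assoc del: sum.lessThan_Suc)
    qed
    also have "\<dots> = (\<Sum>l<Suc i. fmul (Suc i) (lower p) (lower p') i l * y l)"
      unfolding fmul_def sum_distrib_right by (rule sum.swap)
    also have "\<dots> = (\<Sum>l<Suc i. fone i l * y l)"
    proof (intro sum.cong refl)
      fix l assume "l \<in> {..<Suc i}"
      then show "fmul (Suc i) (lower p) (lower p') i l * y l = fone i l * y l"
        using fmul_lower_lower[of "Suc i" p p'] by (simp add: feq_def inv lower_1)
    qed
    also have "\<dots> = y i" by (simp add: fone_def)
    finally show ?thesis .
  qed
  have inner2: "(\<Sum>i. upper m j i * upper m' i l * fps_nth \<Psi> l) = fone j l * fps_nth \<Psi> l" for l
  proof -
    have "(\<Sum>i. upper m j i * upper m' i l * fps_nth \<Psi> l) = (\<Sum>i<Suc (j + l). upper m j i * upper m' i l * fps_nth \<Psi> l)"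
      by (rule suminf_finite) (auto simp: upper_def)
    also have "\<dots> = fmul (Suc (j + l)) (upper m) (upper m') j l * fps_nth \<Psi> l"
      by (simp only: fmul_def sum_distrib_right)
    also have "\<dots> = fone j l * fps_nth \<Psi> l"
      using fmul_upper_upper[of "Suc (j + l)" m m'] by (simp add: feq_def inv upper_1)
    finally show ?thesis .
  qed
  have "(\<Sum>k. toep p m j k * x k) = (\<Sum>k. \<Sum>i. f k i)"
    unfolding toep_def f_def by (intro suminf_cong suminf_mult2[OF summable_toep[OF s' s(2) m p]])
  also have "\<dots> = (\<Sum>i. \<Sum>k. f k i)"
    using r by (intro suminf_swap_geometric[OF _ _ f]) auto
  also have "\<dots> = (\<Sum>i. upper m j i * y i)"
    by (simp only: inner1)
  also have "\<dots> = (\<Sum>i. \<Sum>l. upper m j i * upper m' i l * fps_nth \<Psi> l)"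
  proof (rule suminf_cong)
    fix i
    have "norm (upper m' i l * fps_nth \<Psi> l) \<le> C * C * s ^ l" for l
      unfolding norm_mult using mult_mono[OF norm_upper_le_const[OF m' s' s(2), of i l] geom_bddD[OF \<Psi>, of l]] nn s
      by (simp add: mult_ac)
    then have "summable (\<lambda>l. upper m' i l * fps_nth \<Psi> l)"
      by (intro summable_comparison_test'[OF suminf_geometric_mult(2)[OF s' s(2)]])
    then show "upper m j i * y i = (\<Sum>l. upper m j i * upper m' i l * fps_nth \<Psi> l)"
      unfolding y_def back_subst_def by (simp add: suminf_mult mult.assoc)
  qed
  also have "\<dots> = (\<Sum>l. \<Sum>i. upper m j i * upper m' i l * fps_nth \<Psi> l)"
  proof (rule suminf_swap_geometric[OF s' s(2)])
    fix i l
    show "norm (upper m j i * upper m' i l * fps_nth \<Psi> l) \<le> C * C * C / s ^ j * s ^ i * s ^ l"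
    proof (cases "j \<le> i")
      case True
      have "norm (upper m j i * upper m' i l * fps_nth \<Psi> l) \<le> (C * s ^ (i - j)) * C * (C * s ^ l)"
        unfolding norm_mult using True nn s norm_upper_le[OF m, of j i] norm_upper_le_const[OF m', of i l]
        by (intro mult_mono geom_bddD[OF \<Psi>]) auto
      also have "\<dots> = C * C * C / s ^ j * s ^ i * s ^ l"
        using True s by (simp add: power_diff)
      finally show ?thesis .
    qed (use nn s in \<open>auto simp: upper_def\<close>)
  qed
  also have "\<dots> = (\<Sum>l. fone j l * fps_nth \<Psi> l)"
    by (simp only: inner2)
  also have "\<dots> = (\<Sum>l\<in>{j}. fone j l * fps_nth \<Psi> l)"
    by (rule suminf_finite) (auto simp: fone_def)
  finally show ?thesis by (simp add: x_def fone_def)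
qed

section \<open>Toeplitz determinants with a prescribed first column\<close>

lemma fdet_first_col_add:
  assumes "n > 0"
  shows "fdet n (\<lambda>j k. if k = 0 then a j + b j else f j k) =
    fdet n (\<lambda>j k. if k = 0 then a j else f j k) + fdet n (\<lambda>j k. if k = 0 then b j else f j k)"
proof -
  obtain n' where n: "n = Suc n'" using assms by (cases n) auto
  have tr: "fdet n (\<lambda>j k. if k = 0 then c j else f j k) = fdet n (\<lambda>k j. if k = 0 then c j else f j k)" for c
    by (rule fdet_transpose)
  have "fdet n (\<lambda>k j. if k = 0 then a j + b j else f j k) =
    fdet n (\<lambda>k j. if k = 0 then a j else f j k) + fdet n (\<lambda>k j. if k = 0 then b j else f j k)"
    unfolding fdet_leibniz n prod.lessThan_Suc_shift
    by (simp add: distrib_left distrib_right sum.distrib)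
  then show ?thesis
    unfolding tr[of a] tr[of b] tr[of "\<lambda>j. a j + b j"] .
qed

text \<open>Right multiplication by the identity with first column \<open>x\<close>, a lower
  triangular matrix of determinant \<open>x 0\<close>.\<close>

lemma fdet_first_col_combination:
  assumes "n > 0"
  shows "fdet n (\<lambda>j k. if k = 0 then (\<Sum>l<n. f j l * x l) else f j k) = x 0 * fdet n f"
proof -
  define X where "X = (\<lambda>l k. if k = 0 then x l else fone l k)"
  have "fdet n (\<lambda>j k. if k = 0 then (\<Sum>l<n. f j l * x l) else f j k) = fdet n (fmul n f X)"
  proof (rule fdet_cong)
    fix j k assume "j < n" "k < n"
    then show "(if k = 0 then (\<Sum>l<n. f j l * x l) else f j k) = fmul n f X j k"
      using fmul_fone_right[of n f] by (auto simp: feq_def fmul_def X_def)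
  qed
  also have "\<dots> = fdet n f * fdet n X" by (rule fdet_fmul)
  also have "fdet n X = (\<Prod>i<n. X i i)"
    by (rule fdet_lower_triangular) (auto simp: X_def fone_def)
  also have "\<dots> = (\<Prod>i<n. if i = 0 then x 0 else 1)"
    by (intro prod.cong) (auto simp: X_def fone_def)
  also have "\<dots> = x 0" using assms by (simp add: prod.delta)
  finally show ?thesis by (simp add: mult.commute)
qed

text \<open>Cramer's rule would need a bound on the inverse matrix; instead, multiplication by the
  unimodular factors \<open>lower p'\<close> and \<open>upper m'\<close> yields identity plus kernel
  plus a rank-one matrix, with first column \<open>g\<close> of norm at most \<open>G\<close>. A
  product bound over columns then gives \<open>G\<close> times a bounded exponential.\<close>

lemma norm_fdet_first_col_le:
  assumes sr: "0 \<le> s" "s < r" "r < 1"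
    and p: "geom_bdd C s p" and p': "geom_bdd C s p'" and m: "geom_bdd C s m" and m': "geom_bdd C s m'"
    and inv: "p * p' = 1" "m * m' = 1" and one: "fps_nth p 0 = 1" "fps_nth m 0 = 1"
    and e: "\<And>j. j < n \<Longrightarrow> norm (e j) \<le> \<epsilon>" and n: "n > 0"
  defines "G \<equiv> real n ^ 2 * C * \<epsilon>"
    and "Kc \<equiv> C * C * (C * C / (1 - s)) * (r / (r - s))\<^sup>2 / (1 - r)\<^sup>2"
    and "Hh \<equiv> C * (C * C / (1 - s)) * (r / (r - s)) / (1 - r)"
  shows "norm (fdet n (\<lambda>j k. if k = 0 then e j else toep p m j k)) \<le> G * exp (Kc + (G + Hh) * (C / (1 - s)))"
proof -
  have s: "0 \<le> s" "s < 1" using sr by auto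
  note nn = geom_bdd_nonneg[OF p]
  have p'0: "fps_nth p' 0 = 1" and m'0: "fps_nth m' 0 = 1"
    using one inv[THEN fps_nth_0_right_inverse] by simp_all
  define T where "T = toep p m"
  define E where "E = (\<lambda>j k. if k = 0 then e j else T j k)"
  define K where "K = kern p p' m m'"
  define h where "h j = (\<Sum>a<n. lower p' j a * T a 0)" for j
  define g where "g j = (\<Sum>a<n. lower p' j a * e a)" for j
  define M where "M = fmul n (lower p') (fmul n E (upper m'))"
  have \<epsilon>: "0 \<le> \<epsilon>" using order.trans[OF norm_ge_zero e[OF n]] .
  have g: "(\<Sum>j<n. norm (g j)) \<le> G"
  proof -
    have "(\<Sum>j<n. norm (g j)) \<le> (\<Sum>j<n. \<Sum>a<n. C * \<epsilon>)"
      unfolding g_def lower_def using e nn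
      by (intro sum_mono order.trans[OF norm_sum])
        (auto simp: norm_mult intro!: mult_mono norm_upper_le_const[OF p' s])
    then show ?thesis by (simp add: G_def power2_eq_square)
  qed
  have h: "norm (h j) \<le> C * (C * C / (1 - s)) * (r / (r - s)) * r ^ j" for j
  proof -
    have "norm (h j) \<le> (\<Sum>a<n. if a \<le> j then C * (C * C / (1 - s)) * s ^ j else 0)"
      unfolding h_def
    proof (intro order.trans[OF norm_sum] sum_mono)
      fix a
      have T0: "norm (T a 0) \<le> C * C / (1 - s) * s ^ a"
        using norm_toep_le[OF s m p, of a 0] by (simp add: T_def)
      show "norm (lower p' j a * T a 0) \<le> (if a \<le> j then C * (C * C / (1 - s)) * s ^ j else 0)"
      proof (cases "a \<le> j")
        case True
        have "norm (lower p' j a * T a 0) \<le> (C * s ^ (j - a)) * (C * C / (1 - s) * s ^ a)"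
          unfolding norm_mult lower_def using True nn s norm_upper_le[OF p', of a j]
          by (intro mult_mono T0) auto
        also have "\<dots> = C * (C * C / (1 - s)) * (s ^ (j - a) * s ^ a)" by simp
        also have "s ^ (j - a) * s ^ a = s ^ j" using True by (simp add: power_add[symmetric])
        finally show ?thesis using True by simp
      qed (simp add: lower_def upper_def)
    qed
    also have "\<dots> \<le> (\<Sum>a\<le>j. C * (C * C / (1 - s)) * s ^ j)"
      unfolding sum.inter_filter[OF finite_lessThan, symmetric] using nn s
      by (intro sum_mono2) auto
    also have "\<dots> = C * (C * C / (1 - s)) * (real (Suc j) * s ^ j)" by simp
    also have "\<dots> \<le> C * (C * C / (1 - s)) * (r / (r - s) * r ^ j)"
      using nn s sr by (intro mult_left_mono Suc_times_power_le) auto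
    finally show ?thesis by (simp add: mult.assoc)
  qed
  have hs: "(\<Sum>j<n. norm (h j)) \<le> Hh"
  proof -
    have "(\<Sum>j<n. norm (h j)) \<le> C * (C * C / (1 - s)) * (r / (r - s)) * (\<Sum>j<n. r ^ j)"
      unfolding sum_distrib_left by (intro sum_mono h)
    also have "\<dots> \<le> C * (C * C / (1 - s)) * (r / (r - s)) * (1 / (1 - r))"
      using nn s sr by (intro mult_left_mono sum_power_le_geometric) auto
    finally show ?thesis by (simp add: Hh_def)
  qed
  have GH: "0 \<le> G" "0 \<le> Hh"
    using order.trans[OF sum_nonneg g] order.trans[OF sum_nonneg hs] by simp_all
  have det: "fdet n E = fdet n M"
    by (simp add: M_def fdet_fmul fdet_lower fdet_upper p'0 m'0)
  \<comment> \<open>The first column of \<open>upper m'\<close> is the first unit vector, so column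
    0 only sees \<open>e\<close>.\<close>
  have M0: "M j 0 = g j" for j
  proof -
    have "fmul n E (upper m') a 0 = (\<Sum>b\<in>{0}. E a b * upper m' b 0)" for a
      unfolding fmul_def using n by (intro sum.mono_neutral_right) (auto simp: upper_def)
    then show ?thesis by (simp add: M_def fmul_def[of n "lower p'"] g_def E_def upper_def m'0)
  qed
  have Mk: "M j k = fone j k + K j k + (g j - h j) * fps_nth m' k" if "j < n" "k < n" for j k
  proof -
    have E: "E = (\<lambda>j k. T j k + (if k = 0 then e j - T j 0 else 0))"
      by (auto simp: E_def fun_eq_iff)
    have "fmul n (\<lambda>j k. if k = 0 then e j - T j 0 else 0) (upper m') a k = (\<Sum>b\<in>{0}. (e a - T a 0) * upper m' b k)" for a
      unfolding fmul_def using n by (intro sum.mono_neutral_cong_right) auto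
    then have "fmul n (lower p') (fmul n (\<lambda>j k. if k = 0 then e j - T j 0 else 0) (upper m')) j k
       = (g j - h j) * fps_nth m' k"
      by (simp add: fmul_def[of n "lower p'"] g_def h_def upper_def right_diff_distrib left_diff_distrib
          sum_subtractf sum_distrib_right mult.assoc)
    moreover have "fmul n (lower p') (fmul n T (upper m')) j k = fone j k + K j k"
      using fmul_toep_kern[OF s m p, of p' m' n] that inv by (simp add: feq_def T_def K_def mult.commute)
    ultimately show ?thesis
      unfolding M_def by (subst E) (simp only: fmul_add_left fmul_add_right)
  qed
  \<comment> \<open>The small vector is a column, so the row bound is applied to the
    transpose.\<close>
  have "norm (fdet n (\<lambda>j k. M k j)) \<le> (\<Prod>k<n. if k = 0 then G else 1) *
      exp (\<Sum>k<n. (\<Sum>j<n. norm (K j k)) + (G + Hh) * norm (fps_nth m' k))"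
  proof (rule norm_fdet_le_exp)
    fix k assume k: "k < n"
    define ck where "ck = (\<Sum>j<n. norm (K j k)) + (G + Hh) * norm (fps_nth m' k)"
    have ck: "0 \<le> ck" using GH by (auto simp: ck_def intro!: add_nonneg_nonneg sum_nonneg)
    show "(\<Sum>j<n. norm (M j k)) \<le> (if k = 0 then G else 1) * exp ck"
    proof (cases "k = 0")
      case True
      have "G * 1 \<le> G * exp ck" using ck GH by (intro mult_left_mono) auto
      then show ?thesis using True g by (simp add: M0)
    next
      case False
      have "(\<Sum>j<n. norm (M j k)) \<le> (\<Sum>j<n. norm (fone j k) + norm (K j k) + (norm (g j) + norm (h j)) * norm (fps_nth m' k))"
      proof (rule sum_mono)
        fix j assume "j \<in> {..<n}"
        then show "norm (M j k) \<le> norm (fone j k) + norm (K j k) + (norm (g j) + norm (h j)) * norm (fps_nth m' k)"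
          using k norm_triangle_ineq4[of "g j" "h j"]
          by (simp add: Mk norm_mult, intro order.trans[OF norm_triangle_ineq] add_mono norm_triangle_ineq)
            (simp add: norm_mult mult_right_mono)
      qed
      also have "\<dots> = 1 + (\<Sum>j<n. norm (K j k)) + ((\<Sum>j<n. norm (g j)) + (\<Sum>j<n. norm (h j))) * norm (fps_nth m' k)"
        using k by (simp add: sum.distrib sum_distrib_right distrib_right fone_def if_distrib[of norm] cong: if_cong)
      also have "\<dots> \<le> 1 + ck"
        unfolding ck_def using g hs by (simp add: mult_right_mono add_mono)
      also have "\<dots> \<le> exp ck" by (rule exp_ge_add_one_self)
      finally show ?thesis using False by simp
    qed
  qed
  also have "(\<Prod>k<n. if k = 0 then G else 1) = G" using n by (simp add: prod.delta)
  also have "fdet n (\<lambda>j k. M k j) = fdet n M" by (rule fdet_transpose)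
  finally have 1: "norm (fdet n M) \<le> G * exp (\<Sum>k<n. (\<Sum>j<n. norm (K j k)) + (G + Hh) * norm (fps_nth m' k))" .
  have Kn: "fnorm n K \<le> Kc"
    using nn s sr unfolding K_def Kc_def
    by (intro fnorm_le_geometric norm_kern_le[OF s(1) sr(2,3) norm_hank_le(1)[OF s p m] p' m']) auto
  have "(\<Sum>k<n. norm (fps_nth m' k)) \<le> (\<Sum>k<n. C * s ^ k)"
    by (intro sum_mono geom_bddD[OF m'])
  also have "\<dots> \<le> C / (1 - s)"
    using mult_left_mono[OF sum_power_le_geometric[OF s, of n] nn] by (simp add: sum_distrib_left)
  finally have mk: "(\<Sum>k<n. norm (fps_nth m' k)) \<le> C / (1 - s)" .
  have "(\<Sum>k<n. (\<Sum>j<n. norm (K j k)) + (G + Hh) * norm (fps_nth m' k))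
      = fnorm n K + (G + Hh) * (\<Sum>k<n. norm (fps_nth m' k))"
    unfolding fnorm_def sum.distrib sum_distrib_left by (subst (1) sum.swap) simp
  also have "\<dots> \<le> Kc + (G + Hh) * (C / (1 - s))"
    using Kn mk GH by (intro add_mono mult_left_mono) auto
  finally have "G * exp (\<Sum>k<n. (\<Sum>j<n. norm (K j k)) + (G + Hh) * norm (fps_nth m' k))
     \<le> G * exp (Kc + (G + Hh) * (C / (1 - s)))"
    using GH by (intro mult_left_mono) auto
  with 1 show ?thesis
    unfolding det[symmetric] by (simp only: E_def T_def)
qed

text \<open>Cutting the infinite system at n splits the first column into a combination of the
  columns of the section and a remainder of size O(\<open>r ^ n\<close>). By back substitution the
  coefficient of the first column is the series in the statement, because \<open>p'\<close> has
  constant coefficient 1.\<close>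

lemma fdet_first_col_asymp:
  assumes s: "0 < s" "s < 1"
    and p: "geom_bdd C s p" and p': "geom_bdd C s p'" and m: "geom_bdd C s m" and m': "geom_bdd C s m'" and \<Psi>: "geom_bdd C s \<Psi>"
    and inv: "p * p' = 1" "m * m' = 1" and one: "fps_nth p 0 = 1" "fps_nth m 0 = 1"
  shows "\<exists>q D. 0 < q \<and> q < 1 \<and> (\<forall>n>0. norm (fdet n (\<lambda>j k. if k = 0 then fps_nth \<Psi> j else toep p m j k)
     - (\<Sum>l. fps_nth m' l * fps_nth \<Psi> l) * fdet n (toep p m)) \<le> D * q ^ n)"
proof -
  have s': "0 \<le> s" using s by simp
  note nn = geom_bdd_nonneg[OF p]
  \<comment> \<open>A chain s < r < r1 < q < 1 of midpoints: \<open>r\<close> is the rate of the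
    solution, and the next two steps absorb one factor n each of
    \<open>n\<^sup>2 * r ^ n\<close>.\<close>
  define r where "r = (1 + s) / 2"
  define r1 where "r1 = (1 + r) / 2"
  define q where "q = (1 + r1) / 2"
  have r: "0 < r" "0 \<le> r" "s < r" "r < 1" using s by (auto simp: r_def)
  have r1: "0 < r1" "0 \<le> r1" "r < r1" "r1 < 1" using r by (auto simp: r1_def)
  have q: "0 < q" "r1 < q" "q < 1" using r1 by (auto simp: q_def)
  define X where "X = C * (C * C / (1 - s)) * (r / (r - s))"
  define x where "x = toep_solution p' m' \<Psi>"
  have x: "norm (x k) \<le> X * r ^ k" for k
    unfolding x_def X_def by (rule norm_toep_solution_le[OF s' r(3,4) p' m' \<Psi>])
  have X0: "0 \<le> X" using nn s r by (simp add: X_def)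
  have p'0: "fps_nth p' 0 = 1"
    using one inv(1)[THEN fps_nth_0_right_inverse] by simp
  have x0: "x 0 = (\<Sum>l. fps_nth m' l * fps_nth \<Psi> l)"
    by (simp add: x_def toep_solution_def back_subst_def lower_def upper_def p'0)
  define T where "T = toep p m"
  have T: "norm (T j k) \<le> C * C / (1 - s)" for j k
  proof -
    have "C * C / (1 - s) * s ^ (max j k - j + (max j k - k)) \<le> C * C / (1 - s) * 1"
      using nn s by (intro mult_left_mono power_le_one) auto
    then show ?thesis using norm_toep_le[OF s' s(2) m p, of j k] by (simp add: T_def)
  qed
  have Tx: "norm (T j k * x k) \<le> C * C / (1 - s) * X * r ^ k" for j k
    unfolding norm_mult using mult_mono[OF T x] nn s by (simp add: mult.assoc)
  have sm: "summable (\<lambda>k. T j k * x k)" for j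
    by (rule summable_comparison_test'[OF suminf_geometric_mult(2)[OF r(2,4)]]) (rule Tx)
  define c where "c = C * C / (1 - s) * X / (1 - r)"
  have c0: "0 \<le> c" using nn s r X0 by (simp add: c_def)
  define e where "e n j = (\<Sum>k. T j (k + n) * x (k + n))" for n j
  have e: "norm (e n j) \<le> c * r ^ n" for n j
  proof -
    have "norm (e n j) \<le> (\<Sum>k. C * C / (1 - s) * X * r ^ n * r ^ k)"
      unfolding e_def
    proof (rule norm_suminf_le[OF _ suminf_geometric_mult(2)[OF r(2,4)]])
      fix k show "norm (T j (k + n) * x (k + n)) \<le> C * C / (1 - s) * X * r ^ n * r ^ k"
        using Tx[of j "k + n"] by (simp add: power_add mult_ac)
    qed
    also have "\<dots> = c * r ^ n" unfolding suminf_geometric_mult[OF r(2,4)] by (simp add: c_def)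
    finally show ?thesis .
  qed
  have sol: "fps_nth \<Psi> j = (\<Sum>k<n. T j k * x k) + e n j" for n j
    using suminf_split_initial_segment[OF sm, of j n] suminf_toep_solution[OF s p p' m m' \<Psi> inv, of j]
    by (simp add: e_def T_def x_def)
  define c2 where "c2 = C * c * (r1 / (r1 - r)) * (q / (q - r1))"
  define Kc where "Kc = C * C * (C * C / (1 - s)) * (r / (r - s))\<^sup>2 / (1 - r)\<^sup>2"
  define Hh where "Hh = C * (C * C / (1 - s)) * (r / (r - s)) / (1 - r)"
  define D where "D = c2 * exp (Kc + (c2 + Hh) * (C / (1 - s)))"
  have c2: "0 \<le> c2" using c0 nn r r1 q by (simp add: c2_def)
  have "norm (fdet n (\<lambda>j k. if k = 0 then fps_nth \<Psi> j else T j k) - x 0 * fdet n T) \<le> D * q ^ n" if n: "n > 0" for n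
  proof -
    have "fdet n (\<lambda>j k. if k = 0 then fps_nth \<Psi> j else T j k)
        = fdet n (\<lambda>j k. if k = 0 then (\<Sum>k<n. T j k * x k) + e n j else T j k)"
      by (simp only: sol[of _ n])
    also have "\<dots> = x 0 * fdet n T + fdet n (\<lambda>j k. if k = 0 then e n j else T j k)"
      by (simp only: fdet_first_col_add[OF n] fdet_first_col_combination[OF n])
    finally have eq: "fdet n (\<lambda>j k. if k = 0 then fps_nth \<Psi> j else T j k) - x 0 * fdet n T
        = fdet n (\<lambda>j k. if k = 0 then e n j else T j k)" by simp
    define G where "G = real n ^ 2 * C * (c * r ^ n)"
    have "real n ^ 2 * r ^ n \<le> real (Suc n) * (real (Suc n) * r ^ n)"
      using r by (simp add: power2_eq_square mult_mono algebra_simps)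
    also have "\<dots> \<le> real (Suc n) * (r1 / (r1 - r) * r1 ^ n)"
      using r r1 by (intro mult_left_mono Suc_times_power_le) auto
    also have "\<dots> = r1 / (r1 - r) * (real (Suc n) * r1 ^ n)" by simp
    also have "\<dots> \<le> r1 / (r1 - r) * (q / (q - r1) * q ^ n)"
      using r r1 q by (intro mult_left_mono Suc_times_power_le) auto
    finally have "C * c * (real n ^ 2 * r ^ n) \<le> C * c * (r1 / (r1 - r) * (q / (q - r1) * q ^ n))"
      using nn c0 by (intro mult_left_mono) auto
    then have G: "G \<le> c2 * q ^ n" by (simp add: G_def c2_def mult_ac)
    have G': "G \<le> c2" using G c2 q order.trans[OF G mult_left_mono[of "q ^ n" 1 c2]] by (simp add: power_le_one)
    have "norm (fdet n (\<lambda>j k. if k = 0 then e n j else T j k)) \<le> G * exp (Kc + (G + Hh) * (C / (1 - s)))"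
      unfolding T_def G_def Kc_def Hh_def
      by (rule norm_fdet_first_col_le[OF s' r(3,4) p p' m m' inv one e n])
    also have "\<dots> \<le> (c2 * q ^ n) * exp (Kc + (c2 + Hh) * (C / (1 - s)))"
    proof (rule mult_mono[OF G])
      have "(G + Hh) * (C / (1 - s)) \<le> (c2 + Hh) * (C / (1 - s))"
        using G' nn s by (intro mult_right_mono) auto
      then show "exp (Kc + (G + Hh) * (C / (1 - s))) \<le> exp (Kc + (c2 + Hh) * (C / (1 - s)))"
        by simp
    qed (use c2 q in auto)
    also have "\<dots> = D * q ^ n" by (simp add: D_def)
    finally show ?thesis by (simp only: eq)
  qed
  then show ?thesis
    using q unfolding T_def x0 by blast
qed

section \<open>Fourier coefficients and Laurent series\<close>

abbreviation circle_integral :: "real \<Rightarrow> (complex \<Rightarrow> complex) \<Rightarrow> complex" where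
  "circle_integral \<rho> f \<equiv> contour_integral (circlepath 0 \<rho>) f"

lemma contour_integrable_circle:
  "0 < \<rho> \<Longrightarrow> continuous_on (sphere 0 \<rho>) f \<Longrightarrow> f contour_integrable_on circlepath 0 \<rho>"
  by (rule contour_integrable_continuous_circlepath) simp

lemma contour_integral_circle_suminf:
  fixes h :: "nat \<Rightarrow> complex \<Rightarrow> complex"
  assumes "0 < \<rho>" and "\<And>n. continuous_on (sphere 0 \<rho>) (h n)"
    and "\<And>n w. norm w = \<rho> \<Longrightarrow> norm (h n w) \<le> M n" and "summable M"
  shows "(\<lambda>n. circle_integral \<rho> (h n)) sums circle_integral \<rho> (\<lambda>w. \<Sum>n. h n w)"
proof -
  have int: "h n contour_integrable_on circlepath 0 \<rho>" for n
    by (rule contour_integrable_circle[OF assms(1,2)])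
  have "((\<lambda>n. circle_integral \<rho> (\<lambda>w. \<Sum>i<n. h i w)) \<longlongrightarrow>
      circle_integral \<rho> (\<lambda>w. \<Sum>n. h n w)) sequentially"
  proof (rule contour_integral_uniform_limit_circlepath(2))
    show "\<forall>\<^sub>F n in sequentially. (\<lambda>w. \<Sum>i<n. h i w) contour_integrable_on circlepath 0 \<rho>"
      by (intro always_eventually allI contour_integrable_sum int) auto
    show "uniform_limit (sphere 0 \<rho>) (\<lambda>n w. \<Sum>i<n. h i w) (\<lambda>w. \<Sum>n. h n w) sequentially"
      using assms by (intro Weierstrass_m_test) auto
  qed (use assms in auto)
  moreover have "circle_integral \<rho> (\<lambda>w. \<Sum>i<n. h i w) = (\<Sum>i<n. circle_integral \<rho> (h i))" for n
    by (intro contour_integral_sum int) auto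
  ultimately show ?thesis by (simp add: sums_def)
qed

lemma fourier_coeff_cong:
  "(\<And>z. norm z = 1 \<Longrightarrow> f z = g z) \<Longrightarrow> fourier_coeff f n = fourier_coeff g n"
  unfolding fourier_coeff_def by (intro contour_integral_eq) auto

lemma continuous_on_fourier_integrand:
  "continuous_on (sphere 0 1) f \<Longrightarrow> continuous_on (sphere 0 1) (\<lambda>z. z powi (-n) * f z / (2 * of_real pi * \<i> * z))"
  by (intro continuous_intros) auto

lemma fourier_coeff_cmult:
  assumes "continuous_on (sphere 0 1) f"
  shows "fourier_coeff (\<lambda>z. c * f z) n = c * fourier_coeff f n"
proof -
  have "fourier_coeff (\<lambda>z. c * f z) n =
      circle_integral 1 (\<lambda>z. c * (z powi (-n) * f z / (2 * of_real pi * \<i> * z)))"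
    unfolding fourier_coeff_def by (simp add: mult_ac)
  then show ?thesis
    unfolding fourier_coeff_def
    by (subst (asm) contour_integral_lmul[OF contour_integrable_circle[OF _ continuous_on_fourier_integrand[OF assms]]]) auto
qed

lemma fourier_coeff_add:
  assumes "continuous_on (sphere 0 1) f" "continuous_on (sphere 0 1) g"
  shows "fourier_coeff (\<lambda>z. f z + g z) n = fourier_coeff f n + fourier_coeff g n"
proof -
  have "fourier_coeff (\<lambda>z. f z + g z) n = circle_integral 1
      (\<lambda>z. z powi (-n) * f z / (2 * of_real pi * \<i> * z) + z powi (-n) * g z / (2 * of_real pi * \<i> * z))"
    unfolding fourier_coeff_def by (simp add: distrib_left add_divide_distrib)
  then show ?thesis
    unfolding fourier_coeff_def
    by (subst (asm) contour_integral_add) (auto intro!: contour_integrable_circle continuous_on_fourier_integrand assms)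
qed

lemma fourier_coeff_sum:
  assumes "finite I" "\<And>i. i \<in> I \<Longrightarrow> continuous_on (sphere 0 1) (f i)"
  shows "fourier_coeff (\<lambda>z. \<Sum>i\<in>I. f i z) n = (\<Sum>i\<in>I. fourier_coeff (f i) n)"
  using assms
proof (induction I rule: finite_induct)
  case empty
  show ?case by (simp add: fourier_coeff_def)
next
  case (insert x F)
  then show ?case
    by (simp add: fourier_coeff_add continuous_on_sum)
qed

lemma fourier_coeff_power_int: "fourier_coeff (\<lambda>z. z powi k * f z) n = fourier_coeff f (n - k)"
  unfolding fourier_coeff_def
proof (rule contour_integral_eq)
  fix z :: complex assume "z \<in> path_image (circlepath 0 1)"
  then have "z \<noteq> 0" by auto
  then have "z powi (- n) * z powi k = z powi (- (n - k))"
    by (simp add: power_int_add[symmetric] add.commute)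
  then show "z powi (- n) * (z powi k * f z) / (2 * of_real pi * \<i> * z) = z powi (- (n - k)) * f z / (2 * of_real pi * \<i> * z)"
    by (simp add: mult.assoc[symmetric])
qed

lemma fourier_coeff_1: "fourier_coeff (\<lambda>z. 1) n = (if n = 0 then 1 else 0)"
proof (cases "n = 0")
  case True
  have "fourier_coeff (\<lambda>z. 1) n = circle_integral 1 (\<lambda>z. 1 / (2 * of_real pi * \<i>) * (1 / (z - 0)))"
    using True by (simp add: fourier_coeff_def)
  also have "\<dots> = 1 / (2 * of_real pi * \<i>) * circle_integral 1 (\<lambda>z. 1 / (z - 0))"
    by (intro contour_integral_lmul contour_integrable_circle continuous_intros) auto
  also have "\<dots> = 1" by (subst contour_integral_circlepath) auto
  finally show ?thesis using True by simp
next
  case False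
  have "((\<lambda>z. z powi (-n) * 1 / (2 * of_real pi * \<i> * z)) has_contour_integral 0) (circlepath 0 1)"
  proof (rule Cauchy_theorem_primitive[where S = "- {0}"])
    fix z :: complex assume z: "z \<in> - {0}"
    have "((\<lambda>z. z powi (-n) / (- of_int n * (2 * of_real pi * \<i>))) has_field_derivative
        (of_int (- n) * z powi (- n - 1) * 1) / (- of_int n * (2 * of_real pi * \<i>))) (at z within - {0})"
      using z by (intro DERIV_power_int DERIV_cdivide DERIV_ident) auto
    also have "(of_int (- n) * z powi (- n - 1) * 1) / (- of_int n * (2 * of_real pi * \<i>)) = z powi (-n) * 1 / (2 * of_real pi * \<i> * z)"
      using False z by (simp add: power_int_diff)
    finally show "((\<lambda>z. z powi (-n) / (- of_int n * (2 * of_real pi * \<i>))) has_field_derivative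
        z powi (-n) * 1 / (2 * of_real pi * \<i> * z)) (at z within - {0})" .
  qed auto
  then show ?thesis using False by (simp add: fourier_coeff_def contour_integral_unique)
qed

text \<open>Absolute summability gives uniform convergence on the circle and hence termwise
  integration. Free exponents \<open>e\<close> let one statement serve power series, series in 1/z
  and both expansions of the Cauchy kernel.\<close>

lemma fourier_coeff_mult_series:
  assumes f: "continuous_on (sphere 0 1) f" and a: "summable (\<lambda>l. norm (a l))"
    and g: "\<And>z. norm z = 1 \<Longrightarrow> (\<lambda>l. a l * z powi (e l)) sums g z"
  shows "(\<lambda>l. a l * fourier_coeff f (n - e l)) sums fourier_coeff (\<lambda>z. f z * g z) n"
proof -
  define h where "h = (\<lambda>l z. a l * (z powi (- (n - e l)) * f z / (2 * of_real pi * \<i> * z)))"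
  obtain M where M: "\<And>z. norm z = 1 \<Longrightarrow> norm (f z) \<le> M"
    using continuous_on_sphere_bounded[OF f] by blast
  have cont: "continuous_on (sphere 0 1) (\<lambda>z. z powi (- k) * f z / (2 * of_real pi * \<i> * z))" for k
    by (rule continuous_on_fourier_integrand[OF f])
  have "(\<lambda>l. circle_integral 1 (h l)) sums circle_integral 1 (\<lambda>z. \<Sum>l. h l z)"
  proof (rule contour_integral_circle_suminf)
    show "summable (\<lambda>l. norm (a l) * (M / (2 * pi)))"
      using a by (rule summable_mult2)
    show "norm (h l w) \<le> norm (a l) * (M / (2 * pi))" if "norm w = 1" for l w
      using M[OF that] that
      by (auto simp: h_def norm_mult norm_divide norm_power_int intro!: mult_left_mono divide_right_mono)
    show "continuous_on (sphere 0 1) (h l)" for l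
      unfolding h_def by (intro continuous_on_mult continuous_on_const cont)
  qed auto
  also have "(\<lambda>l. circle_integral 1 (h l)) = (\<lambda>l. a l * fourier_coeff f (n - e l))"
    unfolding h_def fourier_coeff_def
    by (intro ext contour_integral_lmul contour_integrable_circle cont) auto
  also have "circle_integral 1 (\<lambda>z. \<Sum>l. h l z) = fourier_coeff (\<lambda>z. f z * g z) n"
    unfolding fourier_coeff_def
  proof (rule contour_integral_eq)
    fix z :: complex assume "z \<in> path_image (circlepath 0 1)"
    then have z: "norm z = 1" "z \<noteq> 0" by auto
    have "h l z = a l * z powi e l * (z powi (- n) * f z / (2 * of_real pi * \<i> * z))" for l
    proof -
      have "z powi (- (n - e l)) = z powi e l * z powi (- n)"
        using z by (simp add: power_int_add[symmetric])
      then show ?thesis by (simp add: h_def)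
    qed
    moreover have "(\<lambda>l. a l * z powi e l * (z powi (- n) * f z / (2 * of_real pi * \<i> * z)))
        sums (g z * (z powi (- n) * f z / (2 * of_real pi * \<i> * z)))"
      by (rule sums_mult2[OF g[OF z(1)]])
    ultimately show "(\<Sum>l. h l z) = z powi (- n) * (f z * g z) / (2 * of_real pi * \<i> * z)"
      by (simp add: sums_iff mult_ac)
  qed
  finally show ?thesis .
qed

lemma fourier_coeff_power_series:
  assumes "summable (\<lambda>l. norm (a l))" and "\<And>z. norm z = 1 \<Longrightarrow> (\<lambda>l. a l * z ^ l) sums g z"
  shows "fourier_coeff g n = (if 0 \<le> n then a (nat n) else 0)"
proof -
  have "(\<lambda>l. a l * fourier_coeff (\<lambda>z. 1) (n - int l)) sums fourier_coeff (\<lambda>z. 1 * g z) n"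
    using assms by (intro fourier_coeff_mult_series) auto
  moreover have "(\<lambda>l. a l * fourier_coeff (\<lambda>z. 1) (n - int l)) = (\<lambda>l. if l \<in> (if 0 \<le> n then {nat n} else {}) then a l else 0)"
    by (auto simp: fun_eq_iff fourier_coeff_1)
  moreover have "(\<lambda>l. if l \<in> (if 0 \<le> n then {nat n} else {}) then a l else 0) sums (\<Sum>l\<in>(if 0 \<le> n then {nat n} else {}). a l)"
    by (rule sums_If_finite_set) auto
  ultimately show ?thesis
    using sums_unique2 by fastforce
qed

lemma fourier_coeff_inverse_power_series:
  assumes "summable (\<lambda>l. norm (a l))" and "\<And>z. norm z = 1 \<Longrightarrow> (\<lambda>l. a l * inverse z ^ l) sums g z"
  shows "fourier_coeff g n = (if n \<le> 0 then a (nat (- n)) else 0)"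
proof -
  have "(\<lambda>l. a l * fourier_coeff (\<lambda>z. 1) (n - - int l)) sums fourier_coeff (\<lambda>z. 1 * g z) n"
    using assms by (intro fourier_coeff_mult_series) (auto simp: power_int_minus power_inverse)
  moreover have "(\<lambda>l. a l * fourier_coeff (\<lambda>z. 1) (n - - int l)) = (\<lambda>l. if l \<in> (if n \<le> 0 then {nat (- n)} else {}) then a l else 0)"
    by (auto simp: fun_eq_iff fourier_coeff_1)
  moreover have "(\<lambda>l. if l \<in> (if n \<le> 0 then {nat (- n)} else {}) then a l else 0) sums (\<Sum>l\<in>(if n \<le> 0 then {nat (- n)} else {}). a l)"
    by (rule sums_If_finite_set) auto
  ultimately show ?thesis
    using sums_unique2 by fastforce
qed

lemma geom_bdd_summable_norm:
  assumes "geom_bdd C s f" "0 \<le> s" "s < 1"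
  shows "summable (\<lambda>n. norm (fps_nth f n))"
  by (rule summable_comparison_test'[OF suminf_geometric_mult(2)[OF assms(2,3)]])
    (use assms(1) in \<open>auto simp: geom_bdd_def\<close>)

section \<open>Laurent expansion on an annulus\<close>

lemma contour_integral_circles_annulus:
  assumes f: "f holomorphic_on {z. 1 / R < norm z \<and> norm z < R}" and \<rho>: "1 < \<rho>" "\<rho> < R"
  shows "circle_integral \<rho> f = circle_integral (1 / \<rho>) f"
proof (rule Cauchy_theorem_homotopic_loops[OF _ _ f])
  let ?S = "{z::complex. 1 / R < norm z \<and> norm z < R}"
  have op: "open {z::complex. 1 / R < norm z \<and> norm z < R}"
    unfolding Collect_conj_eq
    by (intro open_Int open_Collect_less continuous_intros)
  then show "open ?S" .
  show "homotopic_loops ?S (circlepath 0 \<rho>) (circlepath 0 (1 / \<rho>))"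
  proof (rule homotopic_loops_linear)
    fix t :: real
    show "closed_segment (circlepath 0 \<rho> t) (circlepath 0 (1 / \<rho>) t) \<subseteq> ?S"
    proof
      fix z assume "z \<in> closed_segment (circlepath 0 \<rho> t) (circlepath 0 (1 / \<rho>) t)"
      then obtain u where u: "0 \<le> u" "u \<le> 1"
        "z = (1 - u) *\<^sub>R circlepath 0 \<rho> t + u *\<^sub>R circlepath 0 (1 / \<rho>) t"
        by (auto simp: in_segment)
      define x where "x = (1 - u) * \<rho> + u * (1 / \<rho>)"
      have "z = of_real x * exp (2 * of_real pi * \<i> * of_real t)"
        unfolding u(3) x_def circlepath by (simp add: scaleR_conv_of_real algebra_simps)
      moreover have "norm (exp (2 * of_real pi * \<i> * of_real t)) = 1"
        using norm_exp_i_times[of "2 * pi * t"] by (simp add: mult_ac)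
      ultimately have nz: "norm z = \<bar>x\<bar>" by (simp add: norm_mult)
      have r1: "1 / \<rho> < \<rho>" "1 / R < 1 / \<rho>" using \<rho> by (auto simp: divide_simps less_1_mult order.strict_trans[of 1 \<rho>])
      have "x \<le> (1 - u) * \<rho> + u * \<rho>" unfolding x_def using u r1 by (intro add_left_mono mult_left_mono) auto
      moreover have "(1 - u) * (1 / \<rho>) + u * (1 / \<rho>) \<le> x" unfolding x_def using u r1 by (intro add_right_mono mult_left_mono) auto
      moreover have "(1 - u) * \<rho> + u * \<rho> = \<rho>" "(1 - u) * (1 / \<rho>) + u * (1 / \<rho>) = 1 / \<rho>"
        by (simp_all only: distrib_right[symmetric]) simp_all
      ultimately have "1 / \<rho> \<le> x" "x \<le> \<rho>" by simp_all
      moreover have "0 < 1 / \<rho>" using \<rho> by simp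
      ultimately have "1 / R < \<bar>x\<bar>" "\<bar>x\<bar> < R" using r1 \<rho> by linarith+
      then show "z \<in> ?S" using nz by simp
    qed
  qed auto
qed auto

text \<open>Cauchy's formula with the circles of radius \<open>\<rho>\<close> and
  \<open>1 / \<rho>\<close>: the kernel expands in z/w on the outer and in w/z on the inner circle,
  and the two radii give the geometric bounds. The constant term is assigned to
  \<open>a\<close>.\<close>

lemma annulus_laurent_series:
  assumes R: "1 < R" and f: "f holomorphic_on {z. 1 / R < norm z \<and> norm z < R}"
  shows "\<exists>a b C s. 0 < s \<and> s < 1 \<and> geom_bdd C s a \<and> geom_bdd C s b \<and> fps_nth b 0 = 0 \<and>
    (\<forall>z. norm z = 1 \<longrightarrow> f z = (\<Sum>n. fps_nth a n * z ^ n) + (\<Sum>n. fps_nth b n * inverse z ^ n))"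
proof -
  let ?S = "{z::complex. 1 / R < norm z \<and> norm z < R}"
  define \<rho> where "\<rho> = (1 + R) / 2"
  have \<rho>: "1 < \<rho>" "\<rho> < R" "0 < \<rho>" using R by (auto simp: \<rho>_def)
  define s where "s = 1 / \<rho>"
  have s: "0 < s" "s < 1" "1 / R < s" using \<rho> R by (auto simp: s_def divide_simps)
  have op: "open ?S"
    unfolding Collect_conj_eq by (intro open_Int open_Collect_less continuous_intros)
  have c1: "continuous_on (sphere 0 \<rho>) f" and c2: "continuous_on (sphere 0 s) f"
    using \<rho> R s by (auto intro!: continuous_on_subset[OF holomorphic_on_imp_continuous_on[OF f]] simp: divide_simps less_1_mult order.strict_trans[of _ 1 \<rho>])
  obtain M1 where M1: "\<And>z. norm z = \<rho> \<Longrightarrow> norm (f z) \<le> M1" using continuous_on_sphere_bounded[OF c1] by blast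
  obtain M2 where M2: "\<And>z. norm z = s \<Longrightarrow> norm (f z) \<le> M2" using continuous_on_sphere_bounded[OF c2] by blast
  define C where "C = max M1 M2"
  have C: "norm (f z) \<le> C" if "norm z = \<rho> \<or> norm z = s" for z using that M1[of z] M2[of z] unfolding C_def by linarith
  have C0: "0 \<le> C" using order.trans[OF norm_ge_zero C[of "of_real \<rho>"]] \<rho> by simp
  define a where "a = Abs_fps (\<lambda>n. 1 / (2 * of_real pi * \<i>) * circle_integral \<rho> (\<lambda>w. f w / w ^ Suc n))"
  define b where "b = Abs_fps (\<lambda>n. if n = 0 then 0 else 1 / (2 * of_real pi * \<i>) * circle_integral s (\<lambda>w. f w * w ^ (n - 1)))"
  have bound: "norm (1 / (2 * of_real pi * \<i>) * circle_integral x h) \<le> B * x"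
    if "0 < x" "continuous_on (sphere 0 x) h" "\<And>w. norm w = x \<Longrightarrow> norm (h w) \<le> B" "0 \<le> B" for x h B
  proof -
    have "norm (circle_integral x h) \<le> B * (2 * pi * x)"
      using that by (intro has_contour_integral_bound_circlepath[OF has_contour_integral_integral[OF contour_integrable_circle]]) auto
    then show ?thesis by (simp add: norm_mult norm_divide divide_le_eq mult_ac)
  qed
  have ga: "geom_bdd C s a"
    unfolding geom_bdd_def
  proof
    fix n
    have "norm (fps_nth a n) \<le> C / \<rho> ^ Suc n * \<rho>"
      unfolding a_def fps_nth_Abs_fps using \<rho> C C0
      by (intro bound continuous_intros c1) (auto simp: norm_divide norm_power intro!: divide_right_mono simp del: power_Suc)
    then show "norm (fps_nth a n) \<le> C * s ^ n" using \<rho> by (simp add: s_def power_divide)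
  qed
  have gb: "geom_bdd C s b"
    unfolding geom_bdd_def
  proof
    fix n
    show "norm (fps_nth b n) \<le> C * s ^ n"
    proof (cases n)
      case (Suc k)
      have "norm (fps_nth b n) \<le> C * s ^ k * s"
        unfolding b_def fps_nth_Abs_fps using s C C0 Suc
        by (simp only: if_False nat.distinct diff_Suc_1 Suc, intro bound continuous_intros c2) (auto simp: norm_mult norm_power intro!: mult_right_mono)
      then show ?thesis using Suc by (simp add: mult_ac)
    qed (use C0 in \<open>simp add: b_def\<close>)
  qed
  have "f z = (\<Sum>n. fps_nth a n * z ^ n) + (\<Sum>n. fps_nth b n * inverse z ^ n)" if z: "norm z = 1" for z
  proof -
    have z0: "z \<noteq> 0" using z by auto
    \<comment> \<open>The difference quotient has a removable singularity at z, so its integrals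
      over the two circles agree; separating the kernel 1/(w - z) turns this into Cauchy's formula
      for the annulus.\<close>
    define F where "F = (\<lambda>w. if w = z then deriv f z else (f w - f z) / (w - z))"
    have "z \<in> ?S" using z R by (auto simp: divide_simps)
    then have F: "F holomorphic_on ?S"
      unfolding F_def using op by (intro pole_lemma[OF f]) (simp add: interior_open)
    have I: "circle_integral x F
       = circle_integral x (\<lambda>w. f w / (w - z)) - f z * circle_integral x (\<lambda>w. 1 / (w - z))"
      if x: "0 < x" "x \<noteq> 1" and c: "continuous_on (sphere 0 x) f" for x
    proof -
      have nz: "w \<noteq> z" if "w \<in> sphere 0 x" for w using that x z by auto
      have "circle_integral x F = circle_integral x (\<lambda>w. f w / (w - z) - f z * (1 / (w - z)))"
        using nz x by (intro contour_integral_eq) (auto simp: F_def diff_divide_distrib)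
      also have "\<dots> = circle_integral x (\<lambda>w. f w / (w - z)) - circle_integral x (\<lambda>w. f z * (1 / (w - z)))"
        using nz x by (intro contour_integral_diff contour_integrable_circle continuous_intros c) auto
      also have "circle_integral x (\<lambda>w. f z * (1 / (w - z))) = f z * circle_integral x (\<lambda>w. 1 / (w - z))"
        using nz x by (intro contour_integral_lmul contour_integrable_circle continuous_intros) auto
      finally show ?thesis .
    qed
    have "circle_integral \<rho> (\<lambda>w. 1 / (w - z)) = 2 * of_real pi * \<i> * 1"
      using \<rho> z by (intro contour_integral_unique Cauchy_integral_circlepath_simple[of "\<lambda>_. 1"]) auto
    moreover have "circle_integral s (\<lambda>w. 1 / (w - z)) = 0"
      using s z by (intro contour_integral_unique Cauchy_theorem_disc_simple[of _ 0 1] holomorphic_intros) auto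
    moreover have "circle_integral \<rho> F = circle_integral s F"
      unfolding s_def by (rule contour_integral_circles_annulus[OF F \<rho>(1,2)])
    ultimately have main: "2 * of_real pi * \<i> * f z = circle_integral \<rho> (\<lambda>w. f w / (w - z)) - circle_integral s (\<lambda>w. f w / (w - z))"
      using I[of \<rho>] I[of s] \<rho> s c1 c2 by (simp add: algebra_simps)
    have "(\<lambda>n. circle_integral \<rho> (\<lambda>w. z ^ n * (f w / w ^ Suc n))) sums
      circle_integral \<rho> (\<lambda>w. \<Sum>n. z ^ n * (f w / w ^ Suc n))"
    proof (rule contour_integral_circle_suminf)
      show "summable (\<lambda>n. C / \<rho> * s ^ n)" using s by (intro summable_mult summable_geometric) auto
      show "norm (z ^ n * (f w / w ^ Suc n)) \<le> C / \<rho> * s ^ n" if "norm w = \<rho>" for n w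
        using C[of w] that z \<rho> by (simp add: norm_mult norm_divide norm_power s_def power_divide divide_right_mono)
      show "continuous_on (sphere 0 \<rho>) (\<lambda>w. z ^ n * (f w / w ^ Suc n))" for n
        using \<rho> by (intro continuous_intros c1) auto
    qed (use \<rho> in auto)
    also have "(\<lambda>n. circle_integral \<rho> (\<lambda>w. z ^ n * (f w / w ^ Suc n)))
       = (\<lambda>n. z ^ n * circle_integral \<rho> (\<lambda>w. f w / w ^ Suc n))"
      using \<rho> by (intro ext contour_integral_lmul contour_integrable_circle continuous_intros c1) auto
    also have "circle_integral \<rho> (\<lambda>w. \<Sum>n. z ^ n * (f w / w ^ Suc n)) = circle_integral \<rho> (\<lambda>w. f w / (w - z))"
    proof (rule contour_integral_eq)
      fix w assume "w \<in> path_image (circlepath 0 \<rho>)"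
      then have w: "norm w = \<rho>" "w \<noteq> 0" "w \<noteq> z" using \<rho> z by auto
      have "(\<lambda>n. f w / w * (z / w) ^ n) sums (f w / w * (1 / (1 - z / w)))"
        using w z \<rho> by (intro sums_mult geometric_sums) (auto simp: norm_divide)
      moreover have "f w / w * (1 / (1 - z / w)) = f w / (w - z)" using w by (simp add: field_simps)
      ultimately show "(\<Sum>n. z ^ n * (f w / w ^ Suc n)) = f w / (w - z)"
        by (simp add: sums_iff power_divide mult_ac)
    qed
    finally have A: "(\<lambda>n. fps_nth a n * z ^ n) sums (1 / (2 * of_real pi * \<i>) * circle_integral \<rho> (\<lambda>w. f w / (w - z)))"
      using sums_mult[of _ _ "1 / (2 * of_real pi * \<i>)"] by (fastforce simp: a_def mult_ac)
    have "(\<lambda>n. circle_integral s (\<lambda>w. inverse z ^ Suc n * (f w * w ^ n))) sums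
      circle_integral s (\<lambda>w. \<Sum>n. inverse z ^ Suc n * (f w * w ^ n))"
    proof (rule contour_integral_circle_suminf)
      show "summable (\<lambda>n. C * s ^ n)" using s by (intro summable_mult summable_geometric) auto
      show "norm (inverse z ^ Suc n * (f w * w ^ n)) \<le> C * s ^ n" if "norm w = s" for n w
        using C[of w] that z s by (simp add: norm_mult norm_inverse norm_power mult_right_mono)
      show "continuous_on (sphere 0 s) (\<lambda>w. inverse z ^ Suc n * (f w * w ^ n))" for n
        by (intro continuous_intros c2)
    qed (use s in auto)
    also have "(\<lambda>n. circle_integral s (\<lambda>w. inverse z ^ Suc n * (f w * w ^ n)))
       = (\<lambda>n. inverse z ^ Suc n * circle_integral s (\<lambda>w. f w * w ^ n))"
      using s by (intro ext contour_integral_lmul contour_integrable_circle continuous_intros c2) auto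
    also have "circle_integral s (\<lambda>w. \<Sum>n. inverse z ^ Suc n * (f w * w ^ n)) = circle_integral s (\<lambda>w. - 1 * (f w / (w - z)))"
    proof (rule contour_integral_eq)
      fix w assume "w \<in> path_image (circlepath 0 s)"
      then have w: "norm w = s" "w \<noteq> z" using s z by auto
      have "(\<lambda>n. f w / z * (w / z) ^ n) sums (f w / z * (1 / (1 - w / z)))"
        using w z s by (intro sums_mult geometric_sums) (auto simp: norm_divide)
      moreover have "f w / z * (1 / (1 - w / z)) = - 1 * (f w / (w - z))" using w z0 by (simp add: field_simps)
      ultimately show "(\<Sum>n. inverse z ^ Suc n * (f w * w ^ n)) = - 1 * (f w / (w - z))"
        by (simp add: sums_iff power_divide divide_inverse power_mult_distrib mult_ac)
    qed
    also have "\<dots> = - 1 * circle_integral s (\<lambda>w. f w / (w - z))"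
      using s z by (intro contour_integral_lmul contour_integrable_circle continuous_intros c2) auto
    finally have B: "(\<lambda>n. fps_nth b (Suc n) * inverse z ^ Suc n) sums (1 / (2 * of_real pi * \<i>) * (- 1 * circle_integral s (\<lambda>w. f w / (w - z))))"
      using sums_mult[of _ _ "1 / (2 * of_real pi * \<i>)"] by (fastforce simp: b_def mult_ac)
    then have B': "(\<lambda>n. fps_nth b n * inverse z ^ n) sums (1 / (2 * of_real pi * \<i>) * (- 1 * circle_integral s (\<lambda>w. f w / (w - z))))"
      by (subst (asm) sums_Suc_iff) (simp add: b_def)
    have "f z = 1 / (2 * of_real pi * \<i>) * (2 * of_real pi * \<i> * f z)" by simp
    also have "\<dots> = (\<Sum>n. fps_nth a n * z ^ n) + (\<Sum>n. fps_nth b n * inverse z ^ n)"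
      unfolding main sums_unique[OF A, symmetric] sums_unique[OF B', symmetric] by (simp add: right_diff_distrib diff_divide_distrib)
    finally show ?thesis .
  qed
  moreover have "fps_nth b 0 = 0" by (simp add: b_def)
  ultimately show ?thesis using s ga gb by blast
qed

section \<open>Logarithms on the circle\<close>

text \<open>Discharges the choice in the definition: winding number zero makes the image loop
  null-homotopic in the punctured plane, and a null-homotopic circle map has a continuous
  logarithm.\<close>

lemma circle_log:
  assumes "szego_type \<phi>"
  shows "continuous_on (sphere 0 1) (circle_log \<phi>)" "\<And>z. norm z = 1 \<Longrightarrow> exp (circle_log \<phi> z) = \<phi> z"
proof -
  obtain U g where U: "open U" "sphere 0 1 \<subseteq> U" "g holomorphic_on U" "\<And>z. z \<in> sphere 0 1 \<Longrightarrow> g z = \<phi> z"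
    and nz: "\<And>z. z \<in> sphere 0 1 \<Longrightarrow> \<phi> z \<noteq> 0"
    and wn: "winding_number (\<phi> \<circ> circlepath 0 1) 0 = 0"
    using assms unfolding szego_type_def by blast
  have cont: "continuous_on (sphere 0 1) \<phi>"
    using continuous_on_subset[OF holomorphic_on_imp_continuous_on[OF U(3)] U(2)] U(4)
    by (subst continuous_on_cong[OF refl, of _ _ g]) auto
  have path: "path (\<phi> \<circ> circlepath 0 1)"
    by (intro path_continuous_image) (auto intro: cont)
  have "0 \<notin> path_image (\<phi> \<circ> circlepath 0 1)"
    unfolding path_image_compose using nz by auto
  then obtain a where "homotopic_loops (- {0}) (\<phi> \<circ> circlepath 0 1) (\<lambda>t. a)"
    using winding_number_homotopic_loops_null_eq[OF path] wn by blast
  then have "homotopic_with_canon (\<lambda>h. True) (sphere 0 1) (- {0})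
     ((\<phi> \<circ> circlepath 0 1) \<circ> (\<lambda>z. Arg2pi z / (2 * pi))) ((\<lambda>t. a) \<circ> (\<lambda>z. Arg2pi z / (2 * pi)))"
    by (rule homotopic_loops_imp_homotopic_circlemaps)
  then have "\<exists>a. homotopic_with_canon (\<lambda>h. True) (sphere 0 1) (- {0})
     ((\<phi> \<circ> circlepath 0 1) \<circ> (\<lambda>z. Arg2pi z / (2 * pi))) (\<lambda>t. a)"
    by (auto simp: o_def)
  then obtain L where L: "continuous_on (sphere 0 1) L"
    "\<And>z. z \<in> sphere 0 1 \<Longrightarrow> ((\<phi> \<circ> circlepath 0 1) \<circ> (\<lambda>z. Arg2pi z / (2 * pi))) z = exp (L z)"
    unfolding inessential_eq_continuous_logarithm by blast
  have "circlepath 0 1 (Arg2pi z / (2 * pi)) = z" if "norm z = 1" for z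
  proof -
    have "circlepath 0 1 (Arg2pi z / (2 * pi)) = exp (\<i> * of_real (Arg2pi z))"
      by (simp add: circlepath mult_ac)
    also have "\<dots> = z"
      using Arg2pi_eq[of z] that by simp
    finally show ?thesis .
  qed
  then have "\<exists>L. continuous_on (sphere 0 1) L \<and> (\<forall>z\<in>sphere 0 1. exp (L z) = \<phi> z)"
    using L by (intro exI[of _ L]) auto
  then have "continuous_on (sphere 0 1) (circle_log \<phi>) \<and> (\<forall>z\<in>sphere 0 1. exp (circle_log \<phi> z) = \<phi> z)"
    unfolding circle_log_def by (rule someI_ex)
  then show "continuous_on (sphere 0 1) (circle_log \<phi>)" "\<And>z. norm z = 1 \<Longrightarrow> exp (circle_log \<phi> z) = \<phi> z"
    by auto
qed

text \<open>Near a point the logarithm moves by less than 1, hence less than \<pi>, so its increment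
  is the principal logarithm of the quotient of the values of \<open>g\<close>.\<close>

lemma continuous_log_imp_holomorphic:
  assumes S: "open S" and L: "continuous_on S L" and g: "g holomorphic_on S" and e: "\<And>z. z \<in> S \<Longrightarrow> exp (L z) = g z"
  shows "L holomorphic_on S"
proof -
  have "L field_differentiable at z0" if z0: "z0 \<in> S" for z0
  proof -
    have "isCont L z0" using L S z0 by (simp add: continuous_on_eq_continuous_at)
    then have "eventually (\<lambda>z. dist (L z) (L z0) < 1) (nhds z0)"
      by (intro tendstoD) (auto simp: isCont_def tendsto_nhds_iff)
    moreover have "eventually (\<lambda>z. z \<in> S) (nhds z0)"
      using S z0 by (rule eventually_nhds_in_open)
    ultimately have "eventually (\<lambda>z. L z = L z0 + Ln (g z / g z0)) (nhds z0)"
    proof eventually_elim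
      case (elim z)
      have "exp (L z - L z0) = g z / g z0"
        using e[OF elim(2)] e[OF z0] by (simp add: exp_diff)
      moreover have "\<bar>Im (L z - L z0)\<bar> < 1"
        using abs_Im_le_cmod[of "L z - L z0"] elim(1) by (simp add: dist_norm)
      ultimately have "Ln (g z / g z0) = L z - L z0"
        using pi_gt3 by (intro Ln_unique) auto
      then show ?case by simp
    qed
    moreover have "g z0 \<noteq> 0" using e[OF z0] by (metis exp_not_eq_zero)
    then have "((\<lambda>z. L z0 + Ln (g z / g z0)) has_field_derivative (deriv g z0 / g z0)) (at z0)"
      using holomorphic_derivI[OF g S z0] by (auto intro!: derivative_eq_intros)
    ultimately have "(L has_field_derivative (deriv g z0 / g z0)) (at z0)"
      by (subst DERIV_cong_ev) auto
    then show ?thesis by (auto simp: field_differentiable_def)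
  qed
  then show ?thesis using S by (simp add: holomorphic_on_open field_differentiable_def)
qed

text \<open>Compactness gives a collar of uniform width \<epsilon>; R = 1 + \<epsilon> works on the
  inner side too, since 1 - \<epsilon> <= 1/(1 + \<epsilon>).\<close>

lemma open_superset_sphere_contains_annulus:
  assumes "open W" "sphere 0 1 \<subseteq> (W :: complex set)"
  shows "\<exists>R>1. {z. 1 / R < norm z \<and> norm z < R} \<subseteq> W"
proof -
  obtain \<epsilon> where \<epsilon>: "\<epsilon> > 0" "(\<Union>x\<in>sphere 0 1. ball x \<epsilon>) \<subseteq> W"
    using compact_subset_open_imp_ball_epsilon_subset[OF compact_sphere assms] .
  have "z \<in> W" if z: "1 / (1 + \<epsilon>) < norm z" "norm z < 1 + \<epsilon>" for z
  proof -
    have "0 < 1 / (1 + \<epsilon>)" using \<epsilon> by simp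
    then have "norm z > 0" using z(1) by linarith
    then have z0: "z \<noteq> 0" by simp
    have "z - sgn z = of_real (norm z - 1) * sgn z"
      using z0 by (simp add: sgn_eq left_diff_distrib diff_divide_distrib)
    then have "norm (z - sgn z) = \<bar>norm z - 1\<bar>"
      using z0 by (simp only: norm_mult norm_of_real norm_sgn) simp
    also have "\<dots> < \<epsilon>"
    proof -
      have "1 - \<epsilon> \<le> 1 / (1 + \<epsilon>)" using \<epsilon> by (simp add: field_simps)
      then show ?thesis using z by linarith
    qed
    finally have "z \<in> ball (sgn z) \<epsilon>" by (simp add: dist_norm norm_minus_commute)
    moreover have "sgn z \<in> sphere 0 1" using z0 by (simp add: norm_sgn)
    ultimately show ?thesis using \<epsilon>(2) by blast
  qed
  then show ?thesis using \<epsilon>(1) by (intro exI[of _ "1 + \<epsilon>"]) auto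
qed

text \<open>Extend radially: the value at the projection \<open>sgn z\<close> plus the principal
  logarithm of g(z)/g(sgn z). Near the circle this quotient lies within distance 1 of 1, away from
  the branch cut; holomorphy then follows from continuity.\<close>

lemma holomorphic_log_annulus:
  assumes U: "open U" "sphere 0 1 \<subseteq> U" "g holomorphic_on U"
    and L: "continuous_on (sphere 0 1) L" "\<And>z. norm z = 1 \<Longrightarrow> exp (L z) = g z"
  shows "\<exists>R>1. \<exists>L'. L' holomorphic_on {z. 1 / R < norm z \<and> norm z < R} \<and> (\<forall>z. norm z = 1 \<longrightarrow> L' z = L z)"
proof -
  have gc: "continuous_on U g" by (rule holomorphic_on_imp_continuous_on[OF U(3)])
  have gnz: "g z \<noteq> 0" if "norm z = 1" for z using L(2)[OF that] by (metis exp_not_eq_zero)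
  define V where "V = U - {0}"
  have V: "open V" "0 \<notin> V" "V \<subseteq> U" using U by (auto simp: V_def)
  have sg: "sgn z \<in> sphere 0 1" if "z \<in> V" for z using that V by (auto simp: norm_sgn)
  have sgc: "continuous_on V (\<lambda>z::complex. sgn z)"
    using V by (intro continuous_intros) auto
  define h where "h = (\<lambda>z. g z / g (sgn z))"
  have gs: "continuous_on V (\<lambda>z. g (sgn z))"
    using sg U by (intro continuous_on_compose2[OF gc sgc]) auto
  have hc: "continuous_on V h"
    unfolding h_def using gnz sg
    by (intro continuous_on_divide gs continuous_on_subset[OF gc V(3)]) auto
  define W where "W = V \<inter> h -` ball 1 1"
  have W: "open W" unfolding W_def using continuous_open_preimage[OF hc V(1)] by simp
  have "sphere 0 1 \<subseteq> W"
  proof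
    fix z :: complex assume z: "z \<in> sphere 0 1"
    then have "sgn z = z" by (simp add: sgn_eq)
    then show "z \<in> W" using z U gnz[of z] by (auto simp: W_def V_def h_def)
  qed
  then obtain R where R: "1 < R" "{z. 1 / R < norm z \<and> norm z < R} \<subseteq> W"
    using open_superset_sphere_contains_annulus[OF W] by blast
  define L' where "L' = (\<lambda>z. L (sgn z) + Ln (h z))"
  have hW: "h z \<notin> \<real>\<^sub>\<le>\<^sub>0" "h z \<noteq> 0" if "z \<in> W" for z
  proof -
    have "norm (1 - h z) < 1" using that by (simp add: W_def dist_norm)
    then have "Re (1 - h z) < 1" using complex_Re_le_cmod[of "1 - h z"] by linarith
    then have "0 < Re (h z)" by simp
    then show "h z \<notin> \<real>\<^sub>\<le>\<^sub>0" "h z \<noteq> 0" by (auto simp: complex_nonpos_Reals_iff)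
  qed
  have WV: "W \<subseteq> V" by (auto simp: W_def)
  have "L' holomorphic_on W"
  proof (rule continuous_log_imp_holomorphic[OF W])
    show "g holomorphic_on W" using U(3) V(3) WV by (meson holomorphic_on_subset order_trans)
    show "continuous_on W L'"
      unfolding L'_def
    proof (intro continuous_on_add)
      show "continuous_on W (\<lambda>z. L (sgn z))"
        using sg WV by (intro continuous_on_compose2[OF L(1) continuous_on_subset[OF sgc WV]]) auto
      show "continuous_on W (\<lambda>z. Ln (h z))"
        using hW by (intro continuous_on_Ln' continuous_on_subset[OF hc WV]) auto
    qed
    show "exp (L' z) = g z" if "z \<in> W" for z
    proof -
      have "norm (sgn z) = 1" using sg[of z] that WV by auto
      then show ?thesis
        using hW(2)[OF that] L(2)[of "sgn z"] gnz[of "sgn z"] by (simp add: L'_def exp_add h_def)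
    qed
  qed
  then have "L' holomorphic_on {z. 1 / R < norm z \<and> norm z < R}"
    using R(2) by (rule holomorphic_on_subset)
  moreover have "L' z = L z" if "norm z = 1" for z
  proof -
    have "sgn z = z" using that by (simp add: sgn_eq)
    then show ?thesis using gnz[OF that] by (simp add: L'_def h_def)
  qed
  ultimately show ?thesis using R(1) by blast
qed

section \<open>Cauchy kernels and the function \<alpha>\<close>

lemma fourier_coeff_cauchy_kernel_inside:
  assumes f: "continuous_on (sphere 0 1) f" and c: "norm c < 1"
  shows "(\<lambda>l. c ^ l * fourier_coeff f (n + int l)) sums fourier_coeff (\<lambda>z. f z * (z / (z - c))) n"
proof -
  have "(\<lambda>l. c ^ l * fourier_coeff f (n - - int l)) sums fourier_coeff (\<lambda>z. f z * (z / (z - c))) n"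
  proof (rule fourier_coeff_mult_series[OF f])
    show "summable (\<lambda>l. norm (c ^ l))" using c by (simp add: norm_power summable_geometric)
    fix z :: complex assume z: "norm z = 1"
    then have z0: "z \<noteq> 0" "z \<noteq> c" using c by auto
    have "(\<lambda>l. (c / z) ^ l) sums (1 / (1 - c / z))"
      using c z by (intro geometric_sums) (simp add: norm_divide)
    moreover have "1 / (1 - c / z) = z / (z - c)" using z0 by (simp add: field_simps)
    moreover have "(c / z) ^ l = c ^ l * z powi (- int l)" for l
      by (simp add: power_int_minus divide_inverse power_mult_distrib power_inverse)
    ultimately show "(\<lambda>l. c ^ l * z powi (- int l)) sums (z / (z - c))"
      by simp
  qed
  then show ?thesis by simp
qed

text \<open>For an outer point z/(z - c) expands in powers of z/c starting at exponent 1, so only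
  coefficients of index strictly below \<open>n\<close> enter; for an inner point they are those of
  index at least \<open>n\<close>.\<close>

lemma fourier_coeff_cauchy_kernel_outside:
  assumes f: "continuous_on (sphere 0 1) f" and c: "norm c > 1"
  shows "(\<lambda>l. - (inverse c ^ Suc l) * fourier_coeff f (n - int (Suc l))) sums fourier_coeff (\<lambda>z. f z * (z / (z - c))) n"
proof (rule fourier_coeff_mult_series[OF f])
  have c0: "c \<noteq> 0" using c by auto
  have ic: "norm (inverse c) < 1" using c by (simp add: norm_inverse inverse_less_1_iff)
  then have "summable (\<lambda>l. norm (inverse c) * norm (inverse c) ^ l)"
    by (intro summable_mult summable_geometric) simp
  then show "summable (\<lambda>l. norm (- (inverse c ^ Suc l)))" by (simp add: norm_mult norm_power)
  fix z :: complex assume z: "norm z = 1"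
  then have z0: "z \<noteq> c" using c by auto
  have "(\<lambda>l. - (z / c) * (z / c) ^ l) sums (- (z / c) * (1 / (1 - z / c)))"
    using c z c0 by (intro sums_mult geometric_sums) (simp add: norm_divide divide_less_eq)
  moreover have "- (z / c) * (1 / (1 - z / c)) = z / (z - c)" using z0 c0 by (simp add: field_simps)
  moreover have "- (z / c) * (z / c) ^ l = - (inverse c ^ Suc l) * z powi int (Suc l)" for l
    unfolding power_int_of_nat by (simp add: divide_inverse power_mult_distrib mult_ac)
  ultimately show "(\<lambda>l. - (inverse c ^ Suc l) * z powi int (Suc l)) sums (z / (z - c))"
    by simp
qed

text \<open>The extra factor z cancels the 1/z of the Fourier integral. Without integrability both
  contour integrals have the default value 0, so the identity is unconditional.\<close>

lemma szego_alpha_eq_fourier_coeff: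
  "szego_alpha \<phi> c = exp (fourier_coeff (\<lambda>z. circle_log \<phi> z * (z / (z - c))) 0)"
proof (cases "(\<lambda>\<tau>. circle_log \<phi> \<tau> / (\<tau> - c)) contour_integrable_on circlepath 0 1")
  case True
  have "fourier_coeff (\<lambda>z. circle_log \<phi> z * (z / (z - c))) 0
      = circle_integral 1 (\<lambda>\<tau>. 1 / (2 * of_real pi * \<i>) * (circle_log \<phi> \<tau> / (\<tau> - c)))"
    unfolding fourier_coeff_def by (intro contour_integral_eq) auto
  also have "\<dots> = 1 / (2 * of_real pi * \<i>) * circle_integral 1 (\<lambda>\<tau>. circle_log \<phi> \<tau> / (\<tau> - c))"
    by (rule contour_integral_lmul[OF True])
  finally show ?thesis by (simp add: szego_alpha_def)
next
  case False
  have "\<not> (\<lambda>\<tau>. 1 / (2 * of_real pi * \<i>) * (circle_log \<phi> \<tau> / (\<tau> - c))) contour_integrable_on circlepath 0 1"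
  proof
    assume "(\<lambda>\<tau>. 1 / (2 * of_real pi * \<i>) * (circle_log \<phi> \<tau> / (\<tau> - c))) contour_integrable_on circlepath 0 1"
    from contour_integrable_lmul[OF this, of "2 * of_real pi * \<i>"] False show False by simp
  qed
  then have "circle_integral 1 (\<lambda>\<tau>. 1 / (2 * of_real pi * \<i>) * (circle_log \<phi> \<tau> / (\<tau> - c))) = 0"
    by (rule not_integrable_contour_integral)
  moreover have "fourier_coeff (\<lambda>z. circle_log \<phi> z * (z / (z - c))) 0
      = circle_integral 1 (\<lambda>\<tau>. 1 / (2 * of_real pi * \<i>) * (circle_log \<phi> \<tau> / (\<tau> - c)))"
    unfolding fourier_coeff_def by (intro contour_integral_eq) auto
  ultimately show ?thesis
    using False by (simp add: szego_alpha_def not_integrable_contour_integral)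
qed

lemma geom_bdd_mono_rate: "geom_bdd C s f \<Longrightarrow> 0 \<le> s \<Longrightarrow> s \<le> s' \<Longrightarrow> geom_bdd C s' f"
  unfolding geom_bdd_def
proof
  fix n assume *: "\<forall>n. norm (fps_nth f n) \<le> C * s ^ n" and s: "0 \<le> s" "s \<le> s'"
  have "0 \<le> C" using order.trans[OF norm_ge_zero *[rule_format, of 0]] by simp
  then have "C * s ^ n \<le> C * s' ^ n" using s by (intro mult_left_mono power_mono)
  then show "norm (fps_nth f n) \<le> C * s' ^ n" using *[rule_format, of n] by linarith
qed

lemma geom_bdd_imp_fps_conv_radius:
  assumes "geom_bdd C s f" "0 < s"
  shows "fps_conv_radius f \<ge> ereal (1 / s)"
  unfolding fps_conv_radius_def
proof (rule conv_radius_geI_ex)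
  fix r :: real assume r: "0 < r" "ereal r < ereal (1 / s)"
  then have rs: "s * r < 1" using assms(2) by (simp add: field_simps)
  have "summable (\<lambda>n. fps_nth f n * of_real r ^ n)"
  proof (rule summable_comparison_test')
    show "summable (\<lambda>n. C * (s * r) ^ n)"
      using rs r assms(2) by (intro summable_mult summable_geometric) auto
    show "norm (fps_nth f n * of_real r ^ n) \<le> C * (s * r) ^ n" if "n \<ge> 0" for n
      using mult_right_mono[OF geom_bddD[OF assms(1), of n], of "r ^ n"] r
      by (simp add: norm_mult norm_power power_mult_distrib mult_ac)
  qed
  then show "\<exists>z. norm z = r \<and> summable (\<lambda>n. fps_nth f n * z ^ n)"
    using r by (intro exI[of _ "of_real r"]) auto
qed

lemma holomorphic_on_eval_fps_ball:
  assumes "geom_bdd C s f" "0 < s"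
  shows "eval_fps f holomorphic_on ball 0 (1 / s)"
proof -
  have "ball 0 (1 / s) \<subseteq> eball (0::complex) (fps_conv_radius f)"
  proof
    fix x :: complex assume "x \<in> ball 0 (1 / s)"
    then have "ereal (dist 0 x) < ereal (1 / s)" by simp
    also have "\<dots> \<le> fps_conv_radius f" by (rule geom_bdd_imp_fps_conv_radius[OF assms])
    finally show "x \<in> eball 0 (fps_conv_radius f)" by (simp add: in_eball_iff)
  qed
  then show ?thesis by (rule holomorphic_on_eval_fps)
qed

text \<open>The two halves of the Laurent series of the extended logarithm; the constant coefficient
  is split off as \<open>l0\<close> so that both functions vanish at 0.\<close>

lemma szego_log_splitting:
  assumes "szego_type \<phi>"
  shows "\<exists>A B R l0. disc_pair A B R \<and>
    (\<forall>z. norm z = 1 \<longrightarrow> circle_log \<phi> z = l0 + A z + B (inverse z))"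
proof -
  obtain U g where U: "open U" "sphere 0 1 \<subseteq> U" "g holomorphic_on U" "\<And>z. z \<in> sphere 0 1 \<Longrightarrow> g z = \<phi> z"
    using assms unfolding szego_type_def by blast
  have "exp (circle_log \<phi> z) = g z" if "norm z = 1" for z
    using circle_log(2)[OF assms that] U(4)[of z] that by simp
  from holomorphic_log_annulus[OF U(1-3) circle_log(1)[OF assms] this]
  obtain R L where R: "1 < R" "L holomorphic_on {z. 1 / R < norm z \<and> norm z < R}"
    "\<And>z. norm z = 1 \<Longrightarrow> L z = circle_log \<phi> z" by blast
  obtain a b C s where s: "0 < s" "s < 1" and a: "geom_bdd C s a" and b: "geom_bdd C s b" "fps_nth b 0 = 0"
    and L: "\<And>z. norm z = 1 \<Longrightarrow> L z = (\<Sum>n. fps_nth a n * z ^ n) + (\<Sum>n. fps_nth b n * inverse z ^ n)"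
    using annulus_laurent_series[OF R(1,2)] by blast
  define A where "A z = eval_fps a z - fps_nth a 0" for z
  define B where "B = eval_fps b"
  have "A holomorphic_on ball 0 (1 / s)" "B holomorphic_on ball 0 (1 / s)"
    unfolding A_def B_def using holomorphic_on_eval_fps_ball[OF a s(1)] holomorphic_on_eval_fps_ball[OF b(1) s(1)]
    by (auto intro!: holomorphic_intros)
  moreover have "1 < 1 / s" using s by simp
  moreover have "A 0 = 0" "B 0 = 0" using b(2) by (auto simp: A_def B_def eval_fps_at_0)
  ultimately have "disc_pair A B (1 / s)"
    by (simp add: disc_pair_def disc_function_def)
  moreover have "circle_log \<phi> z = fps_nth a 0 + A z + B (inverse z)" if "norm z = 1" for z
    using L[OF that] R(3)[OF that] by (simp add: A_def B_def eval_fps_def)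
  ultimately show ?thesis by blast
qed

section \<open>Asymptotics of bordered Toeplitz determinants\<close>

locale szego_symbol = disc_pair A B R for A B R +
  fixes \<phi> :: "complex \<Rightarrow> complex" and l0 :: complex
  assumes cont_log: "continuous_on (sphere 0 1) (circle_log \<phi>)"
    and exp_log: "norm z = 1 \<Longrightarrow> exp (circle_log \<phi> z) = \<phi> z"
    and log_split: "norm z = 1 \<Longrightarrow> circle_log \<phi> z = l0 + A z + B (inverse z)"
begin

lemma summable_norm_coeffs:
  "summable (\<lambda>l. norm (fps_nth Ac l))" "summable (\<lambda>l. norm (fps_nth Bc l))"
  "summable (\<lambda>l. norm (fps_nth (exp_fps A t) l))" "summable (\<lambda>l. norm (fps_nth (exp_fps B t) l))"
  using A.geom_bdd_exp_fps_uniform B.geom_bdd_exp_fps_uniform A.geom_bdd_exp_fps[of t] B.geom_bdd_exp_fps[of t] s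
  unfolding s_def[symmetric] by (auto intro: geom_bdd_summable_norm)

lemma circle_subset: "sphere 0 1 \<subseteq> ball (0::complex) R"
  using A.R by auto

lemma continuous_on_A: "continuous_on (sphere 0 1) A"
  by (rule continuous_on_subset[OF holomorphic_on_imp_continuous_on[OF A.hol] circle_subset])

lemma continuous_on_B_inverse: "continuous_on (sphere 0 1) (\<lambda>z. B (inverse z))"
proof (rule continuous_on_compose2[OF continuous_on_subset[OF holomorphic_on_imp_continuous_on[OF B.hol] circle_subset]])
  show "continuous_on (sphere 0 1) (inverse :: complex \<Rightarrow> complex)"
    by (intro continuous_intros) auto
qed (auto simp: norm_inverse)

lemma norm_less_R:
  fixes z :: complex
  shows "norm z = 1 \<Longrightarrow> norm z < R" "norm z = 1 \<Longrightarrow> norm (inverse z) < R"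
  using A.R by (auto simp: norm_inverse)

lemma fourier_coeff_A: "fourier_coeff A n = (if 0 \<le> n then fps_nth Ac (nat n) else 0)"
  by (intro fourier_coeff_power_series summable_norm_coeffs A.disc_sums norm_less_R)

lemma fourier_coeff_B_inverse: "fourier_coeff (\<lambda>z. B (inverse z)) n = (if n \<le> 0 then fps_nth Bc (nat (- n)) else 0)"
  by (intro fourier_coeff_inverse_power_series summable_norm_coeffs B.disc_sums norm_less_R)

lemma fourier_coeff_exp_A: "fourier_coeff (\<lambda>z. exp (t * A z)) n = (if 0 \<le> n then fps_nth (exp_fps A t) (nat n) else 0)"
  by (intro fourier_coeff_power_series summable_norm_coeffs A.exp_fps_sums norm_less_R)

lemma fourier_coeff_exp_B_inverse:
  "fourier_coeff (\<lambda>z. exp (t * B (inverse z))) n = (if n \<le> 0 then fps_nth (exp_fps B t) (nat (- n)) else 0)"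
  by (intro fourier_coeff_inverse_power_series summable_norm_coeffs B.exp_fps_sums norm_less_R)

lemma fourier_coeff_log:
  "fourier_coeff (circle_log \<phi>) n = (if n = 0 then l0 else if 0 < n then fps_nth Ac (nat n) else fps_nth Bc (nat (- n)))"
proof -
  have "fourier_coeff (circle_log \<phi>) n = fourier_coeff (\<lambda>z. (l0 * 1 + A z) + B (inverse z)) n"
    by (rule fourier_coeff_cong) (simp add: log_split)
  also have "\<dots> = l0 * fourier_coeff (\<lambda>z. 1) n + fourier_coeff A n + fourier_coeff (\<lambda>z. B (inverse z)) n"
    by (simp add: fourier_coeff_add fourier_coeff_cmult continuous_on_A continuous_on_B_inverse continuous_on_add
        del: mult_1_right)
  finally show ?thesis
    by (simp add: fourier_coeff_1 fourier_coeff_A fourier_coeff_B_inverse A.fps_expansion_nth_0 B.fps_expansion_nth_0)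
qed

lemma symbol_eq: "norm z = 1 \<Longrightarrow> \<phi> z = exp l0 * (exp (A z) * exp (B (inverse z)))"
  unfolding exp_log[symmetric] log_split by (simp add: exp_add)

lemma szego_G_eq: "szego_G \<phi> = exp l0"
  by (simp add: szego_G_def fourier_coeff_log)

lemma szego_E_eq: "szego_E \<phi> = exp \<kappa>"
proof -
  obtain C D where "geom_bdd C s Ac" "geom_bdd D s Bc"
    using A.geom_bdd_exp_fps_uniform B.geom_bdd_exp_fps_uniform unfolding s_def by blast
  then have "\<kappa> = (\<Sum>n. of_nat (Suc n) * fps_nth Ac (Suc n) * fps_nth Bc (Suc n))"
    unfolding \<kappa>_def by (rule suminf_hank_diagonal[OF s(2,3)])
  then show ?thesis
    by (simp add: szego_E_def fourier_coeff_log nat_add_distrib)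
qed

text \<open>An inner point selects the coefficients of index >= 0; in particular
  \<alpha>(c)/\<alpha>(0) is \<open>f\<^sub>+\<close> at c.\<close>

lemma szego_alpha_inside:
  assumes c: "norm c < 1"
  shows "szego_alpha \<phi> c = exp (l0 + A c)"
proof -
  have cR: "norm c < R" using c A.R by simp
  have "(\<lambda>l. c ^ l * fourier_coeff (circle_log \<phi>) (0 + int l)) sums fourier_coeff (\<lambda>z. circle_log \<phi> z * (z / (z - c))) 0"
    by (rule fourier_coeff_cauchy_kernel_inside[OF cont_log c])
  moreover have "(\<lambda>l. (if l = 0 then l0 else 0) + fps_nth Ac l * c ^ l) sums (l0 + A c)"
    using sums_single[of 0 "\<lambda>_. l0"] by (intro sums_add A.disc_sums[OF cR]) auto
  moreover have "c ^ l * fourier_coeff (circle_log \<phi>) (0 + int l) = (if l = 0 then l0 else 0) + fps_nth Ac l * c ^ l" for l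
    by (simp add: fourier_coeff_log A.fps_expansion_nth_0)
  ultimately show ?thesis
    unfolding szego_alpha_eq_fourier_coeff using sums_unique2 by fastforce
qed

text \<open>An outer point selects the negative coefficients, with a minus sign: \<alpha>(c) is the
  reciprocal of \<open>f\<^sub>-\<close> at c.\<close>

lemma szego_alpha_outside:
  assumes c: "norm c > 1"
  shows "szego_alpha \<phi> c = exp (- B (inverse c))"
proof -
  have ic: "norm (inverse c) < R" using c A.R by (simp add: norm_inverse) (smt (verit) inverse_less_1_iff)
  have "(\<lambda>l. - (inverse c ^ Suc l) * fourier_coeff (circle_log \<phi>) (0 - int (Suc l))) sums
     fourier_coeff (\<lambda>z. circle_log \<phi> z * (z / (z - c))) 0"
    by (rule fourier_coeff_cauchy_kernel_outside[OF cont_log c])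
  moreover have "(\<lambda>l. - (inverse c ^ Suc l) * fourier_coeff (circle_log \<phi>) (0 - int (Suc l))) = (\<lambda>l. - (fps_nth Bc (Suc l) * inverse c ^ Suc l))"
    by (auto simp: fourier_coeff_log fun_eq_iff nat_add_distrib)
  moreover have "(\<lambda>l. fps_nth Bc (Suc l) * inverse c ^ Suc l) sums B (inverse c)"
    using B.disc_sums[OF ic] by (subst sums_Suc_iff) (simp add: B.fps_expansion_nth_0)
  then have "(\<lambda>l. - (fps_nth Bc (Suc l) * inverse c ^ Suc l)) sums (- B (inverse c))"
    by (rule sums_minus)
  ultimately show ?thesis
    unfolding szego_alpha_eq_fourier_coeff using sums_unique2 by metis
qed

lemma fourier_coeff_symbol:
  "fourier_coeff \<phi> (int j - int k) = exp l0 * toep (exp_fps A 1) (exp_fps B 1) j k"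
proof -
  define p where "p = exp_fps A 1"
  define m where "m = exp_fps B 1"
  have contA: "continuous_on (sphere 0 1) (\<lambda>z. exp (1 * A z))"
    by (intro continuous_intros continuous_on_A)
  have contB: "continuous_on (sphere 0 1) (\<lambda>z. exp (1 * B (inverse z)))"
    by (intro continuous_intros continuous_on_B_inverse)
  have "fourier_coeff \<phi> (int j - int k) = fourier_coeff (\<lambda>z. exp l0 * (exp (1 * A z) * exp (1 * B (inverse z)))) (int j - int k)"
    by (rule fourier_coeff_cong) (simp add: symbol_eq)
  also have "\<dots> = exp l0 * fourier_coeff (\<lambda>z. exp (1 * A z) * exp (1 * B (inverse z))) (int j - int k)"
    by (intro fourier_coeff_cmult continuous_on_mult contA contB)
  also have "fourier_coeff (\<lambda>z. exp (1 * A z) * exp (1 * B (inverse z))) (int j - int k) = toep p m j k"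
  proof -
    have "(\<lambda>l. fps_nth m l * fourier_coeff (\<lambda>z. exp (1 * A z)) (int j - int k - - int l))
      sums fourier_coeff (\<lambda>z. exp (1 * A z) * exp (1 * B (inverse z))) (int j - int k)"
      unfolding m_def
    proof (rule fourier_coeff_mult_series[OF contA])
      fix z :: complex assume "norm z = 1"
      then show "(\<lambda>l. fps_nth (exp_fps B 1) l * z powi - int l) sums exp (1 * B (inverse z))"
        using B.exp_fps_sums[OF norm_less_R(2), of z 1] by (simp add: power_int_minus power_inverse)
    qed (rule summable_norm_coeffs)
    \<comment> \<open>The first j terms of the series for \<open>toep\<close> vanish by
      triangularity; shifting by j matches it with the convolution of Fourier coefficients.\<close>
    moreover have "fps_nth m l * fourier_coeff (\<lambda>z. exp (1 * A z)) (int j - int k - - int l)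
        = upper m j (l + j) * upper p k (l + j)" for l
    proof -
      have "0 \<le> int j - int k - - int l \<longleftrightarrow> k \<le> l + j" "nat (int j - int k - - int l) = l + j - k"
        by auto
      then show ?thesis
        unfolding fourier_coeff_exp_A by (simp add: upper_def p_def)
    qed
    moreover have "(\<lambda>l. upper m j (l + j) * upper p k (l + j)) sums toep p m j k"
    proof -
      obtain C where b: "geom_bdd C s p" "geom_bdd C s m"
        unfolding p_def m_def using common_bound by metis
      have "(\<Sum>i<j. upper m j i * upper p k i) = 0" by (intro sum.neutral) (auto simp: upper_def)
      then show ?thesis
        using summable_sums[OF summable_toep[OF s(2,3) b(2,1), of j k]]
        by (subst sums_iff_shift) (simp add: toep_def)
    qed
    ultimately show ?thesis using sums_unique2 by fastforce
  qed
  finally show ?thesis by (simp add: p_def m_def)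
qed

text \<open>One factor exp l0 is extracted from every column, the border included, which therefore
  carries the compensating exp (- l0).\<close>

lemma bordered_toeplitz_det_eq:
  assumes N: "N > 1"
  shows "bordered_toeplitz_det N \<phi> \<psi> = exp l0 ^ N *
    fdet N (\<lambda>j k. if k = 0 then exp (- l0) * fourier_coeff \<psi> (int j) else toep (exp_fps A 1) (exp_fps B 1) j k)"
proof -
  define f where "f = (\<lambda>j k. if k = N - 1 then fourier_coeff \<psi> (int N - 1 - int j) else fourier_coeff \<phi> (int k - int j))"
  have "bordered_toeplitz_det N \<phi> \<psi> = fdet N f"
    unfolding bordered_toeplitz_det_def fdet_def f_def by simp
  also have "\<dots> = fdet N (\<lambda>j k. f (N - 1 - j) (N - 1 - k))"
    by (rule fdet_reverse[symmetric])
  also have "\<dots> = fdet N (\<lambda>j k. exp l0 * (if k = 0 then exp (- l0) * fourier_coeff \<psi> (int j) else toep (exp_fps A 1) (exp_fps B 1) j k))"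
  proof (rule fdet_cong)
    fix j k assume jk: "j < N" "k < N"
    then have i: "int (N - 1 - j) = int N - 1 - int j" "int (N - 1 - k) = int N - 1 - int k" by auto
    show "f (N - 1 - j) (N - 1 - k) = exp l0 * (if k = 0 then exp (- l0) * fourier_coeff \<psi> (int j) else toep (exp_fps A 1) (exp_fps B 1) j k)"
    proof (cases "k = 0")
      case True
      have "exp l0 * (exp (- l0) * x) = x" for x :: complex
        by (simp add: exp_minus)
      then show ?thesis using True jk i by (simp add: f_def)
    next
      case False
      then have "N - 1 - k \<noteq> N - 1" using jk by auto
      then show ?thesis using False i fourier_coeff_symbol[of j k] by (simp add: f_def)
    qed
  qed
  also have "\<dots> = exp l0 ^ N * fdet N (\<lambda>j k. if k = 0 then exp (- l0) * fourier_coeff \<psi> (int j) else toep (exp_fps A 1) (exp_fps B 1) j k)"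
    by (rule fdet_scale)
  finally show ?thesis .
qed

end

lemma continuous_on_cauchy_kernel:
  "norm c \<noteq> 1 \<Longrightarrow> continuous_on (sphere 0 1) (\<lambda>z::complex. z / (z - c))"
  by (intro continuous_intros) auto

lemma fourier_coeff_linear_combination:
  assumes "continuous_on (sphere 0 1) h" "\<And>j. j \<in> J \<Longrightarrow> continuous_on (sphere 0 1) (k j)" "finite J"
  shows "fourier_coeff (\<lambda>z. h z + (\<Sum>j\<in>J. b j * k j z)) n = fourier_coeff h n + (\<Sum>j\<in>J. b j * fourier_coeff (k j) n)"
proof -
  have c: "continuous_on (sphere 0 1) (\<lambda>z. b j * k j z)" if "j \<in> J" for j
    by (intro continuous_on_mult_left assms that)
  have "fourier_coeff (\<lambda>z. h z + (\<Sum>j\<in>J. b j * k j z)) n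
      = fourier_coeff h n + fourier_coeff (\<lambda>z. \<Sum>j\<in>J. b j * k j z) n"
    by (intro fourier_coeff_add assms continuous_on_sum c)
  also have "fourier_coeff (\<lambda>z. \<Sum>j\<in>J. b j * k j z) n = (\<Sum>j\<in>J. fourier_coeff (\<lambda>z. b j * k j z) n)"
    by (intro fourier_coeff_sum assms c)
  also have "\<dots> = (\<Sum>j\<in>J. b j * fourier_coeff (k j) n)"
    by (intro sum.cong refl fourier_coeff_cmult assms)
  finally show ?thesis .
qed

text \<open>The two versions match the different pole terms of \<open>q1\<close> and
  \<open>q2\<close>: lacking the factor z, 1/(z - c) is z^(-1) times the Cauchy kernel, which raises
  the index from 0 to 1.\<close>

lemma fourier_coeff_partial_fractions:
  fixes b c :: "nat \<Rightarrow> complex"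
  assumes f: "continuous_on (sphere 0 1) f" and c: "\<And>j. j \<in> J \<Longrightarrow> norm (c j) \<noteq> 1" and J: "finite J"
  shows "fourier_coeff (\<lambda>z. (a0 + a1 * z + b0 / z + (\<Sum>j\<in>J. b j * z / (z - c j))) * f z) 0 =
      a0 * fourier_coeff f 0 + a1 * fourier_coeff f (-1) + b0 * fourier_coeff f 1
      + (\<Sum>j\<in>J. b j * fourier_coeff (\<lambda>z. f z * (z / (z - c j))) 0)" (is ?thesis1)
    and "fourier_coeff (\<lambda>z. (a0 + a1 * z + b0 / z + (\<Sum>j\<in>J. b j / (z - c j))) * f z) 0 =
      a0 * fourier_coeff f 0 + a1 * fourier_coeff f (-1) + b0 * fourier_coeff f 1
      + (\<Sum>j\<in>J. b j * fourier_coeff (\<lambda>z. f z * (z / (z - c j))) 1)" (is ?thesis2)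
proof -
  have k: "continuous_on (sphere 0 1) (\<lambda>z. f z * (z / (z - c j)))" if "j \<in> J" for j
    by (intro continuous_on_mult f continuous_on_cauchy_kernel c that)
  have pk: "continuous_on (sphere 0 1) (\<lambda>z. z powi n * g z)" if "continuous_on (sphere 0 1) g" for n and g :: "complex \<Rightarrow> complex"
    by (intro continuous_intros that) auto
  define h where "h = (\<lambda>z. a0 * f z + a1 * (z powi 1 * f z) + b0 * (z powi (-1) * f z))"
  have h: "continuous_on (sphere 0 1) h"
    unfolding h_def by (intro continuous_intros f pk)
  have h0: "fourier_coeff h 0 = a0 * fourier_coeff f 0 + a1 * fourier_coeff f (-1) + b0 * fourier_coeff f 1"
    unfolding h_def
    by (subst fourier_coeff_add fourier_coeff_cmult | (intro continuous_intros f pk; fail))+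
      (simp add: fourier_coeff_power_int del: power_int_1_right power_int_minus1_right)
  have h_eq: "(a0 + a1 * z + b0 / z + S) * f z = h z + S * f z" for z S
    by (simp add: h_def power_int_minus divide_inverse algebra_simps)
  have "fourier_coeff (\<lambda>z. (a0 + a1 * z + b0 / z + (\<Sum>j\<in>J. b j * z / (z - c j))) * f z) 0
     = fourier_coeff (\<lambda>z. h z + (\<Sum>j\<in>J. b j * (f z * (z / (z - c j))))) 0"
    unfolding h_eq sum_distrib_right by (intro fourier_coeff_cong) (simp add: mult_ac)
  then show ?thesis1
    by (simp only: fourier_coeff_linear_combination[OF h k J] h0)
  have "fourier_coeff (\<lambda>z. (a0 + a1 * z + b0 / z + (\<Sum>j\<in>J. b j / (z - c j))) * f z) 0
     = fourier_coeff (\<lambda>z. h z + (\<Sum>j\<in>J. b j * (z powi (-1) * (f z * (z / (z - c j)))))) 0"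
  proof (rule fourier_coeff_cong)
    fix z :: complex assume "norm z = 1"
    then have "z \<noteq> 0" by auto
    then show "(a0 + a1 * z + b0 / z + (\<Sum>j\<in>J. b j / (z - c j))) * f z = h z + (\<Sum>j\<in>J. b j * (z powi (-1) * (f z * (z / (z - c j)))))"
      unfolding h_eq sum_distrib_right by (simp add: power_int_minus field_simps)
  qed
  also have "\<dots> = fourier_coeff h 0 + (\<Sum>j\<in>J. b j * fourier_coeff (\<lambda>z. z powi (-1) * (f z * (z / (z - c j)))) 0)"
    by (intro fourier_coeff_linear_combination h J pk k)
  finally show ?thesis2
    by (simp only: h0 fourier_coeff_power_int) simp
qed

context szego_symbol
begin

lemma continuous_on_exp_A: "continuous_on (sphere 0 1) (\<lambda>z. exp (t * A z))"
  by (intro continuous_intros continuous_on_A)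

lemma continuous_on_exp_B_inverse: "continuous_on (sphere 0 1) (\<lambda>z. exp (t * B (inverse z)))"
  by (intro continuous_intros continuous_on_B_inverse)

text \<open>An outer pole would pick negative coefficients of \<open>f\<^sub>+\<close>, which are
  all zero; hence only inner poles of \<open>q1\<close> contribute to F.\<close>

lemma kernel_exp_A:
  "norm c < 1 \<Longrightarrow> fourier_coeff (\<lambda>z. exp (1 * A z) * (z / (z - c))) 0 = exp (A c)"
  "norm c > 1 \<Longrightarrow> fourier_coeff (\<lambda>z. exp (1 * A z) * (z / (z - c))) 0 = 0"
proof -
  assume c: "norm c < 1"
  then have "norm c < R" using A.R by simp
  from A.exp_fps_sums[OF this, of 1] fourier_coeff_cauchy_kernel_inside[OF continuous_on_exp_A c, of 1 0]
  show "fourier_coeff (\<lambda>z. exp (1 * A z) * (z / (z - c))) 0 = exp (A c)"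
    unfolding fourier_coeff_exp_A by (intro sums_unique2) (auto simp: mult.commute)
next
  assume c: "norm c > 1"
  from fourier_coeff_cauchy_kernel_outside[OF continuous_on_exp_A c, of 1 0]
  show "fourier_coeff (\<lambda>z. exp (1 * A z) * (z / (z - c))) 0 = 0"
    unfolding fourier_coeff_exp_A by (simp add: sums_iff)
qed

text \<open>Dually, at index 1 an inner pole picks only positive coefficients of the reciprocal of
  \<open>f\<^sub>-\<close>, which vanish; hence only outer poles of \<open>q2\<close> contribute to
  F.\<close>

lemma kernel_exp_B_inverse:
  "norm c < 1 \<Longrightarrow> fourier_coeff (\<lambda>z. exp (- 1 * B (inverse z)) * (z / (z - c))) 1 = 0"
  "norm c > 1 \<Longrightarrow> fourier_coeff (\<lambda>z. exp (- 1 * B (inverse z)) * (z / (z - c))) 1 = - (exp (- B (inverse c)) / c)"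
proof -
  assume c: "norm c < 1"
  from fourier_coeff_cauchy_kernel_inside[OF continuous_on_exp_B_inverse c, of "- 1" 1]
  show "fourier_coeff (\<lambda>z. exp (- 1 * B (inverse z)) * (z / (z - c))) 1 = 0"
    unfolding fourier_coeff_exp_B_inverse by (simp add: sums_iff)
next
  assume c: "norm c > 1"
  have ic: "norm (inverse c) < R"
    using c A.R by (simp add: norm_inverse) (smt (verit) inverse_less_1_iff)
  have "(\<lambda>l. - inverse c * (fps_nth (exp_fps B (- 1)) l * inverse c ^ l)) sums (- inverse c * exp (- 1 * B (inverse c)))"
    by (intro sums_mult B.exp_fps_sums ic)
  with fourier_coeff_cauchy_kernel_outside[OF continuous_on_exp_B_inverse c, of "- 1" 1]
  show "fourier_coeff (\<lambda>z. exp (- 1 * B (inverse z)) * (z / (z - c))) 1 = - (exp (- B (inverse c)) / c)"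
    unfolding fourier_coeff_exp_B_inverse by (simp add: sums_iff mult_ac divide_inverse)
qed

text \<open>The series is the zeroth coefficient of \<psi> divided by \<open>f\<^sub>-\<close>. The
  division cancels \<open>f\<^sub>-\<close> in the term with \<phi>, leaving \<open>q1\<close> times
  \<open>f\<^sub>+\<close>, and puts its reciprocal next to \<open>q2\<close>.\<close>

lemma suminf_coeffs_eq:
  assumes \<psi>: "continuous_on (sphere 0 1) \<psi>"
    and "\<And>z. norm z = 1 \<Longrightarrow> \<psi> z = q1 z * \<phi> z + q2 z"
    and q1: "continuous_on (sphere 0 1) q1" and q2: "continuous_on (sphere 0 1) q2"
  shows "(\<Sum>l. fps_nth (exp_fps B (- 1)) l * fourier_coeff \<psi> (int l)) =
    exp l0 * fourier_coeff (\<lambda>z. q1 z * exp (1 * A z)) 0 + fourier_coeff (\<lambda>z. q2 z * exp (- 1 * B (inverse z))) 0"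
proof -
  have "(\<lambda>l. fps_nth (exp_fps B (- 1)) l * fourier_coeff \<psi> (0 - - int l)) sums
      fourier_coeff (\<lambda>z. \<psi> z * exp (- 1 * B (inverse z))) 0"
  proof (rule fourier_coeff_mult_series[OF \<psi>])
    fix z :: complex assume "norm z = 1"
    then show "(\<lambda>l. fps_nth (exp_fps B (- 1)) l * z powi - int l) sums exp (- 1 * B (inverse z))"
      using B.exp_fps_sums[OF norm_less_R(2), of z "- 1"] by (simp add: power_int_minus power_inverse)
  qed (rule summable_norm_coeffs)
  then have "(\<Sum>l. fps_nth (exp_fps B (- 1)) l * fourier_coeff \<psi> (int l)) = fourier_coeff (\<lambda>z. \<psi> z * exp (- 1 * B (inverse z))) 0"
    by (simp add: sums_iff)
  also have "\<dots> = fourier_coeff (\<lambda>z. exp l0 * (q1 z * exp (1 * A z)) + q2 z * exp (- 1 * B (inverse z))) 0"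
    by (rule fourier_coeff_cong) (simp add: assms(2) symbol_eq algebra_simps exp_minus)
  also have "\<dots> = exp l0 * fourier_coeff (\<lambda>z. q1 z * exp (1 * A z)) 0 + fourier_coeff (\<lambda>z. q2 z * exp (- 1 * B (inverse z))) 0"
    by (simp only: fourier_coeff_add fourier_coeff_cmult continuous_on_mult continuous_on_const q1 q2
        continuous_on_exp_A continuous_on_exp_B_inverse)
  finally show ?thesis .
qed

text \<open>Two exponentially small errors are added: the bordered determinant against X times the
  Toeplitz determinant, and the latter against its limit exp \<kappa>. After division by G^N E
  exactly X remains.\<close>

lemma bordered_asymp:
  assumes s1: "0 < s1" "s1 < 1" and \<psi>: "\<And>n. norm (fourier_coeff \<psi> (int n)) \<le> C1 * s1 ^ n"
  defines "X \<equiv> exp (- l0) * (\<Sum>l. fps_nth (exp_fps B (- 1)) l * fourier_coeff \<psi> (int l))"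
  shows "\<exists>q D. 0 < q \<and> q < 1 \<and> (\<forall>N>1. norm (bordered_toeplitz_det N \<phi> \<psi> / (szego_G \<phi> ^ N * szego_E \<phi>) - X) \<le> D * q ^ N)"
proof -
  define \<Psi>0 where "\<Psi>0 = Abs_fps (\<lambda>n. fourier_coeff \<psi> (int n))"
  define \<Psi> where "\<Psi> = fps_const (exp (- l0)) * \<Psi>0"
  define p where "p = exp_fps A 1"
  define p' where "p' = exp_fps A (- 1)"
  define m where "m = exp_fps B 1"
  define m' where "m' = exp_fps B (- 1)"
  \<comment> \<open>The coefficients of \<psi> may decay more slowly than those of the factors, for
    instance because of poles close to the circle; a common rate is fixed.\<close>
  define s2 where "s2 = max s s1"
  have s2: "0 < s2" "s2 < 1" "s \<le> s2" "s1 \<le> s2" using s s1 by (auto simp: s2_def)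
  obtain C where C: "geom_bdd C s p" "geom_bdd C s p'" "geom_bdd C s m" "geom_bdd C s m'"
    unfolding p_def p'_def m_def m'_def using common_bound by metis
  have "geom_bdd C1 s1 \<Psi>0" using \<psi> by (simp add: geom_bdd_def \<Psi>0_def)
  then have "geom_bdd (norm (exp (- l0)) * C1) s1 \<Psi>"
    unfolding \<Psi>_def by (rule geom_bdd_const_mult)
  then have g\<Psi>: "geom_bdd (norm (exp (- l0)) * C1) s2 \<Psi>"
    by (rule geom_bdd_mono_rate) (use s1 s2 in auto)
  define C2 where "C2 = max C (norm (exp (- l0)) * C1)"
  have b: "geom_bdd C2 s2 p" "geom_bdd C2 s2 p'" "geom_bdd C2 s2 m" "geom_bdd C2 s2 m'" "geom_bdd C2 s2 \<Psi>"
  proof -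
    have "C \<le> C2" "norm (exp (- l0)) * C1 \<le> C2" "0 \<le> s2" using s2 by (auto simp: C2_def)
    then show "geom_bdd C2 s2 p" "geom_bdd C2 s2 p'" "geom_bdd C2 s2 m" "geom_bdd C2 s2 m'" "geom_bdd C2 s2 \<Psi>"
      using geom_bdd_mono[OF geom_bdd_mono_rate[OF _ s(2) s2(3)]] C geom_bdd_mono[OF g\<Psi>] by blast+
  qed
  obtain q D where q: "0 < q" "q < 1" and D: "\<And>n. n > 0 \<Longrightarrow> norm (fdet n (\<lambda>j k. if k = 0 then fps_nth \<Psi> j else toep p m j k)
     - (\<Sum>l. fps_nth m' l * fps_nth \<Psi> l) * fdet n (toep p m)) \<le> D * q ^ n"
  proof -
    have "p * p' = 1" "m * m' = 1" "fps_nth p 0 = 1" "fps_nth m 0 = 1"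
      unfolding p_def p'_def m_def m'_def
      by (rule A.exp_fps_uminus B.exp_fps_uminus A.exp_fps_nth_0 B.exp_fps_nth_0)+
    from fdet_first_col_asymp[OF s2(1,2) b this] that show ?thesis by blast
  qed
  have X: "(\<Sum>l. fps_nth m' l * fps_nth \<Psi> l) = X"
  proof -
    have "summable (\<lambda>l. fps_nth m' l * fps_nth \<Psi>0 l)"
    proof (rule summable_norm_cancel, rule summable_comparison_test')
      show "summable (\<lambda>l. norm (fps_nth m' l) * \<bar>C1\<bar>)"
        unfolding m'_def by (intro summable_mult2 summable_norm_coeffs)
      fix n :: nat
      have "norm (fps_nth \<Psi>0 n) \<le> \<bar>C1\<bar> * 1"
        using order.trans[OF \<psi>[of n] mult_mono[of C1 "\<bar>C1\<bar>" "s1 ^ n" 1]] s1 by (simp add: \<Psi>0_def power_le_one)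
      then show "norm (norm (fps_nth m' n * fps_nth \<Psi>0 n)) \<le> norm (fps_nth m' n) * \<bar>C1\<bar>"
        by (simp add: norm_mult mult_left_mono)
    qed
    then have "(\<Sum>l. exp (- l0) * (fps_nth m' l * fps_nth \<Psi>0 l)) = X"
      by (subst suminf_mult) (simp_all add: X_def m'_def \<Psi>0_def)
    then show ?thesis by (simp add: \<Psi>_def mult_ac)
  qed
  obtain D2 where D2: "\<And>N. norm (fdet N (toep p m) - exp \<kappa>) \<le> D2 * r ^ N"
    using fdet_toep_rate[of 1 1] unfolding p_def m_def S_1_1 by blast
  define q' where "q' = max q r"
  have q': "0 < q'" "q' < 1" using q r by (auto simp: q'_def)
  define D' where "D' = (\<bar>D\<bar> + norm X * \<bar>D2\<bar>) / norm (exp \<kappa>)"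
  have "norm (bordered_toeplitz_det N \<phi> \<psi> / (szego_G \<phi> ^ N * szego_E \<phi>) - X) \<le> D' * q' ^ N" if N: "N > 1" for N
  proof -
    define d where "d = fdet N (\<lambda>j k. if k = 0 then fps_nth \<Psi> j else toep p m j k)"
    have "bordered_toeplitz_det N \<phi> \<psi> = exp l0 ^ N * d"
      unfolding bordered_toeplitz_det_eq[OF N] d_def p_def m_def \<Psi>_def \<Psi>0_def
      by (intro arg_cong[where f = "\<lambda>x. exp l0 ^ N * x"] fdet_cong) simp
    then have "bordered_toeplitz_det N \<phi> \<psi> / (szego_G \<phi> ^ N * szego_E \<phi>) - X = (d - X * exp \<kappa>) / exp \<kappa>"
      by (simp add: szego_G_eq szego_E_eq diff_divide_distrib)
    also have "norm \<dots> = norm ((d - X * fdet N (toep p m)) + X * (fdet N (toep p m) - exp \<kappa>)) / norm (exp \<kappa>)"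
    proof -
      have "d - X * exp \<kappa> = (d - X * fdet N (toep p m)) + X * (fdet N (toep p m) - exp \<kappa>)"
        by (simp add: right_diff_distrib)
      then show ?thesis by (simp only: norm_divide)
    qed
    also have "\<dots> \<le> ((\<bar>D\<bar> + norm X * \<bar>D2\<bar>) * q' ^ N) / norm (exp \<kappa>)"
    proof (rule divide_right_mono)
      have qN: "q ^ N \<le> q' ^ N" "r ^ N \<le> q' ^ N" using q r by (auto simp: q'_def intro!: power_mono)
      have DD: "D * q ^ N \<le> \<bar>D\<bar> * q' ^ N" "D2 * r ^ N \<le> \<bar>D2\<bar> * q' ^ N"
        using q r by (intro mult_mono qN; simp)+
      have "norm (d - X * fdet N (toep p m)) \<le> D * q ^ N"
        using D[of N] N unfolding X d_def by simp
      then have "norm (d - X * fdet N (toep p m)) \<le> \<bar>D\<bar> * q' ^ N"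
        using DD(1) by (rule order.trans)
      moreover have "norm (X * (fdet N (toep p m) - exp \<kappa>)) \<le> norm X * (\<bar>D2\<bar> * q' ^ N)"
        unfolding norm_mult by (intro mult_left_mono order.trans[OF D2 DD(2)] norm_ge_zero)
      ultimately have "norm (d - X * fdet N (toep p m)) \<le> \<bar>D\<bar> * q' ^ N"
        "norm (X * (fdet N (toep p m) - exp \<kappa>)) \<le> norm X * (\<bar>D2\<bar> * q' ^ N)" by -
      then show "norm ((d - X * fdet N (toep p m)) + X * (fdet N (toep p m) - exp \<kappa>)) \<le> (\<bar>D\<bar> + norm X * \<bar>D2\<bar>) * q' ^ N"
        using norm_triangle_ineq[of "d - X * fdet N (toep p m)" "X * (fdet N (toep p m) - exp \<kappa>)"]
        by (simp add: distrib_right mult.assoc)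
    qed simp
    finally show ?thesis by (simp add: D'_def)
  qed
  then show ?thesis using q' by blast
qed

end

text \<open>Only indices n >= 0 are treated, as the border contains no others; there the part in
  powers of 1/z is invisible, its constant term being zero.\<close>

lemma fourier_coeff_geometric_decay:
  assumes "open U" "sphere 0 1 \<subseteq> U" "g holomorphic_on U" and eq: "\<And>z. norm z = 1 \<Longrightarrow> g z = \<psi> z"
  shows "\<exists>C s. 0 < s \<and> s < 1 \<and> (\<forall>n. norm (fourier_coeff \<psi> (int n)) \<le> C * s ^ n)"
proof -
  obtain R where R: "1 < R" "{z. 1 / R < norm z \<and> norm z < R} \<subseteq> U"
    using open_superset_sphere_contains_annulus[OF assms(1,2)] by blast
  obtain a b C s where s: "0 < s" "s < 1" and a: "geom_bdd C s a" and b: "geom_bdd C s b" "fps_nth b 0 = 0"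
    and L: "\<And>z. norm z = 1 \<Longrightarrow> g z = (\<Sum>n. fps_nth a n * z ^ n) + (\<Sum>n. fps_nth b n * inverse z ^ n)"
    using annulus_laurent_series[OF R(1) holomorphic_on_subset[OF assms(3) R(2)]] by blast
  have s': "0 \<le> s" using s by simp
  note sa = geom_bdd_summable_norm[OF a s' s(2)] and sb = geom_bdd_summable_norm[OF b(1) s' s(2)]
  have sms: "(\<lambda>n. fps_nth f n * w ^ n) sums eval_fps f w" if "summable (\<lambda>n. norm (fps_nth f n))" "norm w = 1" for f and w :: complex
  proof -
    have "summable (\<lambda>n. norm (fps_nth f n * w ^ n))"
      using that by (simp add: norm_mult norm_power)
    then show ?thesis
      unfolding eval_fps_def by (rule summable_sums[OF summable_norm_cancel])
  qed
  have sma: "(\<lambda>n. fps_nth a n * z ^ n) sums eval_fps a z" and smb: "(\<lambda>n. fps_nth b n * inverse z ^ n) sums eval_fps b (inverse z)"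
    if "norm z = 1" for z
    using sms[OF sa that] sms[OF sb, of "inverse z"] that by (simp_all add: norm_inverse)
  have sub: "sphere 0 1 \<subseteq> ball (0::complex) (1 / s)" using s by auto
  have ca: "continuous_on (sphere 0 1) (eval_fps a)"
    by (rule continuous_on_subset[OF holomorphic_on_imp_continuous_on[OF holomorphic_on_eval_fps_ball[OF a s(1)]] sub])
  have cb: "continuous_on (sphere 0 1) (\<lambda>z. eval_fps b (inverse z))"
  proof (rule continuous_on_compose2[OF continuous_on_subset[OF holomorphic_on_imp_continuous_on[OF holomorphic_on_eval_fps_ball[OF b(1) s(1)]] sub]])
    show "continuous_on (sphere 0 1) (inverse :: complex \<Rightarrow> complex)"
      by (intro continuous_intros) auto
  qed (auto simp: norm_inverse)
  have "fourier_coeff \<psi> (int n) = fps_nth a n" for n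
  proof -
    have "fourier_coeff \<psi> (int n) = fourier_coeff (\<lambda>z. eval_fps a z + eval_fps b (inverse z)) (int n)"
      using L eq by (intro fourier_coeff_cong) (simp add: eval_fps_def)
    also have "\<dots> = fourier_coeff (eval_fps a) (int n) + fourier_coeff (\<lambda>z. eval_fps b (inverse z)) (int n)"
      by (rule fourier_coeff_add[OF ca cb])
    also have "fourier_coeff (eval_fps a) (int n) = fps_nth a n"
      by (subst fourier_coeff_power_series[OF sa sma]) auto
    also have "fourier_coeff (\<lambda>z. eval_fps b (inverse z)) (int n) = 0"
      by (subst fourier_coeff_inverse_power_series[OF sb smb]) (auto simp: b(2))
    finally show ?thesis by simp
  qed
  then show ?thesis using s geom_bddD[OF a] by auto
qed

theorem theorem1p1:
  fixes \<phi> q1 q2 \<psi> :: "complex \<Rightarrow> complex"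
    and m :: nat
    and a0 a1 a0' a1' :: complex
    and b b' c :: "nat \<Rightarrow> complex"
    and F :: complex
  assumes "szego_type \<phi>"
    and "\<And>j. j \<in> {1..m} \<Longrightarrow> c j \<noteq> 0"
    and "\<And>j. j \<in> {1..m} \<Longrightarrow> norm (c j) \<noteq> 1"
    and "\<And>z. z \<in> sphere 0 1 \<Longrightarrow>
           q1 z = a0 + a1 * z + b 0 / z + (\<Sum>j=1..m. b j * z / (z - c j))"
    and "\<And>z. z \<in> sphere 0 1 \<Longrightarrow>
           q2 z = a0' + a1' * z + b' 0 / z + (\<Sum>j=1..m. b' j / (z - c j))"
    and "\<And>z. z \<in> sphere 0 1 \<Longrightarrow> \<psi> z = q1 z * \<phi> z + q2 z"
    and "F = a0 + b 0 * fourier_coeff (circle_log \<phi>) 1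
           + (\<Sum>j | j \<in> {1..m} \<and> 0 < norm (c j) \<and> norm (c j) < 1.
                b j * (szego_alpha \<phi> (c j) / szego_alpha \<phi> 0))
           + 1 / szego_alpha \<phi> 0 *
             (a0' - a1' * fourier_coeff (circle_log \<phi>) (-1)
              - (\<Sum>j | j \<in> {1..m} \<and> norm (c j) > 1. b' j / c j * szego_alpha \<phi> (c j)))"
  shows "\<exists>\<cc>>0. \<exists>R :: nat \<Rightarrow> complex.
           R \<in> O(\<lambda>N. of_real (exp (- \<cc> * real N))) \<and>
           (\<forall>N>1. bordered_toeplitz_det N \<phi> \<psi> = szego_G \<phi> ^ N * szego_E \<phi> * (F + R N))"
proof -
  obtain A B Rad l0 where dp: "disc_pair A B Rad"
    and split: "\<And>z. norm z = 1 \<Longrightarrow> circle_log \<phi> z = l0 + A z + B (inverse z)"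
    using szego_log_splitting[OF assms(1)] by blast
  interpret disc_pair A B Rad by (rule dp)
  interpret szego_symbol A B Rad \<phi> l0
    by unfold_locales (use circle_log[OF assms(1)] split in auto)
  define Q1 where "Q1 = (\<lambda>z. a0 + a1 * z + b 0 / z + (\<Sum>j\<in>{1..m}. b j * z / (z - c j)))"
  define Q2 where "Q2 = (\<lambda>z. a0' + a1' * z + b' 0 / z + (\<Sum>j\<in>{1..m}. b' j / (z - c j)))"
  have Q: "q1 z = Q1 z" "q2 z = Q2 z" "\<psi> z = Q1 z * \<phi> z + Q2 z" if "norm z = 1" for z
    using that assms(4-6)[of z] by (auto simp: Q1_def Q2_def)
  obtain U g where U: "open U" "sphere 0 1 \<subseteq> U" "g holomorphic_on U" "\<And>z. z \<in> sphere 0 1 \<Longrightarrow> g z = \<phi> z"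
    using assms(1) unfolding szego_type_def by blast
  \<comment> \<open>Removing 0 and the poles leaves a neighbourhood of the circle, as no
    \<open>c j\<close> lies on it; there \<psi> extends holomorphically.\<close>
  define V where "V = U - insert 0 (c ` {1..m})"
  have V: "open V" "sphere 0 1 \<subseteq> V" "V \<subseteq> U"
    using U(1,2) assms(3) by (auto simp: V_def intro!: open_Diff finite_imp_closed)
  have Vz: "z \<noteq> 0" "\<And>j. j \<in> {1..m} \<Longrightarrow> z - c j \<noteq> 0" if "z \<in> V" for z
    using that by (auto simp: V_def)
  have holQ: "Q1 holomorphic_on V" "Q2 holomorphic_on V"
    unfolding Q1_def Q2_def using Vz by (auto intro!: holomorphic_intros)
  define \<Psi> where "\<Psi> = (\<lambda>z. Q1 z * g z + Q2 z)"
  have hol\<Psi>: "\<Psi> holomorphic_on V"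
    unfolding \<Psi>_def by (intro holomorphic_intros holQ holomorphic_on_subset[OF U(3) V(3)])
  have \<Psi>: "\<Psi> z = \<psi> z" if "norm z = 1" for z
    using that Q(3)[of z] U(4)[of z] by (simp add: \<Psi>_def)
  obtain C1 s1 where s1: "0 < s1" "s1 < 1" and decay: "\<And>n. norm (fourier_coeff \<psi> (int n)) \<le> C1 * s1 ^ n"
    using fourier_coeff_geometric_decay[OF V(1,2) hol\<Psi> \<Psi>] by blast
  have contQ: "continuous_on (sphere 0 1) Q1" "continuous_on (sphere 0 1) Q2"
    using holQ V(2) by (auto intro: continuous_on_subset[OF holomorphic_on_imp_continuous_on])
  have cont\<psi>: "continuous_on (sphere 0 1) \<psi>"
    using continuous_on_subset[OF holomorphic_on_imp_continuous_on[OF hol\<Psi>] V(2)] \<Psi>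
    by (subst continuous_on_cong[OF refl, of _ _ \<Psi>]) auto
  have alpha0: "szego_alpha \<phi> 0 = exp l0"
    using szego_alpha_inside[of 0] by (simp add: A.A0)
  have B1: "fps_nth (exp_fps B (- 1)) 1 = - fps_nth Bc 1"
    using B.exp_fps_nth_1[of "- 1"] by simp
  have P1: "fourier_coeff (\<lambda>z. Q1 z * exp (1 * A z)) 0 = a0 + b 0 * fourier_coeff (circle_log \<phi>) 1
      + (\<Sum>j | j \<in> {1..m} \<and> 0 < norm (c j) \<and> norm (c j) < 1. b j * (szego_alpha \<phi> (c j) / szego_alpha \<phi> 0))"
  proof -
    have "(\<Sum>j\<in>{1..m}. b j * fourier_coeff (\<lambda>z. exp (1 * A z) * (z / (z - c j))) 0)
      = (\<Sum>j | j \<in> {1..m} \<and> 0 < norm (c j) \<and> norm (c j) < 1. b j * (szego_alpha \<phi> (c j) / szego_alpha \<phi> 0))"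
    proof (rule sum.mono_neutral_cong_right)
      \<comment> \<open>Since the \<open>c j\<close> are nonzero and off the circle, the indices
        left out of the sum in F are exactly those of the outer poles.\<close>
      show "\<forall>j\<in>{1..m} - {j. j \<in> {1..m} \<and> 0 < norm (c j) \<and> norm (c j) < 1}.
          b j * fourier_coeff (\<lambda>z. exp (1 * A z) * (z / (z - c j))) 0 = 0"
      proof
        fix j assume "j \<in> {1..m} - {j. j \<in> {1..m} \<and> 0 < norm (c j) \<and> norm (c j) < 1}"
        then have "norm (c j) > 1" using assms(2,3)[of j] by auto
        then show "b j * fourier_coeff (\<lambda>z. exp (1 * A z) * (z / (z - c j))) 0 = 0"
          by (simp only: kernel_exp_A(2) mult_zero_right)
      qed
    next
      fix j assume "j \<in> {j. j \<in> {1..m} \<and> 0 < norm (c j) \<and> norm (c j) < 1}"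
      then have c1: "norm (c j) < 1" by auto
      then show "b j * fourier_coeff (\<lambda>z. exp (1 * A z) * (z / (z - c j))) 0 = b j * (szego_alpha \<phi> (c j) / szego_alpha \<phi> 0)"
        by (simp only: kernel_exp_A(1) szego_alpha_inside alpha0) (simp add: exp_add)
    qed auto
    \<comment> \<open>As \<open>A\<close> vanishes at 0, \<open>f\<^sub>+\<close> and its logarithm
      \<open>A\<close> share their first coefficient; this is where the \<open>b 0\<close> term of F
      comes from. The \<open>a1\<close> term meets the coefficient of index -1, which is
      zero.\<close>
    moreover have "fourier_coeff (circle_log \<phi>) 1 = fourier_coeff (\<lambda>z. exp (1 * A z)) 1"
      using A.exp_fps_nth_1[of 1] by (simp only: fourier_coeff_log fourier_coeff_exp_A) simp
    moreover have "fourier_coeff (\<lambda>z. exp (1 * A z)) 0 = 1" "fourier_coeff (\<lambda>z. exp (1 * A z)) (- 1) = 0"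
      by (simp_all only: fourier_coeff_exp_A) (simp_all add: A.exp_fps_nth_0)
    ultimately show ?thesis
      unfolding Q1_def
      by (subst fourier_coeff_partial_fractions(1)[OF continuous_on_exp_A]) (use assms(3) in simp_all)
  qed
  have P2: "fourier_coeff (\<lambda>z. Q2 z * exp (- 1 * B (inverse z))) 0 = a0' - a1' * fourier_coeff (circle_log \<phi>) (-1)
      - (\<Sum>j | j \<in> {1..m} \<and> norm (c j) > 1. b' j / c j * szego_alpha \<phi> (c j))"
  proof -
    have "(\<Sum>j\<in>{1..m}. b' j * fourier_coeff (\<lambda>z. exp (- 1 * B (inverse z)) * (z / (z - c j))) 1)
      = (\<Sum>j | j \<in> {1..m} \<and> norm (c j) > 1. - (b' j / c j * szego_alpha \<phi> (c j)))"
    proof (rule sum.mono_neutral_cong_right)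
      show "\<forall>j\<in>{1..m} - {j. j \<in> {1..m} \<and> norm (c j) > 1}.
          b' j * fourier_coeff (\<lambda>z. exp (- 1 * B (inverse z)) * (z / (z - c j))) 1 = 0"
      proof
        fix j assume "j \<in> {1..m} - {j. j \<in> {1..m} \<and> norm (c j) > 1}"
        then have "norm (c j) < 1" using assms(3)[of j] by auto
        then show "b' j * fourier_coeff (\<lambda>z. exp (- 1 * B (inverse z)) * (z / (z - c j))) 1 = 0"
          by (simp only: kernel_exp_B_inverse(1) mult_zero_right)
      qed
    next
      fix j assume "j \<in> {j. j \<in> {1..m} \<and> norm (c j) > 1}"
      then have c1: "norm (c j) > 1" by auto
      then show "b' j * fourier_coeff (\<lambda>z. exp (- 1 * B (inverse z)) * (z / (z - c j))) 1 = - (b' j / c j * szego_alpha \<phi> (c j))"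
        by (simp only: kernel_exp_B_inverse(2) szego_alpha_outside) simp
    qed auto
    \<comment> \<open>The reciprocal of \<open>f\<^sub>-\<close> has logarithm -B(1/z), hence the
      minus sign at \<open>a1'\<close> in F.\<close>
    moreover have "fourier_coeff (circle_log \<phi>) (-1) = - fourier_coeff (\<lambda>z. exp (- 1 * B (inverse z))) (-1)"
      using B1 by (simp only: fourier_coeff_log fourier_coeff_exp_B_inverse) simp
    moreover have "fourier_coeff (\<lambda>z. exp (- 1 * B (inverse z))) 0 = 1" "fourier_coeff (\<lambda>z. exp (- 1 * B (inverse z))) 1 = 0"
      by (simp_all only: fourier_coeff_exp_B_inverse) (simp_all add: B.exp_fps_nth_0)
    ultimately show ?thesis
      unfolding Q2_def
      by (subst fourier_coeff_partial_fractions(2)[OF continuous_on_exp_B_inverse]) (use assms(3) in \<open>simp_all add: sum_negf\<close>)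
  qed
  have sum_eq: "(\<Sum>l. fps_nth (exp_fps B (- 1)) l * fourier_coeff \<psi> (int l)) =
     exp l0 * fourier_coeff (\<lambda>z. Q1 z * exp (1 * A z)) 0 + fourier_coeff (\<lambda>z. Q2 z * exp (- 1 * B (inverse z))) 0"
    by (rule suminf_coeffs_eq[OF cont\<psi> Q(3) contQ])
  have cancel: "exp (- l0) * (exp l0 * x + y) = x + 1 / exp l0 * y" for x y
    by (simp add: exp_minus field_simps)
  have X: "exp (- l0) * (\<Sum>l. fps_nth (exp_fps B (- 1)) l * fourier_coeff \<psi> (int l)) = F"
    unfolding sum_eq cancel P1 P2 assms(7) alpha0 by (rule refl)
  obtain q D where q: "0 < q" "q < 1"
    and D: "\<And>N. N > 1 \<Longrightarrow> norm (bordered_toeplitz_det N \<phi> \<psi> / (szego_G \<phi> ^ N * szego_E \<phi>) - F) \<le> D * q ^ N"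
    using bordered_asymp[OF s1 decay] unfolding X by blast
  define Rm where "Rm N = bordered_toeplitz_det N \<phi> \<psi> / (szego_G \<phi> ^ N * szego_E \<phi>) - F" for N
  \<comment> \<open>The constant of the theorem is -ln q, so that the exponential is
    \<open>q ^ N\<close>. \<open>Rm\<close> is defined by solving the asserted equation, which is
    possible because G and E are exponentials and so nonzero.\<close>
  have "Rm \<in> O(\<lambda>N. of_real (exp (- (- ln q) * real N)))"
  proof (rule bigoI[of _ D], rule eventually_sequentiallyI[of 2])
    fix N :: nat assume "2 \<le> N"
    moreover have "exp (- (- ln q) * real N) = q ^ N"
      using q by (simp add: exp_of_nat2_mult)
    ultimately show "norm (Rm N) \<le> D * norm (of_real (exp (- (- ln q) * real N)) :: complex)"
      using D[of N] q by (simp add: Rm_def norm_power)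
  qed
  moreover have "bordered_toeplitz_det N \<phi> \<psi> = szego_G \<phi> ^ N * szego_E \<phi> * (F + Rm N)" for N
    by (simp add: Rm_def szego_G_eq szego_E_eq)
  moreover have "- ln q > 0" using q by simp
  ultimately show ?thesis by blast
qed

end
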